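(* Let $n\ge 31$. Let $S_n=\{P_n(2,a,b)\mid a+b=n-3,\ 1\le a\le b\}$ and let $S_n'=S_n\setminus\{P_n(2,5,n-8),P_n(2,3,n-6),P_n(2,1,n-4)\}$ (so $S_n'$ consists of $\lfloor\frac{n-9}{2}\rfloor$ trees). Then the path $P_n$ together with the trees in $S_n'$ are the first $\lfloor\frac{n-7}{2}\rfloor$ largest energy trees among all trees of order $n$; that is, for every tree $T$ of order $n$ that is not isomorphic to $P_n$ or to a member of $S_n'$, we have $\mathbb{E}(T)<\mathbb{E}(T')$ for every $T'\in\{P_n\}\cup S_n'$.
   Context: The energy $\mathbb{E}(G)$ of a graph $G$ is the sum of the absolute values of the eigenvalues of its adjacency matrix. For positive integers $a_1,\dots,a_k$ ($k\ge 3$) with $a_1+\cdots+a_k=n-1$, $P_n(a_1,\dots,a_k)$ denotes the tree of order $n$ consisting of a central vertex with $k$ internally disjoint pendent paths of lengths $a_1,\dots,a_k$ attached to it. $P_n$ denotes the path on $n$ vertices. *)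

theory Defs
  imports
    "HOL-Computational_Algebra.Computational_Algebra"
    "Jordan_Normal_Form.Char_Poly"
    "Graph_Theory.Graph_Theory"
begin

text \<open>
  Finite simple graphs are symmetric loop-free pair digraphs (locale \<open>pair_graph\<close>).  In such a
  digraph every edge gives a directed cycle of length 2, so the library's \<open>forest\<close> and \<open>tree\<close> are
  not the undirected notions; the cycles of the undirected graph are exactly the directed cycles
  of length at least 3.
\<close>

definition undirected_tree :: "'a pair_pre_digraph \<Rightarrow> bool" where
  "undirected_tree G \<longleftrightarrow>
     pair_graph G \<and> Digraph_Component.connected (with_proj G) \<and>
     (\<nexists>p. pre_digraph.cycle (with_proj G) p \<and> length p \<ge> 3)"

definition graph_isomorphic :: "'a pair_pre_digraph \<Rightarrow> 'b pair_pre_digraph \<Rightarrow> bool" where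
  "graph_isomorphic G H \<longleftrightarrow> digraph_iso (with_proj G) (with_proj H)"

definition adjacency_matrix :: "'a pair_pre_digraph \<Rightarrow> 'a list \<Rightarrow> complex mat" where
  "adjacency_matrix G vs =
     mat (length vs) (length vs) (\<lambda>(i, j). if (vs ! i, vs ! j) \<in> parcs G then 1 else 0)"

text \<open>
  The vertices are listed in an arbitrary order; another order conjugates the adjacency matrix by
  a permutation matrix and does not affect its eigenvalues.  Eigenvalues are counted with
  algebraic multiplicity.
\<close>

definition energy :: "'a pair_pre_digraph \<Rightarrow> real" where
  "energy G =
     (let vs = (SOME vs. distinct vs \<and> set vs = pverts G)
      in \<Sum>x\<in>#proots (char_poly (adjacency_matrix G vs)). cmod x)"

definition path_graph :: "nat \<Rightarrow> nat pair_pre_digraph" where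
  "path_graph n =
     \<lparr> pverts = {..<n}, parcs = {(u, v). u < n \<and> v < n \<and> (v = Suc u \<or> u = Suc v)} \<rparr>"

text \<open>
  The tree \<open>P\<^sub>n(a\<^sub>1, \<dots>, a\<^sub>k)\<close> for a list of positive integers, with \<open>n = 1 + a\<^sub>1 + \<dots> + a\<^sub>k\<close>.
  Vertex 0 is the centre, and the \<open>i\<close>-th pendent path occupies the vertices
  \<open>s\<^sub>i + 1, \<dots>, s\<^sub>i + a\<^sub>i\<close>, where \<open>s\<^sub>i = a\<^sub>1 + \<dots> + a\<^bsub>i-1\<^esub>\<close>, in this order, with \<open>s\<^sub>i + 1\<close>
  attached to the centre.
\<close>

definition path_starts :: "nat list \<Rightarrow> nat set" where
  "path_starts as = {Suc (sum_list (take i as)) | i. i < length as}"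

definition pendent_parent :: "nat list \<Rightarrow> nat \<Rightarrow> nat" where
  "pendent_parent as v = (if v \<in> path_starts as then 0 else v - 1)"

definition pendent_paths_tree :: "nat list \<Rightarrow> nat pair_pre_digraph" where
  "pendent_paths_tree as =
     \<lparr> pverts = {0..sum_list as},
       parcs = {(v, pendent_parent as v) | v. v \<in> {1..sum_list as}} \<union>
               {(pendent_parent as v, v) | v. v \<in> {1..sum_list as}} \<rparr>"

definition S_trees :: "nat \<Rightarrow> nat pair_pre_digraph set" where
  "S_trees n = {pendent_paths_tree [2, a, b] | a b. a + b = n - 3 \<and> 1 \<le> a \<and> a \<le> b}"

text \<open>
  Distinct pairs \<open>a \<le> b\<close> give distinct graphs, and for \<open>n \<ge> 13\<close> the three lists below have this
  sorted form, so removing these labelled graphs removes their isomorphism classes.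
\<close>

definition S_trees' :: "nat \<Rightarrow> nat pair_pre_digraph set" where
  "S_trees' n = S_trees n -
     {pendent_paths_tree [2, 5, n - 8], pendent_paths_tree [2, 3, n - 6],
      pendent_paths_tree [2, 1, n - 4]}"

end

theory Submission
  imports "HOL-Analysis.Analysis" "HOL-Real_Asymp.Real_Asymp" Defs
begin

text \<open>
  The energy of a tree is \<open>2 / \<pi>\<close> times the integral of \<open>ln M(1 / y\<^sup>2)\<close> over \<open>y > 0\<close>, where \<open>M\<close> is the
  generating function of the matchings, so trees may be compared through the pointwise order of \<open>M\<close>.
  For a path this is \<open>p\<^sub>n\<close> with \<open>p\<^bsub>n+2\<^esub> = p\<^bsub>n+1\<^esub> + t p\<^sub>n\<close>, and for a spider with legs \<open>a, b, c\<close> it is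
  \<open>p\<^sub>n - t\<^sup>2 p\<^bsub>a-1\<^esub> p\<^bsub>b-1\<^esub> p\<^bsub>c-1\<^esub>\<close>; an identity of d'Ocagne type orders the spiders with a leg of length 2, and
  shows that all other spiders lie below the smallest member \<open>P\<^sub>n(2, 7, n - 10)\<close> of the family or below
  \<open>P\<^sub>n(4, 4, n - 9)\<close>.  For a tree with at least four leaves, a leaf recursion at a deepest vertex bounds
  \<open>M\<close> by an explicit combination of the \<open>p\<^sub>k\<close>.  The last two bounds are not comparable pointwise to
  \<open>P\<^sub>n(2, 7, n - 10)\<close>.  There the quotient of the two polynomials is smallest at \<open>n = 31\<close> for every \<open>t\<close>, and
  the integral of its logarithm at \<open>n = 31\<close> is bounded below by a certified piecewise polynomial.
\<close>

section \<open>Path polynomials\<close>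

text \<open>Why just the legs 1, 3 and 5 are excluded: with one leg of length 2 the spider loses t^2
  p_{a-1} p_{b-1}, and at a fixed sum of indices this product is largest for a - 1 = 0, then for 2,
  4 and 6. The three excluded trees are therefore the bottom of a pointwise chain, and the tree with
  a = 7 is the smallest one left; a single cutoff polynomial stands for the path and for the whole
  family. The obstacle is the behaviour for large t, that is, for small y. At n = 31 the leading
  coefficient of the cutoff polynomial is 15, while it is 16 for both of its competitors. The
  logarithm of the quotient is thus negative near y = 0, and only its integral can be positive.
  Since that integral has no convenient closed form, it is bounded below by exact rational
  arithmetic. One computation covers all n because 31 - 12 = 19 is odd: p_19 / p_20 is a lower
  convergent, and every later ratio of consecutive path polynomials lies above it.\<close>

fun path_poly :: "real \<Rightarrow> nat \<Rightarrow> real" where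
  "path_poly t 0 = 1"
| "path_poly t (Suc 0) = 1"
| "path_poly t (Suc (Suc n)) = path_poly t (Suc n) + t * path_poly t n"

lemma path_poly_ge_1: "0 \<le> t \<Longrightarrow> 1 \<le> path_poly t n"
  by (induction t n rule: path_poly.induct) (auto intro: add_increasing2)

lemma path_poly_pos: "0 \<le> t \<Longrightarrow> 0 < path_poly t n"
  using path_poly_ge_1[of t n] by linarith

lemma path_poly_nonneg: "0 \<le> t \<Longrightarrow> 0 \<le> path_poly t n"
  using path_poly_ge_1[of t n] by linarith

lemma path_poly_Suc_ge: "0 \<le> t \<Longrightarrow> path_poly t n \<le> path_poly t (Suc n)"
  by (cases n) (auto simp: path_poly_nonneg)

text \<open>Sorts the matchings of a path on m + n + 2 vertices by whether they use the edge that
  follows the first m + 1 vertices.\<close>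

lemma path_poly_add: "path_poly t (Suc m + Suc n)
    = path_poly t (Suc m) * path_poly t (Suc n) + t * path_poly t m * path_poly t n"
  by (induction t n rule: path_poly.induct) (auto simp: algebra_simps)

text \<open>In the induction step both long factors are cut by \<open>path_poly_add\<close>. The
  terms with p_{b+1} cancel, and what remains is -t p_b times the previous identity with b = 0;
  hence the alternating sign.\<close>

lemma path_poly_docagne:
  "path_poly t (Suc k + a) * path_poly t (Suc k + b)
      - path_poly t k * path_poly t (Suc (Suc k) + a + b)
     = (- t) ^ Suc k * path_poly t a * path_poly t b"
proof (induction k arbitrary: a b)
  case 0
  show ?case
    using path_poly_add[of t a b] by (simp add: algebra_simps)
next
  case (Suc k)
  have 1: "path_poly t (Suc (Suc (Suc k)) + a + b) =
      path_poly t (Suc (Suc k) + a) * path_poly t (Suc b) + t * path_poly t (Suc k + a) *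
          path_poly t b"
    using path_poly_add[of t "Suc k + a" b] by (simp add: algebra_simps)
  have 2: "path_poly t (Suc (Suc k) + b) = path_poly t (Suc k) * path_poly t (Suc b)
      + t * path_poly t k * path_poly t b"
    using path_poly_add[of t k b] by (simp add: algebra_simps)
  have "path_poly t (Suc (Suc k) + a) * path_poly t (Suc (Suc k) + b) -
        path_poly t (Suc k) * path_poly t (Suc (Suc (Suc k)) + a + b)
      = - t * path_poly t b * (path_poly t (Suc k + a) * path_poly t (Suc k + 0) - path_poly t k *
          path_poly t (Suc (Suc k) + a + 0))"
    unfolding 1 2 by (simp add: algebra_simps)
  also have "\<dots> = (- t) ^ Suc (Suc k) * path_poly t a * path_poly t b"
    unfolding Suc.IH[of a 0] by (simp add: algebra_simps)
  finally show ?case .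
qed

lemma path_poly_docagne':
  assumes "k < i" "k < j"
  shows "path_poly t i * path_poly t j - path_poly t k * path_poly t (i + j - k)
     = (- t) ^ Suc k * path_poly t (i - Suc k) * path_poly t (j - Suc k)"
proof -
  have "Suc k + (i - Suc k) = i" "Suc k + (j - Suc k) = j"
    "Suc (Suc k) + (i - Suc k) + (j - Suc k) = i + j - k"
    using assms by auto
  then show ?thesis
    using path_poly_docagne[of t k "i - Suc k" "j - Suc k"] by presburger
qed

text \<open>The sign of the difference in \<open>path_poly_docagne'\<close> depends only on the
  parity of k. At a fixed sum s the products are therefore ordered p_1 p_{s-1} <= p_3 p_{s-3} <= ...
  <= p_2 p_{s-2} <= p_0 p_s.\<close>

lemma path_poly_mult_ge_odd:
  assumes "0 \<le> t" "odd k" "k \<le> i" "k \<le> j"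
  shows "path_poly t k * path_poly t (i + j - k) \<le> path_poly t i * path_poly t j"
proof (cases "i = k \<or> j = k")
  case False
  then have "k < i" "k < j" using assms by auto
  then have "path_poly t i * path_poly t j - path_poly t k * path_poly t (i + j - k) \<ge> 0"
    unfolding path_poly_docagne'[OF \<open>k < i\<close> \<open>k < j\<close>] using assms by (auto simp: path_poly_nonneg zero_le_power_eq)
  then show ?thesis by simp
qed (auto simp: algebra_simps)

lemma path_poly_mult_less_even:
  assumes "0 < t" "even k" "k < i" "k < j"
  shows "path_poly t i * path_poly t j < path_poly t k * path_poly t (i + j - k)"
proof -
  have "path_poly t i * path_poly t j - path_poly t k * path_poly t (i + j - k) < 0"
    unfolding path_poly_docagne'[OF \<open>k < i\<close> \<open>k < j\<close>] using assms
    by (auto simp: path_poly_pos zero_less_mult_iff mult_less_0_iff power_less_zero_eq)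
  then show ?thesis by simp
qed

text \<open>In that order the index 2 gives the largest product once index 0 is excluded, that is,
  once both factors belong to nonempty vertex sets.\<close>

lemma path_poly_mult_le_2:
  assumes "0 \<le> t" "1 \<le> i" "1 \<le> j" "3 \<le> i + j"
  shows "path_poly t i * path_poly t j \<le> path_poly t 2 * path_poly t (i + j - 2)"
proof -
  consider "i = 1" "j \<ge> 2" | "j = 1" "i \<ge> 2" | "i = 2" | "j = 2" | "i > 2" "j > 2"
    using assms by linarith
  then show ?thesis
  proof cases
    case 1
    then obtain k where "j = Suc (Suc k)" by (metis add_2_eq_Suc le_Suc_ex)
    with 1 show ?thesis using path_poly_Suc_ge[of t k] assms
      by (simp add: numeral_2_eq_2 algebra_simps mult_left_mono)
  next
    case 2
    then obtain k where "i = Suc (Suc k)" by (metis add_2_eq_Suc le_Suc_ex)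
    with 2 show ?thesis using path_poly_Suc_ge[of t k] assms
      by (simp add: numeral_2_eq_2 algebra_simps mult_left_mono)
  next
    case 5
    then have "path_poly t i * path_poly t j - path_poly t 2 * path_poly t (i + j - 2) \<le> 0"
      unfolding path_poly_docagne'[OF 5] using assms
      by (auto simp: path_poly_nonneg zero_le_mult_iff mult_le_0_iff)
    then show ?thesis by simp
  qed (auto simp: algebra_simps)
qed

section \<open>Recursive inequalities for the two upper bounds\<close>

lemma power_expand:
  "x ^ 2 = x * x" "x ^ 3 = x * (x * x)" "x ^ 4 = x * (x * (x * x))"
  "x ^ 5 = x * (x * (x * (x * x)))" "x ^ 6 = x * (x * (x * (x * (x * x))))" for x :: real
  by (simp_all add: eval_nat_numeral)

text \<open>For \<open>n \<ge> 6\<close> this is the matching polynomial of the spider with legs 2, 2, \<open>n - 5\<close>.\<close>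

definition nonpath_bound :: "real \<Rightarrow> nat \<Rightarrow> real" where
  "nonpath_bound t n = (if n = 4 then path_poly t 4 else if n
      = 5 then path_poly t 5 - t\<^sup>2 else path_poly t n - t\<^sup>2 * path_poly t (n - 6))"

text \<open>
  No tree attains this bound: for \<open>n \<ge> 7\<close> it solves the recursion of the path polynomials and lies
  above two incomparable trees, the one with a fork of two legs of length 2 at each end, and the one
  with two adjacent vertices of degree 3 and legs 2, 2 and 2, \<open>n - 8\<close>.
\<close>

definition nonspider_bound :: "real \<Rightarrow> nat \<Rightarrow> real" where
  "nonspider_bound t n = (if n = 5 then path_poly t 5 - t\<^sup>2
             else path_poly t n - 2 * t\<^sup>2 * path_poly t (n - 6) +
                 (if n \<ge> 9 then t ^ 3 * path_poly t (n - 9) else 0))"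

lemmas path_poly_unfold = path_poly.simps eval_nat_numeral

lemma path_poly_numeral:
  "path_poly t 2 = 1 + t" "path_poly t 3 = 1 + 2 * t" "path_poly t 4 = 1 + 3 * t + t ^ 2"
  "path_poly t 5 = 1 + 4 * t + 3 * t ^ 2" "path_poly t 6 = 1 + 5 * t + 6 * t ^ 2 + t ^ 3"
  "path_poly t 7 = 1 + 6 * t + 10 * t ^ 2 + 4 * t ^ 3"
  "path_poly t 8 = 1 + 7 * t + 15 * t ^ 2 + 10 * t ^ 3 + t ^ 4"
  "path_poly t 9 = 1 + 8 * t + 21 * t ^ 2 + 20 * t ^ 3 + 5 * t ^ 4"
  "path_poly t 10 = 1 + 9 * t + 28 * t ^ 2 + 35 * t ^ 3 + 15 * t ^ 4 + t ^ 5"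
  "path_poly t 11 = 1 + 10 * t + 36 * t ^ 2 + 56 * t ^ 3 + 35 * t ^ 4 + 6 * t ^ 5"
  by (simp_all add: path_poly_unfold algebra_simps)

lemma nonpath_bound_small: "nonpath_bound t 4 = path_poly t 4"
    "nonpath_bound t 5 = path_poly t 5 - t ^ 2"
  by (simp_all add: nonpath_bound_def)

lemma nonpath_bound_add_6: "nonpath_bound t (n + 6) = path_poly t (n + 6) - t ^ 2 * path_poly t n"
  by (simp add: nonpath_bound_def)

lemma nonspider_bound_5: "nonspider_bound t 5 = path_poly t 5 - t ^ 2"
  by (simp add: nonspider_bound_def)

lemma nonspider_bound_small: "nonspider_bound t 6 = path_poly t 6 - 2 * t ^ 2"
    "nonspider_bound t 7 = path_poly t 7 - 2 * t ^ 2"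
    "nonspider_bound t 8 = path_poly t 8 - 2 * t ^ 2 * path_poly t 2"
  by (simp_all add: nonspider_bound_def)

lemma nonspider_bound_add_9: "nonspider_bound t (n + 9)
    = path_poly t (n + 9) - 2 * t ^ 2 * path_poly t (n + 3) + t ^ 3 * path_poly t n"
  by (simp add: nonspider_bound_def add.commute)

lemma nonpath_bound_small': "nonpath_bound t 6 = path_poly t 6 - t ^ 2"
    "nonpath_bound t 7 = path_poly t 7 - t ^ 2"
    "nonpath_bound t 8 = path_poly t 8 - t ^ 2 * path_poly t 2"
   "nonpath_bound t 9 = path_poly t 9 - t ^ 2 * path_poly t 3"
  by (simp_all add: nonpath_bound_def)

lemma nat_ge_add: "k \<le> n \<Longrightarrow> (\<And>m. n = m + k \<Longrightarrow> P) \<Longrightarrow> P" for n :: nat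
  by (metis add.commute le_Suc_ex)

text \<open>This and the next two lemmas are the arithmetic of the three outcomes of
  \<open>tree_end_cases\<close>: a leaf beside two other neighbours, a tail for which both terms of
  the leaf recursion are again non-paths, and a vertex with two legs of length 2.\<close>

lemma nonpath_bound_pendant:
  assumes "0 \<le> t" "4 \<le> n"
  shows "path_poly t (n - 1) + t * (path_poly t 2 * path_poly t (n - 4)) \<le> nonpath_bound t n"
proof -
  consider "n = 4" | "n = 5" | "6 \<le> n" using assms(2) by linarith
  then show ?thesis
  proof cases
    case 3
    then obtain m where n: "n = m + 6" by (rule nat_ge_add)
    have "nonpath_bound t n - (path_poly t (n - 1) + t * (path_poly t 2 * path_poly t (n - 4)))
        = t ^ 2 * (path_poly t (m + 1) - path_poly t m)"
      unfolding n nonpath_bound_add_6 by (simp add: path_poly_unfold algebra_simps)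
    also have "\<dots> \<ge> 0" using path_poly_Suc_ge[of t m] assms by simp
    finally show ?thesis by simp
  qed (simp_all add: path_poly_numeral nonpath_bound_small algebra_simps power2_eq_square)
qed

lemma nonpath_bound_rec:
  assumes "0 \<le> t" "6 \<le> n"
  shows "nonpath_bound t (n - 1) + t * nonpath_bound t (n - 2) \<le> nonpath_bound t n"
proof -
  consider "n = 6" | "n = 7" | "8 \<le> n" using assms(2) by linarith
  then show ?thesis
  proof cases
    case 3
    then obtain m where n: "n = m + 8" by (rule nat_ge_add)
    have "nonpath_bound t n = path_poly t (m + 8) - t ^ 2 * path_poly t (m + 2)"
      "nonpath_bound t (n - 1) = path_poly t (m + 7) - t ^ 2 * path_poly t (m + 1)"
      "nonpath_bound t (n - 2) = path_poly t (m + 6) - t ^ 2 * path_poly t m"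
      by (simp_all add: nonpath_bound_def n add.commute)
    then show ?thesis by (simp add: path_poly_unfold algebra_simps)
  qed (use assms in \<open>simp_all add: path_poly_numeral nonpath_bound_small nonpath_bound_small' nonpath_bound_def nonspider_bound_def algebra_simps power_expand\<close>)
qed

lemma nonpath_bound_fork:
  assumes "0 \<le> t" "6 \<le> n"
  shows "path_poly t 2 * path_poly t (n - 2) + t * (path_poly t 2 * path_poly t (n - 5))
      = nonpath_bound t n"
proof -
  obtain m where n: "n = m + 6" using assms(2) by (rule nat_ge_add)
  show ?thesis unfolding n nonpath_bound_add_6 by (simp add: path_poly_unfold algebra_simps)
qed

text \<open>Here \<open>nonpath_bound\<close> enters because the tree without the leaf cannot be a
  path: a leaf attached to an inner vertex of a path gives a spider.\<close>

lemma nonspider_bound_pendant: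
  assumes "0 \<le> t" "5 \<le> n"
  shows "nonpath_bound t (n - 1) + t * (path_poly t 2 * path_poly t (n - 4)) \<le> nonspider_bound t n"
proof -
  consider "n = 5" | "n = 6" | "n = 7" | "n = 8" | "9 \<le> n" using assms(2) by linarith
  then show ?thesis
  proof cases
    case 5
    then obtain m where n: "n = m + 9" by (rule nat_ge_add)
    have 1: "nonpath_bound t (n - 1) = path_poly t (m + 8) - t ^ 2 * path_poly t (m + 2)"
      by (simp add: nonpath_bound_def n add.commute)
    have "nonspider_bound t n - (nonpath_bound t (n - 1)
        + t * (path_poly t 2 * path_poly t (n - 4))) = t ^ 3 * (1 + t) * path_poly t m"
      unfolding 1 unfolding n nonspider_bound_add_9 by (simp add: path_poly_unfold algebra_simps)
    also have "\<dots> \<ge> 0" using path_poly_nonneg[of t m] assms by simp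
    finally show ?thesis by simp
  qed (use assms in \<open>simp_all add: path_poly_numeral nonpath_bound_small nonpath_bound_small' nonspider_bound_5 nonspider_bound_small nonpath_bound_def nonspider_bound_def algebra_simps power_expand\<close>)
qed

lemma nonspider_bound_rec:
  assumes "0 \<le> t" "7 \<le> n"
  shows "nonspider_bound t (n - 1) + t * nonspider_bound t (n - 2) \<le> nonspider_bound t n"
proof -
  consider "n = 7" | "n = 8" | "n = 9" | "n = 10" | "11 \<le> n" using assms(2) by linarith
  then show ?thesis
  proof cases
    case 5
    then obtain m where n: "n = m + 11" by (rule nat_ge_add)
    have "nonspider_bound t n = path_poly t (m + 11) - 2 * t ^ 2 * path_poly t (m + 5)
        + t ^ 3 * path_poly t (m + 2)"
      "nonspider_bound t (n - 1) = path_poly t (m + 10) - 2 * t ^ 2 * path_poly t (m + 4)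
          + t ^ 3 * path_poly t (m + 1)"
      "nonspider_bound t (n - 2) = path_poly t (m + 9) - 2 * t ^ 2 * path_poly t (m + 3)
          + t ^ 3 * path_poly t m"
      by (simp_all add: nonspider_bound_def n add.commute)
    then show ?thesis by (simp add: path_poly_unfold algebra_simps)
  qed (use assms in \<open>simp_all add: path_poly_numeral nonspider_bound_def nonpath_bound_def nonspider_bound_def algebra_simps power_expand\<close>)
qed

text \<open>Belongs to three legs of length 2 at one vertex. Deleting one leg leaves a non-path;
  deleting the vertex as well frees the other two legs, each a factor p_2.\<close>

lemma nonspider_bound_three_forks:
  assumes "0 \<le> t" "8 \<le> n"
  shows "path_poly t 2 * nonpath_bound t (n - 2)
      + t * (path_poly t 2 * (path_poly t 2 * path_poly t (n - 7))) \<le> nonspider_bound t n"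
proof -
  consider "n = 8" | "9 \<le> n" using assms(2) by linarith
  then show ?thesis
  proof cases
    case 2
    then obtain m where n: "n = m + 9" by (rule nat_ge_add)
    have 1: "nonpath_bound t (n - 2) = path_poly t (m + 7) - t ^ 2 * path_poly t (m + 1)"
      by (simp add: nonpath_bound_def n add.commute)
    have "nonspider_bound t n - (path_poly t 2 * nonpath_bound t (n - 2)
        + t * (path_poly t 2 * (path_poly t 2 * path_poly t (n - 7))))
        = t ^ 2 * (1 + t) * path_poly t (m + 1)"
      unfolding 1 unfolding n nonspider_bound_add_9 by (simp add: path_poly_unfold algebra_simps)
    also have "\<dots> \<ge> 0" using path_poly_nonneg[of t "m + 1"] assms by simp
    finally show ?thesis by simp
  qed (use assms in \<open>simp_all add: path_poly_numeral nonpath_bound_small nonpath_bound_small' nonspider_bound_5 nonspider_bound_small nonpath_bound_def nonspider_bound_def algebra_simps power_expand\<close>)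
qed

text \<open>Belongs to a vertex with two legs of length 2 that is adjacent to another vertex of
  degree at least 3. The two legs and their common vertex form a path on five vertices, whence p_5;
  without the middle vertex they are two edges, whence the square of p_2.\<close>

lemma nonspider_bound_adjacent_forks:
  assumes "0 \<le> t" "9 \<le> n"
  shows "path_poly t 5 * path_poly t (n - 5) + t * (path_poly t 2) ^ 2
      * (path_poly t 2 * path_poly t (n - 8)) \<le> nonspider_bound t n"
proof -
  consider "n = 9" | "n = 10" | "11 \<le> n" using assms(2) by linarith
  then show ?thesis
  proof cases
    case 3
    then obtain m where n: "n = m + 11" by (rule nat_ge_add)
    have 1: "nonspider_bound t n = path_poly t (m + 11) - 2 * t ^ 2 * path_poly t (m + 5)
        + t ^ 3 * path_poly t (m + 2)"
      by (simp add: nonspider_bound_def n add.commute)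
    have "nonspider_bound t n - (path_poly t 5 * path_poly t (n - 5)
        + t * (path_poly t 2) ^ 2 * (path_poly t 2 * path_poly t (n - 8)))
        = t ^ 4 * (1 + t) * path_poly t m"
      unfolding 1 unfolding n by (simp add: path_poly_unfold algebra_simps)
    also have "\<dots> \<ge> 0" using path_poly_nonneg[of t m] assms by simp
    finally show ?thesis by simp
  qed (use assms in \<open>simp_all add: path_poly_numeral nonspider_bound_def nonpath_bound_def nonspider_bound_def algebra_simps power_expand\<close>)
qed

text \<open>For eight vertices the last factor belongs to two isolated vertices and equals 1. With
  p_2 in its place the inequality would fail already in the coefficient of t^2, 14 against
  13.\<close>

lemma nonspider_bound_adjacent_forks_8:
  assumes "0 \<le> t"
  shows "path_poly t 5 * path_poly t 3 + t * (path_poly t 2) ^ 2 \<le> nonspider_bound t 8"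
  using assms unfolding nonspider_bound_small path_poly_numeral
    by (simp add: algebra_simps power_expand)

text \<open>Belongs to a vertex with exactly two legs of length 2 such that the rest of the tree,
  without that vertex, is itself not a path.\<close>

lemma nonspider_bound_fork:
  assumes "0 \<le> t" "9 \<le> n"
  shows "path_poly t 2 * nonpath_bound t (n - 2) + t * (path_poly t 2 * nonpath_bound t (n - 5))
      \<le> nonspider_bound t n"
proof -
  consider "n = 9" | "n = 10" | "11 \<le> n" using assms(2) by linarith
  then show ?thesis
  proof cases
    case 3
    then obtain m where n: "n = m + 11" by (rule nat_ge_add)
    have 1: "nonspider_bound t n = path_poly t (m + 11) - 2 * t ^ 2 * path_poly t (m + 5)
        + t ^ 3 * path_poly t (m + 2)"
      "nonpath_bound t (n - 2) = path_poly t (m + 9) - t ^ 2 * path_poly t (m + 3)"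
      "nonpath_bound t (n - 5) = path_poly t (m + 6) - t ^ 2 * path_poly t m"
      by (simp_all add: nonspider_bound_def nonpath_bound_def n add.commute)
    have "nonspider_bound t n - (path_poly t 2 * nonpath_bound t (n - 2)
        + t * (path_poly t 2 * nonpath_bound t (n - 5)))
        = t ^ 3 * (1 + t) * path_poly t m"
      unfolding 1 by (simp add: path_poly_unfold algebra_simps)
    also have "\<dots> \<ge> 0" using path_poly_nonneg[of t m] assms by simp
    finally show ?thesis by simp
  qed (use assms in \<open>simp_all add: path_poly_numeral nonspider_bound_def nonpath_bound_def nonpath_bound_def nonspider_bound_def algebra_simps power_expand\<close>)
qed

section \<open>Certified lower bounds of logarithmic integrals\<close>

fun horner :: "int list \<Rightarrow> real \<Rightarrow> real" where
  "horner [] x = 0"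
| "horner (c # cs) x = of_int c + x * horner cs x"

fun list_add :: "int list \<Rightarrow> int list \<Rightarrow> int list" where
  "list_add [] q = q"
| "list_add p [] = p"
| "list_add (a # p) (b # q) = (a + b) # list_add p q"

definition list_scale :: "int \<Rightarrow> int list \<Rightarrow> int list" where
  "list_scale c p = map ((*) c) p"

fun list_mult :: "int list \<Rightarrow> int list \<Rightarrow> int list" where
  "list_mult [] q = []"
| "list_mult (c # p) q = list_add (list_scale c q) (0 # list_mult p q)"

text \<open>Carries the numerator of the substituted polynomial together with its denominator, a
  power of d (1 + x) by which each new coefficient has to be multiplied. The lists [d, d] and [b, a]
  stand for d + d x and b + a x.\<close>

fun subst_frac :: "int \<Rightarrow> int \<Rightarrow> int \<Rightarrow> int list \<Rightarrow> int list \<times> int list" where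
  "subst_frac a b d [] = ([], [1])"
| "subst_frac a b d (c # cs) =
     (let (q, w) = subst_frac a b d cs; w' = list_mult [d, d] w
      in (list_add (list_scale c w') (list_mult [b, a] q), w'))"

fun subst_shift :: "int \<Rightarrow> int list \<Rightarrow> int list" where
  "subst_shift a [] = []"
| "subst_shift a (c # cs) = list_add [c] (list_mult [a, 1] (subst_shift a cs))"

definition nonneg_coeffs :: "int list \<Rightarrow> bool" where
  "nonneg_coeffs cs \<longleftrightarrow> list_all (\<lambda>c. 0 \<le> c) cs"

lemma horner_list_add [simp]: "horner (list_add p q) x = horner p x + horner q x"
  by (induction p q rule: list_add.induct) (auto simp: algebra_simps)

lemma horner_list_scale [simp]: "horner (list_scale c p) x = of_int c * horner p x"
  by (induction p) (auto simp: list_scale_def algebra_simps)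

lemma horner_list_mult [simp]: "horner (list_mult p q) x = horner p x * horner q x"
  by (induction p) (auto simp: algebra_simps)

lemma horner_append: "horner (p @ q) x = horner p x + x ^ length p * horner q x"
  by (induction p) (auto simp: algebra_simps)

lemma horner_rev:
  assumes "x \<noteq> 0"
  shows "horner (rev p) x * x = x ^ length p * horner p (1 / x)"
  using assms by (induction p) (auto simp: horner_append field_simps)

lemma horner_nonneg: "nonneg_coeffs cs \<Longrightarrow> 0 \<le> x \<Longrightarrow> 0 \<le> horner cs x"
  by (induction cs) (auto simp: nonneg_coeffs_def)

lemma horner_subst_frac:
  assumes "real_of_int d * (1 + x) * s = of_int b + of_int a * x"
  shows "horner (snd (subst_frac a b d cs)) x = (of_int d * (1 + x)) ^ length cs
       \<and> horner (fst (subst_frac a b d cs)) x = (of_int d * (1 + x)) ^ length cs * horner cs s"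
proof (induction cs)
  case (Cons c cs)
  obtain q w where qw: "subst_frac a b d cs = (q, w)" by fastforce
  define W where "W = (of_int d * (1 + x)) ^ length cs"
  have 1: "horner w x = W" "horner q x = W * horner cs s" using Cons qw by (auto simp: W_def)
  have "horner (list_mult [b, a] q) x = W * (real_of_int d * (1 + x) * s) * horner cs s"
    unfolding assms horner_list_mult 1 by (simp add: algebra_simps)
  moreover have "horner (list_mult [d, d] w) x = of_int d * (1 + x) * W"
    unfolding horner_list_mult 1 by (simp add: algebra_simps)
  moreover have "(real_of_int d * (1 + x)) ^ length (c # cs) = of_int d * (1 + x) * W"
    by (simp add: W_def)
  ultimately show ?case
    by (simp add: qw Let_def algebra_simps del: list_mult.simps power_Suc)
qed simp

text \<open>The substitution \<open>s = (b + a x) / (d (1 + x))\<close> maps \<open>[0, \<infinity>)\<close> onto \<open>(a / d, b / d]\<close>.\<close>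

lemma horner_nonneg_interval:
  assumes "nonneg_coeffs (fst (subst_frac a b d cs))" "0 < d"
    and "of_int a / of_int d < s" "s \<le> of_int b / of_int d"
  shows "0 \<le> horner cs s"
proof -
  define x where "x = (of_int b - s * of_int d) / (s * of_int d - of_int a)"
  have pos: "s * of_int d - of_int a > 0" and le: "s * of_int d \<le> of_int b"
    using assms by (auto simp: field_simps)
  then have x: "x \<ge> 0" by (simp add: x_def)
  have x1: "x * (s * of_int d - of_int a) = of_int b - s * of_int d"
    using pos by (simp add: x_def)
  have "real_of_int d * (1 + x) * s = of_int b + of_int a * x"
    using x1 by (simp add: algebra_simps)
  from horner_subst_frac[OF this] have "0 \<le> (of_int d * (1 + x)) ^ length cs * horner cs s"
    using horner_nonneg[OF assms(1) x] by auto
  moreover have "(real_of_int d * (1 + x)) ^ length cs > 0" using x assms(2) by simp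
  ultimately show ?thesis by (simp add: zero_le_mult_iff)
qed

lemma horner_subst_shift: "horner (subst_shift a cs) x = horner cs (of_int a + x)"
  by (induction cs) (simp_all add: algebra_simps)

lemma horner_nonneg_ge:
  assumes "nonneg_coeffs (subst_shift a cs)" "of_int a \<le> s"
  shows "0 \<le> horner cs s"
  using horner_nonneg[OF assms(1), of "s - of_int a"] assms(2) by (simp add: horner_subst_shift)

section \<open>Lower bounds of the logarithm\<close>

text \<open>The difference of the two sides has derivative x^3 / (1 - x), so it is minimal at 0. The
  odd degree is what makes the truncated series a lower bound on both sides of 0, and expansion
  points of both signs occur.\<close>

lemma ln_one_minus_cubic:
  fixes x :: real
  assumes "x < 1"
  shows "x + x ^ 2 / 2 + x ^ 3 / 3 \<le> - ln (1 - x)"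
proof -
  define g where "g y = - ln (1 - y) - (y + y ^ 2 / 2 + y ^ 3 / 3)" for y :: real
  have D: "(g has_real_derivative y ^ 3 / (1 - y)) (at y)" if "y < 1" for y
    unfolding g_def using that
    by (auto intro!: derivative_eq_intros simp: field_simps power2_eq_square power3_eq_cube)
  have "g 0 \<le> g x"
  proof (cases "0 \<le> x")
    case True
    show ?thesis
      by (rule DERIV_nonneg_imp_nondecreasing[OF True])
         (metis D assms divide_nonneg_pos diff_gt_0_iff_gt order_le_less_trans zero_le_power)
  next
    case False
    show ?thesis
    proof (rule DERIV_nonpos_imp_nonincreasing[of x 0 g])
      fix y :: real assume "x \<le> y" "y \<le> 0"
      then have "(g has_real_derivative y ^ 3 / (1 - y)) (at y)" "y ^ 3 / (1 - y) \<le> 0"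
        by (auto intro!: D divide_nonpos_pos simp: power_le_zero_eq)
      then show "\<exists>d. (g has_real_derivative d) (at y) \<and> d \<le> 0" by blast
    qed (use False in simp)
  qed
  then show ?thesis by (simp add: g_def)
qed

text \<open>Uses ln u <= u - 1 for u = 1 / ((1 - x) r), which is near 1 when 1 / (1 - x)
  approximates r. The bound is affine in 1 / r; for r = F / Q its comparison with a polynomial
  therefore becomes a polynomial inequality after multiplication by F.\<close>

lemma ln_ge_cubic:
  fixes r x :: real
  assumes "0 < r" "x < 1"
  shows "1 + x + x ^ 2 / 2 + x ^ 3 / 3 - 1 / ((1 - x) * r) \<le> ln r"
proof -
  have "ln (1 / ((1 - x) * r)) \<le> 1 / ((1 - x) * r) - 1"
    using assms by (intro ln_le_minus_one) auto
  then have "- ln (1 - x) - ln r \<le> 1 / ((1 - x) * r) - 1"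
    using assms by (simp add: ln_div ln_mult)
  with ln_one_minus_cubic[OF assms(2)] show ?thesis by linarith
qed

text \<open>
  The numbers \<open>600000000 e ((1 - x) (1 + x + x\<^sup>2 / 2 + x\<^sup>3 / 3 - w))\<close> for \<open>x = X / 100\<close> and \<open>w = W / e\<close>, the
  factor being chosen to clear all denominators; compare \<open>ln_ge_cubic\<close>.
\<close>

definition log_cert :: "int \<Rightarrow> int list \<Rightarrow> int \<Rightarrow> int list" where
  "log_cert X W e = list_scale (100 - X)
     (list_add [e * (6000000 + 60000 * X + 300 * X ^ 2 + 2 * X ^ 3)] (list_scale (- 6000000) W))"

definition log_check :: "int list \<Rightarrow> int list \<Rightarrow> int \<times> int \<times> int \<times> int \<times> int \<times> int list \<Rightarrow> bool" where
  "log_check F Q = (\<lambda>(a, b, d, X, e, W).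
     0 < d \<and> 0 < e \<and> X < 100 \<and>
     nonneg_coeffs (fst (subst_frac a b d
       (list_add (list_mult (log_cert X W e) F) (list_scale (- 600000000 * e) Q)))))"

lemma log_check_bound:
  assumes "log_check F Q (a, b, d, X, e, W)"
    and "of_int a / of_int d < s" "s \<le> of_int b / of_int d"
    and "0 < horner F s" "0 < horner Q s"
  shows "horner W s / of_int e \<le> ln (horner F s / horner Q s)"
proof -
  have d: "0 < d" "0 < e" "X < 100"
    and chk: "nonneg_coeffs (fst (subst_frac a b d
       (list_add (list_mult (log_cert X W e) F) (list_scale (- 600000000 * e) Q))))"
    using assms(1) by (auto simp: log_check_def)
  define x where "x = real_of_int X / 100"
  have x: "x < 1" using d by (simp add: x_def)
  have X: "real_of_int X = 100 * x" by (simp add: x_def)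
  define c where "c = 1 + x + x ^ 2 / 2 + x ^ 3 / 3"
  have "horner (log_cert X W e) s = 600000000 * of_int e * (1 - x) * (c - horner W s / of_int e)"
    using d unfolding log_cert_def by (simp add: X c_def field_simps power2_eq_square
        power3_eq_cube)
  moreover have "0 \<le> horner (log_cert X W e) s * horner F s - 600000000 * of_int e * horner Q s"
    using horner_nonneg_interval[OF chk d(1) assms(2,3)] by simp
  ultimately have "0 \<le> 600000000 * of_int e *
      ((1 - x) * (c - horner W s / of_int e) * horner F s - horner Q s)"
    unfolding right_diff_distrib [of _ "_ * horner F s"] by (simp only: mult.assoc)
  then have "horner Q s \<le> (1 - x) * (c - horner W s / of_int e) * horner F s"
    using d by (simp add: zero_le_mult_iff)
  then have "horner W s / of_int e \<le> c - 1 / ((1 - x) * (horner F s / horner Q s))"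
    using assms(4,5) x by (simp add: field_simps)
  also have "\<dots> \<le> ln (horner F s / horner Q s)"
    unfolding c_def using assms(4,5) x by (intro ln_ge_cubic) auto
  finally show ?thesis .
qed

section \<open>Integrals of piecewise polynomial lower bounds\<close>

text \<open>The antiderivative that vanishes at 0; the exponent rises by 2 because the coefficients
  belong to powers of y^2.\<close>

fun primitive :: "nat \<Rightarrow> int list \<Rightarrow> real \<Rightarrow> real" where
  "primitive k [] y = 0"
| "primitive k (c # cs) y = of_int c * y ^ Suc k / Suc k + primitive (k + 2) cs y"

lemma primitive_deriv: "(primitive k cs has_real_derivative y ^ k * horner cs (y\<^sup>2))
    (at y within A)"
proof (induction k cs y rule: primitive.induct)
  case (2 k c cs y)
  have "((\<lambda>y. of_int c * y ^ Suc k / Suc k + primitive (k + 2) cs y)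
     has_real_derivative (of_int c * y ^ k + y ^ (k + 2) * horner cs (y\<^sup>2))) (at y within A)"
    by (rule derivative_eq_intros DERIV_cmult_right 2 refl | simp)+
  then show ?case
    by (simp add: algebra_simps power2_eq_square)
qed simp

lemma horner_continuous: "continuous_on A (\<lambda>y. horner cs (f y))" if "continuous_on A f"
  by (induction cs) (auto intro!: continuous_intros that)

definition piece_integral :: "real \<Rightarrow> real \<Rightarrow> int list \<Rightarrow> int \<Rightarrow> real" where
  "piece_integral a b W e = (primitive 0 W b - primitive 0 W a) / of_int e"

lemma set_integral_ge_piece:
  fixes g :: "real \<Rightarrow> real"
  assumes "a \<le> b" "set_integrable lborel {a<..b} g"
    and "\<And>y. a < y \<Longrightarrow> y \<le> b \<Longrightarrow> horner W (y\<^sup>2) / of_int e \<le> g y"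
  shows "piece_integral a b W e \<le> (LBINT y:{a<..b}. g y)"
proof -
  let ?h = "\<lambda>y. horner W (y\<^sup>2) / of_int e"
  have cont: "continuous_on {a..b} ?h"
    unfolding divide_inverse by (intro continuous_intros horner_continuous)
  have "(LBINT y=a..b. ?h y) = primitive 0 W b / of_int e - primitive 0 W a / of_int e"
  proof (rule interval_integral_FTC_finite)
    fix x
    show "((\<lambda>y. primitive 0 W y / of_int e) has_vector_derivative ?h x)
        (at x within {min a b..max a b})"
      using DERIV_cdivide[OF primitive_deriv[of 0 W x], where c = "of_int e"]
      by (simp add: has_real_derivative_iff_has_vector_derivative)
  qed (use cont assms(1) in \<open>simp add: min_absorb1 max_absorb2\<close>)
  then have "(LBINT y:{a<..b}. ?h y) = piece_integral a b W e"
    using assms(1) by (simp add: interval_integral_Ioc piece_integral_def diff_divide_distrib)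
  moreover have "set_integrable lborel {a<..b} ?h"
    by (rule set_integrable_subset[OF borel_integrable_atLeastAtMost'[OF cont]]) auto
  ultimately show ?thesis
    using set_integral_mono[OF _ assms(2)] assms(3) by (metis greaterThanAtMost_iff)
qed

text \<open>The empty list stands for the unbounded last piece, on which the lower bound 0 is
  enough; it contributes 0 to \<open>pieces_sum\<close>.\<close>

fun pieces_bound :: "(real \<Rightarrow> real) \<Rightarrow> real \<Rightarrow> (real \<times> int list \<times> int) list \<Rightarrow> bool" where
  "pieces_bound g a [] \<longleftrightarrow> (\<forall>y>a. 0 \<le> g y)"
| "pieces_bound g a ((b, W, e) # ps) \<longleftrightarrow>
     a \<le> b \<and> (\<forall>y. a < y \<longrightarrow> y \<le> b \<longrightarrow> horner W (y\<^sup>2) / of_int e \<le> g y) \<and> pieces_bound g b ps"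

fun pieces_sum :: "real \<Rightarrow> (real \<times> int list \<times> int) list \<Rightarrow> real" where
  "pieces_sum a [] = 0"
| "pieces_sum a ((b, W, e) # ps) = piece_integral a b W e + pieces_sum b ps"

lemma set_integral_ge_pieces:
  fixes g :: "real \<Rightarrow> real"
  assumes "set_integrable lborel {a<..} g" "pieces_bound g a ps"
  shows "pieces_sum a ps \<le> (LBINT y:{a<..}. g y)"
  using assms
proof (induction g a ps rule: pieces_bound.induct)
  case (1 g a)
  then show ?case
    by (auto simp: set_lebesgue_integral_def indicator_def intro!:
        Bochner_Integration.integral_nonneg)
next
  case (2 g a b W e ps)
  have ab: "a \<le> b" using 2 by simp
  have U: "{a<..} = {a<..b} \<union> {b<..}" using ab by auto
  have i1: "set_integrable lborel {a<..b} g"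
    by (rule set_integrable_subset[OF 2(2)]) auto
  have i2: "set_integrable lborel {b<..} g"
    by (rule set_integrable_subset[OF 2(2)]) (use ab in auto)
  have "(LBINT y:{a<..}. g y) = (LBINT y:{a<..b}. g y) + (LBINT y:{b<..}. g y)"
    unfolding U by (rule set_integral_Un[OF _ i1 i2]) auto
  moreover have "piece_integral a b W e \<le> (LBINT y:{a<..b}. g y)"
    by (rule set_integral_ge_piece[OF ab i1]) (use 2 in auto)
  moreover have "pieces_sum b ps \<le> (LBINT y:{b<..}. g y)"
    using 2 i2 by auto
  ultimately show ?case by simp
qed

section \<open>The polynomials at n = 31 and their certificates\<close>

text \<open>Two consecutive polynomials are carried along, so that the number of list additions is
  linear in n and not exponential.\<close>

fun path_coeffs_pair :: "nat \<Rightarrow> int list \<times> int list" where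
  "path_coeffs_pair 0 = ([1], [1])"
| "path_coeffs_pair (Suc n) = (let (p, q) = path_coeffs_pair n in (q, list_add q (0 # p)))"

definition path_coeffs :: "nat \<Rightarrow> int list" where "path_coeffs n = fst (path_coeffs_pair n)"

lemma horner_path_coeffs_pair: "horner (fst (path_coeffs_pair n)) t = path_poly t n
    \<and> horner (snd (path_coeffs_pair n)) t = path_poly t (Suc n)"
  by (induction n) (auto simp: Let_def split_beta)

lemma horner_path_coeffs: "horner (path_coeffs n) t = path_poly t n"
  by (simp add: path_coeffs_def horner_path_coeffs_pair)

text \<open>These belong to the spiders with legs 2, 7, \<open>n - 10\<close> and 4, 4, \<open>n - 9\<close>.\<close>

definition cutoff_poly :: "real \<Rightarrow> nat \<Rightarrow> real" where
  "cutoff_poly t n = path_poly t n - t\<^sup>2 * (path_poly t 6 * path_poly t (n - 11))"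

definition long_leg_poly :: "real \<Rightarrow> nat \<Rightarrow> real" where
  "long_leg_poly t n = path_poly t n - t\<^sup>2 * ((path_poly t 3)\<^sup>2 * path_poly t (n - 10))"

definition cutoff_31 :: "int list" where
  "cutoff_31 = list_add (path_coeffs 31) (list_scale (- 1)
      (0 # 0 # list_mult (path_coeffs 6) (path_coeffs 20)))"

definition long_leg_31 :: "int list" where
  "long_leg_31 = list_add (path_coeffs 31) (list_scale (- 1)
      (0 # 0 # list_mult (list_mult (path_coeffs 3) (path_coeffs 3)) (path_coeffs 21)))"

definition nonspider_31 :: "int list" where
  "nonspider_31 = list_add (path_coeffs 31) (list_add (list_scale (- 2) (0 # 0 # path_coeffs 25))
      (0 # 0 # 0 # path_coeffs 22))"

lemma horner_cutoff_31: "horner cutoff_31 t = cutoff_poly t 31"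
  by (simp add: cutoff_31_def cutoff_poly_def horner_path_coeffs power2_eq_square)

lemma horner_long_leg_31: "horner long_leg_31 t = long_leg_poly t 31"
  by (simp add: long_leg_31_def long_leg_poly_def horner_path_coeffs power2_eq_square)

lemma horner_nonspider_31: "horner nonspider_31 t = nonspider_bound t 31"
  by (simp add: nonspider_31_def nonspider_bound_def horner_path_coeffs power2_eq_square
      power3_eq_cube)

text \<open>The substitution t = 1 / s with s = y^2, followed by multiplication by s^15, reverses
  the coefficients; 15 is the degree of p_31. The constant terms of the reversed lists decide the
  behaviour near y = 0.\<close>

definition cutoff_coeffs :: "int list" where
  "cutoff_coeffs = [15, 619, 7738, 45426, 152131, 322620, 460851, 460696, 329768, 170943, 64220,
      17296, 3252, 405, 30, 1]"
definition long_leg_coeffs :: "int list" where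
  "long_leg_coeffs = [16, 636, 7644, 44349, 148864, 317681, 456496, 458317, 328952, 170772, 64200,
      17295, 3252, 405, 30, 1]"
definition nonspider_coeffs :: "int list" where
  "nonspider_coeffs = [16, 655, 7906, 45097, 148083, 310531, 441780, 442238, 318156, 166099,
      62890, 17065, 3229, 404, 30, 1]"

lemma rev_cutoff_31: "rev cutoff_31 = cutoff_coeffs" by code_simp
lemma rev_long_leg_31: "rev long_leg_31 = long_leg_coeffs" by code_simp
lemma rev_nonspider_31: "rev nonspider_31 = nonspider_coeffs" by code_simp

type_synonym cert = "int \<times> int \<times> int \<times> int \<times> int \<times> int list"

text \<open>
  Numerically found lower bounds \<open>W / e\<close>, polynomials in \<open>s = y\<^sup>2\<close>, for the two logarithms on the interval
  \<open>(a / d, b / d]\<close> of \<open>s\<close>; the expansion point is \<open>X / 100\<close>.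
\<close>

definition cert_long_leg :: "cert list" where
  "cert_long_leg = [
     (0, 1, 64, -6, 1000000, [-64563, 1520647, -22734041, 261762310]),
     (1, 4, 64, -3, 1000000, [-63733, 1352213, -12246129, 52897306]),
     (4, 9, 64, 0, 1000000, [-55196, 916367, -4744466, 9613293]),
     (9, 16, 64, 1, 1000000, [-36430, 506330, -1711872, 2043178]),
     (4, 9, 16, 2, 1000000, [-4640, 144790, -315772, 209027]),
     (9, 16, 16, 1, 1000000, [22778, -13965, -5202, 4818]),
     (4, 9, 4, 1, 1000000, [25523, -25800, 10137, -1455]),
     (9, 16, 4, 0, 1000000, [12729, -8166, 1919, -159]),
     (4, 9, 1, 0, 1000000, [3410, -1186, 144, -6])]"

definition cert_nonspider :: "cert list" where
  "cert_nonspider = [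
     (0, 1, 16, -5, 1000, [-66, 445]),
     (1, 4, 16, -2, 1000, [-53, 233]),
     (1, 4, 4, 2, 1000, [-1, 30]),
     (1, 4, 1, 3, 1000, [42, -7])]"

lemma log_check_long_leg: "list_all (log_check cutoff_coeffs long_leg_coeffs) cert_long_leg"
  by code_simp

lemma log_check_nonspider: "list_all (log_check cutoff_coeffs nonspider_coeffs) cert_nonspider"
  by code_simp

text \<open>Disposes of the unbounded piece: for s >= 3 the quotient is at least 1, and the last
  knots 3 and 2 correspond to s = 9 and s = 4.\<close>

lemma tail_check_long_leg: "nonneg_coeffs (subst_shift 3
    (list_add cutoff_coeffs (list_scale (- 1) long_leg_coeffs)))"
  by code_simp

lemma tail_check_nonspider: "nonneg_coeffs (subst_shift 3
    (list_add cutoff_coeffs (list_scale (- 1) nonspider_coeffs)))"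
  by code_simp

definition knots_long_leg :: "real list" where
    "knots_long_leg = [1/8, 1/4, 3/8, 1/2, 3/4, 1, 3/2, 2, 3]"

definition knots_nonspider :: "real list" where "knots_nonspider = [1/4, 1/2, 1, 2]"

lemma horner_rev_square:
  assumes "0 < y" "length p = 16"
  shows "horner (rev p) (y\<^sup>2) = (y\<^sup>2) ^ 15 * horner p (1 / y\<^sup>2)"
proof -
  have "horner (rev p) (y\<^sup>2) * y\<^sup>2 = ((y\<^sup>2) ^ 15 * horner p (1 / y\<^sup>2)) * y\<^sup>2"
    using horner_rev[of "y\<^sup>2" p] assms by (simp add: power_numeral_reduce)
  then show ?thesis using assms(1) by simp
qed

lemma length_rev_eq: "rev p = q \<Longrightarrow> length p = length q" by auto

lemma horner_pos:
  assumes "nonneg_coeffs cs" "0 < x" "cs \<noteq> []" "hd cs > 0"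
  shows "0 < horner cs x"
proof -
  obtain c cs' where "cs = c # cs'" using assms(3) by (cases cs) auto
  then show ?thesis using assms horner_nonneg[of cs' x]
    by (auto simp: nonneg_coeffs_def add_pos_nonneg)
qed

lemma horner_cutoff_pos: "0 < y \<Longrightarrow> 0 < horner cutoff_coeffs (y\<^sup>2)"
  and horner_long_leg_pos: "0 < y \<Longrightarrow> 0 < horner long_leg_coeffs (y\<^sup>2)"
  and horner_nonspider_pos: "0 < y \<Longrightarrow> 0 < horner nonspider_coeffs (y\<^sup>2)"
  by (rule horner_pos; simp add: cutoff_coeffs_def long_leg_coeffs_def nonspider_coeffs_def
      nonneg_coeffs_def)+

lemma ratio_long_leg:
  assumes "0 < y"
  shows "cutoff_poly (1 / y\<^sup>2) 31 / long_leg_poly (1 / y\<^sup>2) 31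
      = horner cutoff_coeffs (y\<^sup>2) / horner long_leg_coeffs (y\<^sup>2)"
proof -
  have "length cutoff_31 = 16" "length long_leg_31 = 16"
    using length_rev_eq[OF rev_cutoff_31] length_rev_eq[OF rev_long_leg_31]
      by (simp_all add: cutoff_coeffs_def long_leg_coeffs_def)
  then show ?thesis
    using assms horner_rev_square[OF assms, of cutoff_31]
        horner_rev_square[OF assms, of long_leg_31]
    by (simp add: rev_cutoff_31 rev_long_leg_31 horner_cutoff_31 horner_long_leg_31)
qed

lemma ratio_nonspider:
  assumes "0 < y"
  shows "cutoff_poly (1 / y\<^sup>2) 31 / nonspider_bound (1 / y\<^sup>2) 31
      = horner cutoff_coeffs (y\<^sup>2) / horner nonspider_coeffs (y\<^sup>2)"
proof -
  have "length cutoff_31 = 16" "length nonspider_31 = 16"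
    using length_rev_eq[OF rev_cutoff_31] length_rev_eq[OF rev_nonspider_31]
      by (simp_all add: cutoff_coeffs_def nonspider_coeffs_def)
  then show ?thesis
    using assms horner_rev_square[OF assms, of cutoff_31]
        horner_rev_square[OF assms, of nonspider_31]
    by (simp add: rev_cutoff_31 rev_nonspider_31 horner_cutoff_31 horner_nonspider_31)
qed

lemma square_bounds:
  assumes "0 \<le> (a::real)" "a < y" "y \<le> b"
  shows "a\<^sup>2 < y\<^sup>2" "y\<^sup>2 \<le> b\<^sup>2"
  using assms by (auto intro: power_strict_mono power_mono)

lemma log_check_piece:
  assumes "log_check F Q (a, b, d, X, e, W)"
    and "0 \<le> (ya::real)" "of_int a / of_int d = ya\<^sup>2" "of_int b / of_int d = yb\<^sup>2" "ya < y" "y \<le> yb"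
    and "0 < horner F (y\<^sup>2)" "0 < horner Q (y\<^sup>2)"
  shows "horner W (y\<^sup>2) / of_int e \<le> ln (horner F (y\<^sup>2) / horner Q (y\<^sup>2))"
  by (rule log_check_bound[OF assms(1)]) (use assms square_bounds[of ya y yb] in auto)

lemma log_tail:
  assumes "nonneg_coeffs (subst_shift 3 (list_add F (list_scale (- 1) Q)))" "2 \<le> y"
  shows "horner Q (y\<^sup>2) \<le> horner F (y\<^sup>2)"
proof -
  have "y\<^sup>2 \<ge> 3" using power_mono[of 2 y 2] assms(2) by simp
  from horner_nonneg_ge[OF assms(1), of "y\<^sup>2"] this show ?thesis by simp
qed

lemma pieces_bound_mono:
  assumes "pieces_bound g a ps" "\<And>y. a < y \<Longrightarrow> g y \<le> h y"
  shows "pieces_bound h a ps"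
  using assms by (induction g a ps rule: pieces_bound.induct) (auto intro: order_trans)

definition to_pieces :: "cert list \<Rightarrow> real list \<Rightarrow> (real \<times> int list \<times> int) list" where
  "to_pieces cs ys = map (\<lambda>((a, b, d, X, e, W), y). (y, W, e)) (zip cs ys)"

text \<open>Certificates refer to s = y^2 and knots to y. The endpoints must agree as squares,
  successive intervals must share an endpoint, and the last knot must reach 2, where
  \<open>log_tail\<close> takes over.\<close>

fun knots_ok :: "real \<Rightarrow> cert list \<Rightarrow> real list \<Rightarrow> bool" where
  "knots_ok ya ((a, b, d, X, e, W) # cs) (yb # ys) \<longleftrightarrow>
     0 \<le> ya \<and> ya \<le> yb \<and> of_int a / of_int d = ya\<^sup>2 \<and> of_int b / of_int d = yb\<^sup>2 \<and> knots_ok yb cs ys"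
| "knots_ok ya cs ys \<longleftrightarrow> cs = [] \<and> ys = [] \<and> 2 \<le> ya"

lemma pieces_bound_cert:
  assumes "list_all (log_check F Q) cs" "knots_ok ya cs ys"
    and "nonneg_coeffs (subst_shift 3 (list_add F (list_scale (- 1) Q)))"
    and "\<And>y. 0 < y \<Longrightarrow> 0 < horner F (y\<^sup>2)" "\<And>y. 0 < y \<Longrightarrow> 0 < horner Q (y\<^sup>2)"
  shows "pieces_bound (\<lambda>y. ln (horner F (y\<^sup>2) / horner Q (y\<^sup>2))) ya (to_pieces cs ys)"
  using assms(1,2)
proof (induction ya cs ys rule: knots_ok.induct)
  case (1 ya a b d X e W cs yb ys)
  have "horner W (y\<^sup>2) / of_int e \<le> ln (horner F (y\<^sup>2) / horner Q (y\<^sup>2))" if "ya < y" "y \<le> yb" for y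
    by (rule log_check_piece[of F Q a b d X e W ya yb]) (use 1 that assms in auto)
  with 1 show ?case by (simp add: to_pieces_def)
qed (use assms in \<open>auto simp: to_pieces_def intro!: log_tail\<close>)

lemma pieces_bound_long_leg: "pieces_bound (\<lambda>y. ln
    (horner cutoff_coeffs (y\<^sup>2) / horner long_leg_coeffs (y\<^sup>2))) 0
    (to_pieces cert_long_leg knots_long_leg)"
  by (rule pieces_bound_cert[OF log_check_long_leg _ tail_check_long_leg horner_cutoff_pos
      horner_long_leg_pos])
     (simp_all add: cert_long_leg_def knots_long_leg_def power_divide)

lemma pieces_bound_nonspider: "pieces_bound (\<lambda>y. ln
    (horner cutoff_coeffs (y\<^sup>2) / horner nonspider_coeffs (y\<^sup>2))) 0
    (to_pieces cert_nonspider knots_nonspider)"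
  by (rule pieces_bound_cert[OF log_check_nonspider _ tail_check_nonspider horner_cutoff_pos
      horner_nonspider_pos])
     (simp_all add: cert_nonspider_def knots_nonspider_def power_divide)

text \<open>An exact rational evaluation: the loss near y = 0 is outweighed by the gain for larger
  y.\<close>

lemma pieces_sum_long_leg: "0 < pieces_sum 0 (to_pieces cert_long_leg knots_long_leg)"
  by (simp add: to_pieces_def cert_long_leg_def knots_long_leg_def piece_integral_def power_divide)

lemma pieces_sum_nonspider: "0 < pieces_sum 0 (to_pieces cert_nonspider knots_nonspider)"
  by (simp add: to_pieces_def cert_nonspider_def knots_nonspider_def piece_integral_def
      power_divide)

section \<open>Monotonicity of the quotients in n\<close>

text \<open>
  The quotients of \<open>cutoff_poly\<close> by \<open>long_leg_poly\<close> and by \<open>nonspider_bound\<close> are increasing Moebius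
  functions of \<open>p\<^bsub>n-12\<^esub> / p\<^bsub>n-11\<^esub>\<close>.  This ratio is smallest at \<open>n = 31\<close>: as convergents of a
  continued fraction the ratios \<open>p\<^bsub>k-1\<^esub> / p\<^sub>k\<close> alternate around their limit.
\<close>

lemma path_poly_ratio_min:
  assumes "0 \<le> t" "31 \<le> n"
  shows "path_poly t (n - 11) * path_poly t 19 \<le> path_poly t (n - 12) * path_poly t 20"
proof -
  have "path_poly t 19 * path_poly t (20 + (n - 12) - 19) \<le> path_poly t 20 * path_poly t (n - 12)"
    using assms by (intro path_poly_mult_ge_odd) auto
  moreover have "20 + (n - 12) - 19 = n - 11" using assms by auto
  ultimately show ?thesis by (simp add: mult.commute)
qed

text \<open>Everything is expressed through p_{n-11} and p_{n-12}, because 11 is the largest amount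
  by which the three polynomials lower the index n.\<close>

lemma path_poly_expand_11:
  assumes "12 \<le> n"
  shows "path_poly t n = path_poly t 11 * path_poly t (n - 11)
      + t * path_poly t 10 * path_poly t (n - 12)"
    "path_poly t (n - 10) = path_poly t (n - 11) + t * path_poly t (n - 12)"
    "path_poly t (n - 6) = path_poly t 5 * path_poly t (n - 11)
        + t * path_poly t 4 * path_poly t (n - 12)"
    "path_poly t (n - 9) = path_poly t 2 * path_poly t (n - 11) + t * path_poly t (n - 12)"
proof -
  obtain m where n: "n = m + 12" using assms by (rule nat_ge_add)
  have "path_poly t (m + 12) = path_poly t 11 * path_poly t (m + 1)
      + t * path_poly t 10 * path_poly t m"
    using path_poly_add[of t 10 m] by (simp add: algebra_simps)
  moreover have "path_poly t (m + 6) = path_poly t 5 * path_poly t (m + 1)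
      + t * path_poly t 4 * path_poly t m"
    using path_poly_add[of t 4 m] by (simp add: algebra_simps)
  moreover have "path_poly t (m + 3) = path_poly t 2 * path_poly t (m + 1) + t * path_poly t m"
    using path_poly_add[of t 1 m] by (simp add: algebra_simps eval_nat_numeral)
  ultimately show "path_poly t n = path_poly t 11 * path_poly t (n - 11)
      + t * path_poly t 10 * path_poly t (n - 12)"
    "path_poly t (n - 10) = path_poly t (n - 11) + t * path_poly t (n - 12)"
    "path_poly t (n - 6) = path_poly t 5 * path_poly t (n - 11)
        + t * path_poly t 4 * path_poly t (n - 12)"
    "path_poly t (n - 9) = path_poly t 2 * path_poly t (n - 11) + t * path_poly t (n - 12)"
    by (simp_all add: n eval_nat_numeral)
qed

text \<open>As a function of z = q / p the quotient (A + B z) / (C + D z) has a derivative with the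
  sign of B C - A D; this is the version with cleared denominators.\<close>

lemma moebius_mono:
  fixes A B C D :: real
  assumes "0 \<le> B * C - A * D" "p * q' \<le> q * p'"
  shows "(A * p' + B * q') * (C * p + D * q) \<le> (A * p + B * q) * (C * p' + D * q')"
proof -
  have "(A * p + B * q) * (C * p' + D * q') - (A * p' + B * q') * (C * p + D * q)
     = (B * C - A * D) * (q * p' - p * q')" by (simp add: algebra_simps)
  also have "\<dots> \<ge> 0" using assms by simp
  finally show ?thesis by simp
qed

lemma cutoff_poly_coeffs:
  assumes "12 \<le> n"
  shows "cutoff_poly t n = (path_poly t 11 - t\<^sup>2 * path_poly t 6) * path_poly t (n - 11)
      + (t * path_poly t 10) * path_poly t (n - 12)"
  unfolding cutoff_poly_def path_poly_expand_11(1)[OF assms] by (simp add: algebra_simps)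

lemma long_leg_poly_coeffs:
  assumes "12 \<le> n"
  shows "long_leg_poly t n = (path_poly t 11 - t\<^sup>2 * (path_poly t 3)\<^sup>2) * path_poly t (n - 11)
    + (t * path_poly t 10 - t ^ 3 * (path_poly t 3)\<^sup>2) * path_poly t (n - 12)"
  unfolding long_leg_poly_def path_poly_expand_11(1,2)[OF assms]
  by (simp add: algebra_simps power2_eq_square power3_eq_cube)

lemma nonspider_bound_coeffs:
  assumes "12 \<le> n"
  shows "nonspider_bound t n = (path_poly t 11 - 2 * t\<^sup>2 * path_poly t 5 + t ^ 3 * path_poly t 2)
      * path_poly t (n - 11)
    + (t * path_poly t 10 - 2 * t ^ 3 * path_poly t 4 + t ^ 4) * path_poly t (n - 12)"
proof -
  have "nonspider_bound t n = path_poly t n - 2 * t\<^sup>2 * path_poly t (n - 6)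
      + t ^ 3 * path_poly t (n - 9)"
    using assms by (simp add: nonspider_bound_def)
  then show ?thesis
    unfolding path_poly_expand_11[OF assms]
    by (simp add: algebra_simps power_expand)
qed

lemma cutoff_long_leg_ratio_mono:
  assumes "0 \<le> t" "31 \<le> n"
  shows "cutoff_poly t 31 * long_leg_poly t n \<le> cutoff_poly t n * long_leg_poly t 31"
proof -
  let ?A = "path_poly t 11 - t\<^sup>2 * path_poly t 6" and ?B = "t * path_poly t 10"
  let ?C = "path_poly t 11 - t\<^sup>2 * (path_poly t 3)\<^sup>2"
      and ?D = "t * path_poly t 10 - t ^ 3 * (path_poly t 3)\<^sup>2"
  have "?B * ?C - ?A * ?D = t ^ 3 * (1 + t * (15 + t * (90 + t * (278 + t * (473 + t * (438
      + t * (202 + t * (37 + t))))))))"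
    unfolding path_poly_numeral by (simp add: algebra_simps eval_nat_numeral)
  also have "\<dots> \<ge> 0" using assms(1) by simp
  finally show ?thesis
    using moebius_mono[of ?B ?C ?A ?D "path_poly t (n - 11)" "path_poly t 19"
        "path_poly t (n - 12)" "path_poly t 20"]
      path_poly_ratio_min[OF assms] assms(2) cutoff_poly_coeffs[of n t]
          cutoff_poly_coeffs[of 31 t] long_leg_poly_coeffs[of n t] long_leg_poly_coeffs[of 31 t]
    by simp
qed

lemma cutoff_nonspider_ratio_mono:
  assumes "0 \<le> t" "31 \<le> n"
  shows "cutoff_poly t 31 * nonspider_bound t n \<le> cutoff_poly t n * nonspider_bound t 31"
proof -
  let ?A = "path_poly t 11 - t\<^sup>2 * path_poly t 6" and ?B = "t * path_poly t 10"
  let ?C = "path_poly t 11 - 2 * t\<^sup>2 * path_poly t 5 + t ^ 3 * path_poly t 2"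
    and ?D = "t * path_poly t 10 - 2 * t ^ 3 * path_poly t 4 + t ^ 4"
  have "?B * ?C - ?A * ?D = t ^ 3 * (1 + t * (14 + t * (77 + t * (216 + t * (335 + t * (289
      + t * (131 + t * (26 + t))))))))"
    unfolding path_poly_numeral by (simp add: algebra_simps eval_nat_numeral)
  also have "\<dots> \<ge> 0" using assms(1) by simp
  finally show ?thesis
    using moebius_mono[of ?B ?C ?A ?D "path_poly t (n - 11)" "path_poly t 19"
        "path_poly t (n - 12)" "path_poly t 20"]
      path_poly_ratio_min[OF assms] assms(2) cutoff_poly_coeffs[of n t]
          cutoff_poly_coeffs[of 31 t] nonspider_bound_coeffs[of n t] nonspider_bound_coeffs[of 31 t]
    by simp
qed

text \<open>By \<open>mono\<close> the quotient at n dominates the one at 31 for every t, so the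
  certified pieces for 31 bound the integrand for n as well.\<close>

lemma log_integral_pos:
  fixes g :: "real \<Rightarrow> real"
  assumes int: "set_integrable lborel {0<..} g"
    and g: "\<And>y. 0 < y \<Longrightarrow> ln (cutoff_poly (1 / y\<^sup>2) n / h (1 / y\<^sup>2) n) \<le> g y"
    and hn: "\<And>y. 0 < y \<Longrightarrow> 0 < h (1 / y\<^sup>2) n"
    and mono: "\<And>t. 0 \<le> t \<Longrightarrow> cutoff_poly t 31 * h t n \<le> cutoff_poly t n * h t 31"
    and ratio: "\<And>y. 0 < y \<Longrightarrow> cutoff_poly (1 / y\<^sup>2) 31 / h (1 / y\<^sup>2) 31
        = horner F (y\<^sup>2) / horner Q (y\<^sup>2)"
    and pos: "\<And>y. 0 < y \<Longrightarrow> 0 < cutoff_poly (1 / y\<^sup>2) 31" "\<And>y. 0 < y \<Longrightarrow> 0 < h (1 / y\<^sup>2) 31"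
    and bound: "pieces_bound (\<lambda>y. ln (horner F (y\<^sup>2) / horner Q (y\<^sup>2))) 0 ps" "0 < pieces_sum 0 ps"
  shows "0 < (LBINT y:{0<..}. g y)"
proof -
  have "ln (horner F (y\<^sup>2) / horner Q (y\<^sup>2)) \<le> g y" if y: "0 < y" for y
  proof -
    let ?t = "1 / y\<^sup>2"
    have "cutoff_poly ?t 31 / h ?t 31 \<le> cutoff_poly ?t n / h ?t n"
      using mono[of ?t] pos[OF y] hn[OF y] by (simp add: field_simps)
    moreover have "0 < cutoff_poly ?t 31 / h ?t 31" using pos[OF y] by simp
    ultimately have "ln (cutoff_poly ?t 31 / h ?t 31) \<le> ln (cutoff_poly ?t n / h ?t n)"
      by (simp only: ln_mono)
    then show ?thesis using g[OF y] ratio[OF y] by simp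
  qed
  then have "pieces_bound g 0 ps"
    by (intro pieces_bound_mono[OF bound(1)])
  then show ?thesis
    using set_integral_ge_pieces[OF int] bound(2) by fastforce
qed

lemma rev_flip: "rev p = q \<Longrightarrow> p = rev q" by auto

lemma values_31_pos:
  assumes "0 < y"
  shows "0 < cutoff_poly (1 / y\<^sup>2) 31" "0 < long_leg_poly (1 / y\<^sup>2) 31"
      "0 < nonspider_bound (1 / y\<^sup>2) 31"
proof -
  have "0 < horner (rev p) (1 / y\<^sup>2)" if "p \<in> {cutoff_coeffs, long_leg_coeffs, nonspider_coeffs}"
      for p
    by (rule horner_pos) (use that assms in \<open>auto simp: cutoff_coeffs_def long_leg_coeffs_def nonspider_coeffs_def nonneg_coeffs_def\<close>)
  then show "0 < cutoff_poly (1 / y\<^sup>2) 31" "0 < long_leg_poly (1 / y\<^sup>2) 31"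
      "0 < nonspider_bound (1 / y\<^sup>2) 31"
    unfolding horner_cutoff_31[symmetric] horner_long_leg_31[symmetric]
        horner_nonspider_31[symmetric]
      rev_flip[OF rev_cutoff_31] rev_flip[OF rev_long_leg_31] rev_flip[OF rev_nonspider_31] by auto
qed

lemma log_integral_pos_long_leg:
  fixes g :: "real \<Rightarrow> real"
  assumes "31 \<le> n" "set_integrable lborel {0<..} g"
    and "\<And>y. 0 < y \<Longrightarrow> ln (cutoff_poly (1 / y\<^sup>2) n / long_leg_poly (1 / y\<^sup>2) n) \<le> g y"
    and "\<And>y. 0 < y \<Longrightarrow> 0 < long_leg_poly (1 / y\<^sup>2) n"
  shows "0 < (LBINT y:{0<..}. g y)"
  using log_integral_pos[OF assms(2-4) cutoff_long_leg_ratio_mono[OF _ assms(1)] ratio_long_leg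
      values_31_pos(1,2)
    pieces_bound_long_leg pieces_sum_long_leg] by blast

lemma log_integral_pos_nonspider:
  fixes g :: "real \<Rightarrow> real"
  assumes "31 \<le> n" "set_integrable lborel {0<..} g"
    and "\<And>y. 0 < y \<Longrightarrow> ln (cutoff_poly (1 / y\<^sup>2) n / nonspider_bound (1 / y\<^sup>2) n) \<le> g y"
    and "\<And>y. 0 < y \<Longrightarrow> 0 < nonspider_bound (1 / y\<^sup>2) n"
  shows "0 < (LBINT y:{0<..}. g y)"
  using log_integral_pos[OF assms(2-4) cutoff_nonspider_ratio_mono[OF _ assms(1)] ratio_nonspider
      values_31_pos(1,3)
    pieces_bound_nonspider pieces_sum_nonspider] by blast

section \<open>Energy as an integral\<close>

text \<open>Indexing by a finite set in place of 0, ..., n - 1 turns the deletion of vertices into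
  restriction to a subset, without renumbering.\<close>

definition setdet :: "'a set \<Rightarrow> ('a \<Rightarrow> 'a \<Rightarrow> 'b :: comm_ring_1) \<Rightarrow> 'b" where
  "setdet V a = (\<Sum>p | p permutes V. of_int (sign p) * (\<Prod>i\<in>V. a i (p i)))"

lemma setdet_cong:
  assumes "\<And>i j. i \<in> V \<Longrightarrow> j \<in> V \<Longrightarrow> a i j = b i j"
  shows "setdet V a = setdet V b"
  unfolding setdet_def
  by (intro sum.cong refl arg_cong2[where f = "(*)"] prod.cong)
     (use assms permutes_in_image in fastforce)+

lemma setdet_reindex:
  assumes f: "bij_betw f A B" and "finite A"
  shows "setdet B a = setdet A (\<lambda>i j. a (f i) (f j))"
proof -
  have fA: "f ` A = B" and inj: "inj_on f A" using f by (auto simp: bij_betw_def)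
  have inv: "bij_betw (inv_into A f) B A" by (rule bij_betw_inv_into[OF f])
  have bij: "bij_betw (map_permutation A f) {p. p permutes A} {p. p permutes B}"
    by (rule bij_betw_byWitness[where f' = "map_permutation B (inv_into A f)"])
       (use f inv in \<open>auto intro!: map_permutation_compose_inv map_permutation_permutes
          simp: bij_betw_inv_into_left bij_betw_inv_into_right\<close>)
  have prod: "(\<Prod>i\<in>B. a i (map_permutation A f p i)) = (\<Prod>i\<in>A. a (f i) (f (p i)))" for p
    unfolding fA[symmetric] prod.reindex[OF inj] by (simp add: map_permutation_apply[OF inj])
  show ?thesis
    unfolding setdet_def sum.reindex_bij_betw[OF bij, symmetric] prod
    by (intro sum.cong refl) (simp add: sign_map_permutation[OF inj _ assms(2)])
qed

lemma det_mat_eq_setdet: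
  fixes a :: "'a \<Rightarrow> 'a \<Rightarrow> 'b :: comm_ring_1"
  assumes "distinct vs"
  shows "det (mat (length vs) (length vs) (\<lambda>(i, j). a (vs ! i) (vs ! j))) = setdet (set vs) a"
proof -
  have bij: "bij_betw ((!) vs) {0..<length vs} (set vs)"
    using bij_betw_nth[OF assms, of "{0..<length vs}" "set vs"] by (auto simp: atLeast0LessThan)
  show ?thesis
    unfolding setdet_reindex[OF bij finite_atLeastLessThan]
    by (auto simp: det_def setdet_def intro!: sum.cong prod.cong dest: permutes_in_image)
qed

lemma setdet_scale:
  "finite V \<Longrightarrow> setdet V (\<lambda>i j. c * a i j) = c ^ card V * setdet V a"
  unfolding setdet_def
  by (simp add: prod.distrib sum_distrib_left algebra_simps)

lemma permutes_fixpoint_iff: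
  assumes "v \<in> V"
  shows "p permutes V \<and> p v = v \<longleftrightarrow> p permutes (V - {v})"
proof
  assume p: "p permutes V \<and> p v = v"
  show "p permutes (V - {v})"
    by (rule permutes_superset[of p V]) (use p assms in auto)
next
  assume p: "p permutes (V - {v})"
  then show "p permutes V \<and> p v = v"
    using permutes_subset[of p "V - {v}" V] permutes_not_in[of p "V - {v}" v] by auto
qed

text \<open>A permutation that moves v picks a zero entry of row v.\<close>

lemma setdet_isolated:
  fixes a :: "'a \<Rightarrow> 'a \<Rightarrow> 'b :: idom"
  assumes "finite V" "v \<in> V" "\<And>j. j \<in> V - {v} \<Longrightarrow> a v j = 0"
  shows "setdet V a = a v v * setdet (V - {v}) a"
proof -
  have "setdet V a = (\<Sum>p | p permutes (V - {v}). of_int (sign p) * (\<Prod>i\<in>V. a i (p i)))"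
    unfolding setdet_def
  proof (rule sum.mono_neutral_right)
    show "{p. p permutes V - {v}} \<subseteq> {p. p permutes V}"
      using permutes_subset by fastforce
    show "\<forall>p\<in>{p. p permutes V} - {p. p permutes V - {v}}. of_int (sign p) * (\<Prod>i\<in>V. a i (p i)) = 0"
    proof
      fix p assume p: "p \<in> {p. p permutes V} - {p. p permutes V - {v}}"
      then have "p v \<noteq> v" "p v \<in> V"
        using permutes_fixpoint_iff[OF assms(2), of p] permutes_in_image[of p V v] assms(2) by auto
      then have "a v (p v) = 0" using assms(3) by auto
      then have "(\<Prod>i\<in>V. a i (p i)) = 0" using assms(1,2) by auto
      then show "of_int (sign p) * (\<Prod>i\<in>V. a i (p i)) = 0" by simp
    qed
  qed (use assms finite_permutations in auto)
  also have "\<dots> = a v v * setdet (V - {v}) a"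
    unfolding setdet_def sum_distrib_left
  proof (intro sum.cong refl)
    fix p assume "p \<in> {p. p permutes V - {v}}"
    then have "p v = v" using permutes_not_in[of p "V - {v}" v] by auto
    then show "of_int (sign p) * (\<Prod>i\<in>V. a i (p i)) =
        a v v * (of_int (sign p) * (\<Prod>i\<in>V - {v}. a i (p i)))"
      using assms(1,2) by (simp add: prod.remove algebra_simps)
  qed
  finally show ?thesis .
qed

text \<open>Nonzero terms come only from permutations that fix v or exchange v and u. The exchange
  contributes the sign -1 of a transposition.\<close>

lemma setdet_leaf:
  fixes a :: "'a \<Rightarrow> 'a \<Rightarrow> 'b :: idom"
  assumes "finite V" "v \<in> V" "u \<in> V" "u \<noteq> v"
    and "\<And>j. j \<in> V - {v, u} \<Longrightarrow> a v j = 0" "\<And>j. j \<in> V - {v, u} \<Longrightarrow> a j v = 0"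
  shows "setdet V a = a v v * setdet (V - {v}) a - a v u * a u v * setdet (V - {v, u}) a"
proof -
  let ?f = "\<lambda>p. of_int (sign p) * (\<Prod>i\<in>V. a i (p i)) :: 'b"
  let ?A = "{p. p permutes V - {v}}"
  \<comment> \<open>The permutations that contain the 2-cycle of v and u, parametrised by their
    action q on the other indices.\<close>
  let ?B = "(\<lambda>q. Transposition.transpose v u \<circ> q) ` {q. q permutes V - {v, u}}"
  have Bperm: "p permutes V" "p v = u" "p u = v" if "p \<in> ?B" for p
  proof -
    obtain q where q: "q permutes V - {v, u}" "p = Transposition.transpose v u \<circ> q"
      using \<open>p \<in> ?B\<close> by blast
    have "q permutes V" using permutes_subset[OF q(1)] by auto
    then show "p permutes V" unfolding q(2)
      by (rule permutes_compose) (use assms in \<open>auto intro: permutes_swap_id\<close>)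
    show "p v = u" "p u = v" using permutes_not_in[OF q(1)] q(2) by auto
  qed
  have "setdet V a = sum ?f (?A \<union> ?B)"
    unfolding setdet_def
  proof (rule sum.mono_neutral_right)
    show "?A \<union> ?B \<subseteq> {p. p permutes V}"
      using Bperm(1) permutes_subset[of _ "V - {v}" V] by blast
    show "\<forall>p\<in>{p. p permutes V} - (?A \<union> ?B). ?f p = 0"
    proof
      fix p assume "p \<in> {p. p permutes V} - (?A \<union> ?B)"
      then have p: "p permutes V" "p \<notin> ?A" "p \<notin> ?B" by auto
      have pv: "p v \<noteq> v" "p v \<in> V"
        using p permutes_fixpoint_iff[OF assms(2), of p] permutes_in_image[of p V v] assms(2)
          by auto
      obtain w where w: "w \<in> V" "p w = v"
        using p(1) assms(2) by (metis permutes_def permutes_in_image)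
      show "?f p = 0"
      proof (cases "p v = u \<and> w = u")
        case True
        define q where "q = Transposition.transpose v u \<circ> p"
        have "q permutes V" unfolding q_def
          by (rule permutes_compose[OF p(1)]) (use assms in \<open>auto intro: permutes_swap_id\<close>)
        then have "q permutes V - {v, u}"
          by (rule permutes_superset) (use True w in \<open>auto simp: q_def\<close>)
        moreover have "p = Transposition.transpose v u \<circ> q" by (auto simp: q_def)
        ultimately show ?thesis using p(3) by auto
      next
        case False
        \<comment> \<open>If v is not sent to u, row v gives a zero. If it is, the preimage w of v
          differs from u, and column v gives a zero.\<close>
        then have "a v (p v) = 0 \<or> a w (p w) = 0"
          using pv w assms by (cases "p v = u") (auto, metis)
        then have "(\<Prod>i\<in>V. a i (p i)) = 0" using assms(1,2) w(1) by auto
        then show ?thesis by simp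
      qed
    qed
  qed (use assms finite_permutations in auto)
  also have "\<dots> = sum ?f ?A + sum ?f ?B"
  proof (rule sum.union_disjoint)
    show "?A \<inter> ?B = {}"
    proof (rule equals0I)
      fix p assume p: "p \<in> ?A \<inter> ?B"
      then have "p v = v" using permutes_not_in[of p "V - {v}" v] by simp
      moreover have "p v = u" using p Bperm(2) by simp
      ultimately show False using assms(4) by simp
    qed
  qed (use assms(1) in \<open>auto intro!: finite_permutations finite_imageI\<close>)
  also have "sum ?f ?A = a v v * setdet (V - {v}) a"
    unfolding setdet_def sum_distrib_left
  proof (intro sum.cong refl)
    fix p assume "p \<in> {p. p permutes V - {v}}"
    then have "p v = v" using permutes_not_in[of p "V - {v}" v] by auto
    then show "?f p = a v v * (of_int (sign p) * (\<Prod>i\<in>V - {v}. a i (p i)))"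
      using assms(1,2) by (simp add: prod.remove algebra_simps)
  qed
  also have "sum ?f ?B = - (a v u * a u v * setdet (V - {v, u}) a)"
  proof -
    have "inj_on (\<lambda>q. Transposition.transpose v u \<circ> q) {q. q permutes V - {v, u}}"
      by (rule inj_onI) (metis comp_assoc comp_id transpose_comp_involutory comp_apply
          fun.map_comp id_comp)
    then have "sum ?f ?B = (\<Sum>q | q permutes V - {v, u}. ?f (Transposition.transpose v u \<circ> q))"
      by (simp add: sum.reindex)
    also have "\<dots> = (\<Sum>q | q permutes V - {v, u}.
        - (a v u * a u v) * (of_int (sign q) * (\<Prod>i\<in>V - {v, u}. a i (q i))))"
    proof (intro sum.cong refl)
      fix q assume "q \<in> {q. q permutes V - {v, u}}"
      then have q: "q permutes V - {v, u}" by simp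
      have fin: "finite (V - {v, u})" using assms(1) by simp
      have "sign (Transposition.transpose v u \<circ> q) = sign (Transposition.transpose v u) * sign q"
        using permutation_permutes[of q] q fin
          by (intro sign_compose) (auto simp: permutation_swap_id)
      then have s: "sign (Transposition.transpose v u \<circ> q) = - sign q"
        using assms(4) by (simp add: sign_swap_id)
      have V: "V = insert v (insert u (V - {v, u}))" using assms by auto
      have "(\<Prod>i\<in>V. a i ((Transposition.transpose v u \<circ> q) i))
          = a v u * (a u v * (\<Prod>i\<in>V - {v, u}. a i ((Transposition.transpose v u \<circ> q) i)))"
        using fin assms(4) permutes_not_in[OF q] by (subst V) (simp add: prod.insert)
      also have "(\<Prod>i\<in>V - {v, u}. a i ((Transposition.transpose v u \<circ> q) i))
          = (\<Prod>i\<in>V - {v, u}. a i (q i))"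
      proof (intro prod.cong refl)
        fix i assume "i \<in> V - {v, u}"
        then have "q i \<in> V - {v, u}" using permutes_in_image[OF q] by blast
        then show "a i ((Transposition.transpose v u \<circ> q) i) = a i (q i)"
          by (auto simp: Transposition.transpose_def)
      qed
      finally show "?f (Transposition.transpose v u \<circ> q) =
        - (a v u * a u v) * (of_int (sign q) * (\<Prod>i\<in>V - {v, u}. a i (q i)))"
        unfolding s by (simp add: algebra_simps)
    qed
    finally show ?thesis
      unfolding setdet_def by (simp add: sum_distrib_left sum_negf)
  qed
  finally show ?thesis by simp
qed

section \<open>Matching polynomials as determinants\<close>

definition weight_mat :: "('a \<times> 'a) set \<Rightarrow> real \<Rightarrow> 'a \<Rightarrow> 'a \<Rightarrow> complex" where
  "weight_mat E t i j = (if i = j then 1 else if (i, j) \<in> E then \<i> * sqrt t else 0)"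

definition matching_det :: "('a \<times> 'a) set \<Rightarrow> real \<Rightarrow> 'a set \<Rightarrow> complex" where
  "matching_det E t V = setdet V (weight_mat E t)"

text \<open>
  For a forest, \<open>det (I + \<surd>(-t) A)\<close> is the generating function of the matchings by size,
  evaluated at \<open>t\<close>.
\<close>

definition matching_poly :: "('a \<times> 'a) set \<Rightarrow> real \<Rightarrow> 'a set \<Rightarrow> real" where
  "matching_poly E t V = Re (matching_det E t V)"

lemma matching_det_empty [simp]: "matching_det E t {} = 1"
  by (simp add: matching_det_def setdet_def)

lemma matching_det_isolated:
  assumes "finite V" "v \<in> V" "\<And>j. j \<in> V - {v} \<Longrightarrow> (v, j) \<notin> E"
  shows "matching_det E t V = matching_det E t (V - {v})"
  unfolding matching_det_def using assms by (subst setdet_isolated[of V v])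
      (auto simp: weight_mat_def)

text \<open>The two entries for the edge are both i sqrt(t), with product -t. The minus sign of
  \<open>setdet_leaf\<close> thus becomes a plus, and the result is the leaf recursion for
  matchings.\<close>

lemma matching_det_leaf:
  assumes "sym E" "finite V" "v \<in> V" "u \<in> V" "u \<noteq> v" "(v, u) \<in> E" "0 \<le> t"
    and "\<And>j. j \<in> V - {v, u} \<Longrightarrow> (v, j) \<notin> E"
  shows "matching_det E t V = matching_det E t (V - {v})
      + of_real t * matching_det E t (V - {v, u})"
proof -
  have "(u, v) \<in> E" "\<And>j. j \<in> V - {v, u} \<Longrightarrow> (j, v) \<notin> E"
    using assms by (auto dest: symD)
  moreover have "\<i> * of_real (sqrt t) * (\<i> * of_real (sqrt t)) = - of_real t"
    using assms(7) by (simp add: algebra_simps flip: of_real_mult)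
  ultimately show ?thesis
    unfolding matching_det_def using assms
    by (subst setdet_leaf[of V v u]) (auto simp: weight_mat_def)
qed

lemma matching_poly_empty [simp]: "matching_poly E t {} = 1"
  by (simp add: matching_poly_def)

lemma matching_poly_isolated:
  assumes "finite V" "v \<in> V" "\<And>j. j \<in> V - {v} \<Longrightarrow> (v, j) \<notin> E"
  shows "matching_poly E t V = matching_poly E t (V - {v})"
  unfolding matching_poly_def using matching_det_isolated[OF assms] by simp

lemma matching_poly_leaf:
  assumes "sym E" "finite V" "v \<in> V" "u \<in> V" "u \<noteq> v" "(v, u) \<in> E" "0 \<le> t"
    and "\<And>j. j \<in> V - {v, u} \<Longrightarrow> (v, j) \<notin> E"
  shows "matching_poly E t V = matching_poly E t (V - {v}) + t * matching_poly E t (V - {v, u})"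
  unfolding matching_poly_def using matching_det_leaf[OF assms] by simp

lemma matching_poly_iso:
  assumes "bij_betw f V W" "finite V"
    and "\<And>x y. x \<in> V \<Longrightarrow> y \<in> V \<Longrightarrow> (f x, f y) \<in> F \<longleftrightarrow> (x, y) \<in> E"
  shows "matching_poly F t W = matching_poly E t V"
proof -
  have "setdet W (weight_mat F t) = setdet V (\<lambda>i j. weight_mat F t (f i) (f j))"
    by (rule setdet_reindex[OF assms(1,2)])
  also have "\<dots> = setdet V (weight_mat E t)"
    by (rule setdet_cong)
       (use assms in \<open>auto simp: weight_mat_def bij_betw_def inj_on_eq_iff\<close>)
  finally show ?thesis by (simp add: matching_poly_def matching_det_def)
qed

section \<open>The spectrum of a symmetric adjacency matrix\<close>

definition vertex_list :: "'a pair_pre_digraph \<Rightarrow> 'a list" where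
  "vertex_list G = (SOME vs. distinct vs \<and> set vs = pverts G)"

lemma vertex_list:
  assumes "finite (pverts G)"
  shows "distinct (vertex_list G)" "set (vertex_list G) = pverts G"
proof -
  have "\<exists>vs. distinct vs \<and> set vs = pverts G" using finite_distinct_list[OF assms] by auto
  from someI_ex[OF this] show "distinct (vertex_list G)" "set (vertex_list G) = pverts G"
    by (auto simp: vertex_list_def)
qed

definition spectrum_mset :: "'a pair_pre_digraph \<Rightarrow> complex multiset" where
  "spectrum_mset G = proots (char_poly (adjacency_matrix G (vertex_list G)))"

lemma energy_spectrum: "energy G = (\<Sum>x\<in>#spectrum_mset G. cmod x)"
  by (simp add: energy_def spectrum_mset_def vertex_list_def)

lemma adjacency_carrier: "adjacency_matrix G vs \<in> carrier_mat (length vs) (length vs)"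
  by (simp add: adjacency_matrix_def)

lemma hermitian_quadratic_form_real:
  fixes a :: "nat \<Rightarrow> nat \<Rightarrow> complex" and v :: "nat \<Rightarrow> complex"
  assumes "\<And>i j. i < n \<Longrightarrow> j < n \<Longrightarrow> a j i = cnj (a i j)"
  shows "(\<Sum>i<n. \<Sum>j<n. cnj (v i) * a i j * v j) \<in> \<real>"
proof -
  have "cnj (\<Sum>i<n. \<Sum>j<n. cnj (v i) * a i j * v j) = (\<Sum>i<n. \<Sum>j<n. v i * a j i * cnj (v j))"
    unfolding cnj_sum
  proof (intro sum.cong refl)
    fix i j assume "i \<in> {..<n}" "j \<in> {..<n}"
    then have "a j i = cnj (a i j)" by (auto intro: assms simp del: complex_cnj_cancel_iff)
    then show "cnj (cnj (v i) * a i j * v j) = v i * a j i * cnj (v j)" by simp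
  qed
  also have "\<dots> = (\<Sum>j<n. \<Sum>i<n. v i * a j i * cnj (v j))" by (rule sum.swap)
  also have "\<dots> = (\<Sum>i<n. \<Sum>j<n. cnj (v i) * a i j * v j)" by (simp add: mult_ac)
  finally show ?thesis by (simp add: Reals_cnj_iff)
qed

text \<open>For an eigenvector v the hermitian form of A at v is real, and it equals k times the
  positive number S, the squared norm of v.\<close>

lemma eigenvalue_adjacency_real:
  assumes "sym (parcs G)" "eigenvalue (adjacency_matrix G vs) k"
  shows "k \<in> \<real>"
proof -
  define n where "n = length vs"
  define A where "A = adjacency_matrix G vs"
  define a where "a i j = A $$ (i, j)" for i j
  have A: "A \<in> carrier_mat n n" by (simp add: A_def n_def adjacency_carrier)
  obtain v where v: "v \<in> carrier_vec n" "v \<noteq> 0\<^sub>v n" "A *\<^sub>v v = k \<cdot>\<^sub>v v"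
    using assms(2) A by (auto simp: eigenvalue_def eigenvector_def A_def)
  have row: "(\<Sum>j<n. a i j * v $ j) = k * v $ i" if "i < n" for i
  proof -
    have "(A *\<^sub>v v) $ i = (\<Sum>j<n. a i j * v $ j)"
      using that A v(1) by (simp add: scalar_prod_def a_def atLeast0LessThan)
    then show ?thesis using v that by simp
  qed
  have "(\<Sum>i<n. \<Sum>j<n. cnj (v $ i) * a i j * v $ j) = (\<Sum>i<n. cnj (v $ i) * (\<Sum>j<n. a i j * v $ j))"
    by (simp add: sum_distrib_left mult_ac)
  also have "\<dots> = (\<Sum>i<n. k * of_real ((cmod (v $ i))\<^sup>2))"
  proof (intro sum.cong refl)
    fix i assume "i \<in> {..<n}"
    then have "cnj (v $ i) * (\<Sum>j<n. a i j * v $ j) = k * (v $ i * cnj (v $ i))"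
      using row by simp
    then show "cnj (v $ i) * (\<Sum>j<n. a i j * v $ j) = k * of_real ((cmod (v $ i))\<^sup>2)"
      by (simp only: complex_norm_square)
  qed
  also have "\<dots> = k * of_real (\<Sum>i<n. (cmod (v $ i))\<^sup>2)"
    by (simp add: sum_distrib_left)
  finally have eq: "(\<Sum>i<n. \<Sum>j<n. cnj (v $ i) * a i j * v $ j)
      = k * of_real (\<Sum>i<n. (cmod (v $ i))\<^sup>2)" .
  have "(\<Sum>i<n. \<Sum>j<n. cnj (v $ i) * a i j * v $ j) \<in> \<real>"
    by (rule hermitian_quadratic_form_real)
       (use assms(1) in \<open>auto simp: a_def A_def adjacency_matrix_def n_def dest: symD\<close>)
  then have "k * of_real (\<Sum>i<n. (cmod (v $ i))\<^sup>2) \<in> \<real>" unfolding eq .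
  moreover have "\<exists>i<n. v $ i \<noteq> 0"
  proof (rule ccontr)
    assume "\<not> (\<exists>i<n. v $ i \<noteq> 0)"
    then have "v = 0\<^sub>v n" using v(1) by (intro eq_vecI) auto
    then show False using v(2) by simp
  qed
  then obtain i where i: "i < n" "v $ i \<noteq> 0" by auto
  define S where "S = (\<Sum>i<n. (cmod (v $ i))\<^sup>2)"
  have "S > 0"
    unfolding S_def by (rule sum_pos2[of _ i]) (use i in auto)
  then have "k = k * of_real S / of_real S" by simp
  ultimately show ?thesis
    unfolding S_def[symmetric] by (metis Reals_divide Reals_of_real)
qed

lemma spectrum_real:
  assumes "sym (parcs G)" "x \<in># spectrum_mset G"
  shows "x \<in> \<real>"
proof -
  let ?A = "adjacency_matrix G (vertex_list G)"
  have "char_poly ?A \<noteq> 0"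
    using degree_monic_char_poly[OF adjacency_carrier[of G "vertex_list G"]] by auto
  then have "poly (char_poly ?A) x = 0" using assms(2) by (simp add: spectrum_mset_def)
  then have "eigenvalue ?A x"
    by (simp add: eigenvalue_root_char_poly[OF adjacency_carrier])
  then show ?thesis by (rule eigenvalue_adjacency_real[OF assms(1)])
qed

text \<open>The characteristic polynomial is evaluated at k in two ways, as a product over its roots
  and as a determinant; the common factor k^n is cancelled.\<close>

lemma char_poly_adjacency:
  assumes "finite (pverts G)" "0 < t" "\<And>x. (x, x) \<notin> parcs G"
  shows "matching_det (parcs G) t (pverts G) = (\<Prod>x\<in>#spectrum_mset G. 1 + \<i> * sqrt t * x)"
proof -
  define vs where "vs = vertex_list G"
  define n where "n = length vs"
  have vs: "distinct vs" "set vs = pverts G" using vertex_list[OF assms(1)] by (auto simp: vs_def)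
  define A where "A = adjacency_matrix G vs"
  define P where "P = char_poly A"
  have A: "A \<in> carrier_mat n n" by (simp add: A_def n_def adjacency_carrier)
  have P: "degree P = n" "lead_coeff P = 1" using degree_monic_char_poly[OF A] by (auto simp: P_def)
  have spec: "spectrum_mset G = proots P" by (simp add: spectrum_mset_def P_def A_def vs_def)
  \<comment> \<open>Chosen so that k I - A = k (I + i sqrt(t) A).\<close>
  define k where "k = \<i> / sqrt t"
  have k: "k \<noteq> 0" "- 1 / k = \<i> * sqrt t" using assms(2) by (auto simp: k_def field_simps)
  have "poly P k = (\<Prod>x\<in>#proots P. k - x)"
    using arg_cong[OF complex_poly_decompose_multiset[of P], of "\<lambda>p. poly p k"] P(2)
    by (simp add: poly_prod_mset image_mset.compositionality o_def)
  also have "\<dots> = (\<Prod>x\<in>#proots P. k * (1 + \<i> * sqrt t * x))"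
    by (intro arg_cong[where f = prod_mset] image_mset_cong)
       (use k(1) in \<open>simp add: k(2)[symmetric] field_simps\<close>)
  also have "\<dots> = k ^ n * (\<Prod>x\<in>#proots P. 1 + \<i> * sqrt t * x)"
    using size_proots_complex[of P] P(1) by (simp add: prod_mset.distrib)
  finally have 1: "poly P k = k ^ n * (\<Prod>x\<in>#proots P. 1 + \<i> * sqrt t * x)" .
  have "poly P k = det (- (char_matrix A k))"
    unfolding P_def by (rule char_poly_matrix[OF A])
  also have "- (char_matrix A k) = mat (length vs) (length vs)
      (\<lambda>(i, j). k * weight_mat (parcs G) t (vs ! i) (vs ! j))"
    (is "_ = mat _ _ ?f")
  proof (rule eq_matI)
    fix i j assume ij: "i < dim_row (mat (length vs) (length vs) ?f)"
        "j < dim_col (mat (length vs) (length vs) ?f)"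
    have "k * (\<i> * sqrt t) = - 1" using k by (simp flip: k(2))
    then show "(- (char_matrix A k)) $$ (i, j) = mat (length vs) (length vs) ?f $$ (i, j)"
      using ij vs(1) assms(3)
      by (auto simp: char_matrix_def A_def adjacency_matrix_def weight_mat_def nth_eq_iff_index_eq)
  qed (simp_all add: char_matrix_def A_def adjacency_matrix_def)
  also have "det \<dots> = setdet (set vs) (\<lambda>i j. k * weight_mat (parcs G) t i j)"
    by (rule det_mat_eq_setdet[OF vs(1)])
  also have "\<dots> = k ^ n * matching_det (parcs G) t (pverts G)"
    using vs distinct_card[OF vs(1)] by (simp add: setdet_scale[OF assms(1)] matching_det_def n_def)
  finally show ?thesis using 1 k(1) by (simp add: spec)
qed

section \<open>The Coulson integral\<close>

text \<open>The contribution of a single eigenvalue of modulus c: it turns the logarithm of a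
  product over the spectrum into a sum of absolute values.\<close>

lemma log_integral:
  fixes c :: real
  assumes "0 \<le> c"
  shows "set_integrable lborel {0<..} (\<lambda>y. ln (1 + c\<^sup>2 / y\<^sup>2))" (is ?int)
    and "(LBINT y:{0<..}. ln (1 + c\<^sup>2 / y\<^sup>2)) = pi * c" (is ?eq)
proof -
  have "?int \<and> ?eq"
  proof (cases "c = 0")
    case True
    then show ?thesis by (simp add: set_lebesgue_integral_def set_integrable_def)
  next
    case False
    then have c: "0 < c" using assms by simp
    let ?f = "\<lambda>y. ln (1 + c\<^sup>2 / y\<^sup>2)"
    \<comment> \<open>Integration by parts. The first summand tends to 0 at both ends, and the
      arctangent supplies pi c at infinity.\<close>
    let ?F = "\<lambda>y. y * ln (1 + c\<^sup>2 / y\<^sup>2) + 2 * c * arctan (y / c)"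
    have D: "DERIV ?F y :> ?f y" if "0 < y" for y
    proof -
      have pos: "1 + c\<^sup>2 / y\<^sup>2 > 0" using that by (simp add: add_pos_nonneg)
      have "DERIV ?F y :> ?f y + y * ((- 2 * c\<^sup>2 / y ^ 3) / (1 + c\<^sup>2 / y\<^sup>2))
          + 2 * c * ((1 / c) / (1 + (y / c)\<^sup>2))"
      proof -
        have "((\<lambda>y. 1 + c\<^sup>2 / y\<^sup>2) has_real_derivative - 2 * c\<^sup>2 / y ^ 3) (at y)"
          using that by (auto intro!: derivative_eq_intros simp: field_simps power2_eq_square
              power3_eq_cube)
        from DERIV_chain2[OF DERIV_ln_divide[OF pos] this]
        have 1: "(?f has_real_derivative (- 2 * c\<^sup>2 / y ^ 3) / (1 + c\<^sup>2 / y\<^sup>2)) (at y)"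
          by (simp add: mult.commute)
        have 2: "((\<lambda>y. arctan (y / c)) has_real_derivative (1 / c) / (1 + (y / c)\<^sup>2)) (at y)"
          using c by (auto intro!: derivative_eq_intros simp: divide_inverse)
        show ?thesis
          using DERIV_add[OF DERIV_mult[OF DERIV_ident 1] DERIV_cmult[OF 2, of "2 * c"]]
          by (simp add: mult.commute add.commute)
      qed
      also have "?f y + y * ((- 2 * c\<^sup>2 / y ^ 3) / (1 + c\<^sup>2 / y\<^sup>2))
          + 2 * c * ((1 / c) / (1 + (y / c)\<^sup>2)) = ?f y"
      proof -
        have "y\<^sup>2 + c\<^sup>2 \<noteq> 0" using c by (simp add: add_nonneg_eq_0_iff)
        moreover have "y * ((- 2 * c\<^sup>2 / y ^ 3) / (1 + c\<^sup>2 / y\<^sup>2)) = - 2 * c\<^sup>2 / (y\<^sup>2 + c\<^sup>2)"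
          using that calculation by (simp add: divide_simps power2_eq_square power3_eq_cube)
        moreover have "2 * c * ((1 / c) / (1 + (y / c)\<^sup>2)) = 2 * c\<^sup>2 / (y\<^sup>2 + c\<^sup>2)"
          using c that calculation by (simp add: divide_simps power2_eq_square)
        ultimately show ?thesis by simp
      qed
      finally show ?thesis .
    qed
    have cont: "isCont ?f y" if "0 < y" for y
    proof -
      have "1 + c\<^sup>2 / y\<^sup>2 > 0" using that by (simp add: add_pos_nonneg)
      then show ?thesis using that by (intro continuous_intros) auto
    qed
    have l0: "((?F \<circ> real_of_ereal) \<longlongrightarrow> 0) (at_right (0::ereal))"
      unfolding zero_ereal_def ereal_tendsto_simps using c by real_asymp
    have l1: "((?F \<circ> real_of_ereal) \<longlongrightarrow> pi * c) (at_left (\<infinity>::ereal))"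
      unfolding ereal_tendsto_simps using c by real_asymp
    have e: "einterval 0 \<infinity> = {0<..}" by (auto simp: einterval_def zero_ereal_def)
    note FTC = interval_integral_FTC_nonneg[of 0 \<infinity> ?F ?f, OF _ _ _ _ l0 l1]
    have "set_integrable lborel (einterval 0 \<infinity>) ?f" "(LBINT x=0..\<infinity>. ?f x) = pi * c - 0"
      by (rule FTC; use D cont in \<open>auto simp: zero_ereal_def\<close>)+
    then show ?thesis
      by (simp add: e interval_lebesgue_integral_def)
  qed
  then show ?int ?eq by auto
qed

lemma norm_prod_mset: "norm (\<Prod>x\<in>#R. f x) = (\<Prod>x\<in>#R. norm (f x))" for f :: "'a \<Rightarrow> complex"
  by (induction R) (auto simp: norm_mult)

lemma ln_prod_mset: "(\<And>x. x \<in># R \<Longrightarrow> 0 < f x) \<Longrightarrow> ln (\<Prod>x\<in>#R. f x) = (\<Sum>x\<in>#R. ln (f x))"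
  for f :: "'a \<Rightarrow> real"
proof (induction R)
  case (add x R)
  have "0 < (\<Prod>x\<in>#R. f x)" if "\<And>x. x \<in># R \<Longrightarrow> 0 < f x"
    using that by (induction R) auto
  then have "0 < (\<Prod>x\<in>#R. f x)" "0 < f x" using add.prems by auto
  then have "ln (f x * (\<Prod>x\<in>#R. f x)) = ln (f x) + ln (\<Prod>x\<in>#R. f x)" by (rule ln_mult_pos[rotated])
  moreover have "ln (\<Prod>x\<in>#R. f x) = (\<Sum>x\<in>#R. ln (f x))"
    using add by simp
  ultimately show ?case by simp
qed simp

lemma log_integral_mset:
  fixes R :: "complex multiset"
  shows "set_integrable lborel {0<..} (\<lambda>y. \<Sum>x\<in>#R. ln (1 + (cmod x)\<^sup>2 / y\<^sup>2))
    \<and> (LBINT y:{0<..}. (\<Sum>x\<in>#R. ln (1 + (cmod x)\<^sup>2 / y\<^sup>2))) = pi * (\<Sum>x\<in>#R. cmod x)"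
proof (induction R)
  case (add x R)
  note 1 = log_integral[of "cmod x", simplified]
  show ?case
    using set_integral_add[OF 1(1) conjunct1[OF add.IH]] add.IH 1(2)
    by (simp add: algebra_simps)
qed (simp add: set_integrable_def set_lebesgue_integral_def)

text \<open>For a real eigenvalue x the factor 1 + i sqrt(t) x has modulus sqrt(1 + t x^2), and this
  square root is the source of the factor 1 / 2. By the hypotheses \<open>real\<close> and
  \<open>pos\<close> the polynomial equals the modulus of the determinant.\<close>

theorem energy_log_integral:
  assumes "sym (parcs G)" "finite (pverts G)" "\<And>x. (x, x) \<notin> parcs G"
    and real: "\<And>t. 0 < t \<Longrightarrow> matching_det (parcs G) t (pverts G)
        = of_real (matching_poly (parcs G) t (pverts G))"
    and pos: "\<And>t. 0 < t \<Longrightarrow> 0 < matching_poly (parcs G) t (pverts G)"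
  shows "set_integrable lborel {0<..} (\<lambda>y. ln (matching_poly (parcs G) (1 / y\<^sup>2) (pverts G)))"
    and "(LBINT y:{0<..}. ln (matching_poly (parcs G) (1 / y\<^sup>2) (pverts G))) = pi / 2 * energy G"
proof -
  let ?R = "spectrum_mset G"
  have ln: "ln (matching_poly (parcs G) (1 / y\<^sup>2) (pverts G))
      = (\<Sum>x\<in>#?R. ln (1 + (cmod x)\<^sup>2 / y\<^sup>2)) / 2"
    if "0 < y" for y
  proof -
    let ?t = "1 / y\<^sup>2"
    have t: "0 < ?t" using that by simp
    have "matching_poly (parcs G) ?t (pverts G) = cmod (matching_det (parcs G) ?t (pverts G))"
      using pos[OF t] unfolding real[OF t] by simp
    also have "\<dots> = (\<Prod>x\<in>#?R. cmod (1 + \<i> * sqrt ?t * x))"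
      unfolding char_poly_adjacency[OF assms(2) t assms(3)] norm_prod_mset ..
    also have "\<dots> = (\<Prod>x\<in>#?R. sqrt (1 + (cmod x)\<^sup>2 / y\<^sup>2))"
    proof (intro arg_cong[where f = prod_mset] image_mset_cong)
      fix x assume "x \<in># ?R"
      then obtain r where r: "x = of_real r" using spectrum_real[OF assms(1)]
        by (auto elim: Reals_cases)
      have "cmod (1 + \<i> * sqrt ?t * x) = sqrt (1 + (sqrt ?t * r)\<^sup>2)"
        by (simp add: r cmod_def)
      also have "(sqrt ?t * r)\<^sup>2 = (cmod x)\<^sup>2 / y\<^sup>2"
        using t by (simp add: r power_mult_distrib)
      finally show "cmod (1 + \<i> * sqrt ?t * x) = sqrt (1 + (cmod x)\<^sup>2 / y\<^sup>2)" .
    qed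
    finally have "ln (matching_poly (parcs G) ?t (pverts G))
        = (\<Sum>x\<in>#?R. ln (sqrt (1 + (cmod x)\<^sup>2 / y\<^sup>2)))"
      by (simp add: ln_prod_mset add_pos_nonneg)
    also have "\<dots> = (\<Sum>x\<in>#?R. ln (1 + (cmod x)\<^sup>2 / y\<^sup>2) * (1 / 2))"
      by (intro arg_cong[where f = sum_mset] image_mset_cong) (simp add: ln_sqrt add_pos_nonneg)
    also have "\<dots> = (\<Sum>x\<in>#?R. ln (1 + (cmod x)\<^sup>2 / y\<^sup>2)) / 2"
    proof -
      have "(\<Sum>x\<in>#M. g x * (1 / 2)) = (\<Sum>x\<in>#M. g x) / 2" for M and g :: "complex \<Rightarrow> real"
        by (induction M) (auto simp: add_divide_distrib)
      then show ?thesis .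
    qed
    finally show ?thesis .
  qed
  note I = log_integral_mset[of ?R]
  have "set_integrable lborel {0<..} (\<lambda>y. (\<Sum>x\<in>#?R. ln (1 + (cmod x)\<^sup>2 / y\<^sup>2)) / 2)"
    using I by simp
  then show "set_integrable lborel {0<..} (\<lambda>y. ln (matching_poly (parcs G) (1 / y\<^sup>2) (pverts G)))"
    by (rule set_integrable_cong[THEN iffD1, rotated -1]) (auto simp: ln)
  have "(LBINT y:{0<..}. ln (matching_poly (parcs G) (1 / y\<^sup>2) (pverts G)))
      = (LBINT y:{0<..}. (\<Sum>x\<in>#?R. ln (1 + (cmod x)\<^sup>2 / y\<^sup>2)) / 2)"
    by (rule set_lebesgue_integral_cong) (auto simp: ln)
  also have "\<dots> = (LBINT y:{0<..}. (\<Sum>x\<in>#?R. ln (1 + (cmod x)\<^sup>2 / y\<^sup>2))) / 2"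
    by simp
  also have "\<dots> = pi / 2 * energy G"
    unfolding conjunct2[OF I] energy_spectrum by (simp only: times_divide_eq_left)
  finally show "(LBINT y:{0<..}. ln (matching_poly (parcs G) (1 / y\<^sup>2) (pverts G)))
      = pi / 2 * energy G" .
qed

section \<open>Matchings of forests\<close>

text \<open>Acyclicity is encoded by a depth function: edges join consecutive levels, and a vertex
  has at most one neighbour one level up. Both conditions pass to all subsets of U, so inductions
  that delete vertices keep E and d and change only the vertex set.\<close>

locale depth_forest =
  fixes E :: "('a \<times> 'a) set" and d :: "'a \<Rightarrow> nat" and U :: "'a set" and t :: real
  assumes sym: "sym E" and fin: "finite U" and t: "0 \<le> t"
    and level: "\<lbrakk>u \<in> U; v \<in> U; (u, v) \<in> E\<rbrakk> \<Longrightarrow> d u = Suc (d v) \<or> d v = Suc (d u)"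
    and parent_unique: "\<lbrakk>v \<in> U; u \<in> U; u' \<in> U; (v, u) \<in> E; (v, u') \<in> E; d v = Suc (d u); d v
        = Suc (d u')\<rbrakk>
      \<Longrightarrow> u = u'"
begin

abbreviation M :: "'a set \<Rightarrow> real" where "M \<equiv> matching_poly E t"

abbreviation p :: "nat \<Rightarrow> real" where "p \<equiv> path_poly t"

definition N :: "'a set \<Rightarrow> 'a \<Rightarrow> 'a set" where "N V v = {u \<in> V. (v, u) \<in> E}"

lemma N_sym: "v \<in> V \<Longrightarrow> u \<in> N V v \<Longrightarrow> v \<in> N V u"
  using sym by (auto simp: N_def dest: symD)

lemma no_loop: "v \<in> U \<Longrightarrow> (v, v) \<notin> E"
  using level by fastforce

lemma N_subset: "N V v \<subseteq> V" by (auto simp: N_def)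

lemma N_Diff: "N (V - W) v = N V v - W" by (auto simp: N_def)

lemma fin_subset: "V \<subseteq> U \<Longrightarrow> finite V"
  using fin finite_subset by blast

lemma M_isolated: "V \<subseteq> U \<Longrightarrow> v \<in> V \<Longrightarrow> N V v = {} \<Longrightarrow> M V = M (V - {v})"
  by (rule matching_poly_isolated) (auto simp: N_def intro: fin_subset)

lemma M_leaf: "V \<subseteq> U \<Longrightarrow> v \<in> V \<Longrightarrow> N V v = {u} \<Longrightarrow> M V = M (V - {v}) + t * M (V - {v, u})"
  by (rule matching_poly_leaf) (use sym t no_loop[of v] in \<open>auto simp: N_def intro: fin_subset\<close>)

lemma matching_det_isolated': "V \<subseteq> U \<Longrightarrow> v \<in> V \<Longrightarrow> N V v = {}
    \<Longrightarrow> matching_det E t V = matching_det E t (V - {v})"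
  by (rule matching_det_isolated) (auto simp: N_def intro: fin_subset)

lemma matching_det_leaf': "V \<subseteq> U \<Longrightarrow> v \<in> V \<Longrightarrow> N V v = {u} \<Longrightarrow>
    matching_det E t V = matching_det E t (V - {v}) + of_real t * matching_det E t (V - {v, u})"
  by (rule matching_det_leaf) (use sym t no_loop[of v] in \<open>auto simp: N_def intro: fin_subset\<close>)

lemma obtain_deepest:
  assumes "V \<subseteq> U" "V \<noteq> {}"
  obtains v where "v \<in> V" "\<And>u. u \<in> V \<Longrightarrow> d u \<le> d v"
proof -
  have "finite (d ` V)" "d ` V \<noteq> {}" using assms fin_subset by auto
  then have "Max (d ` V) \<in> d ` V" by (rule Max_in)
  then obtain v where "v \<in> V" "d v = Max (d ` V)" by (metis imageE)
  with \<open>finite (d ` V)\<close> that[of v] show thesis by simp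
qed

lemma deepest_N:
  assumes "V \<subseteq> U" "v \<in> V" "\<And>u. u \<in> V \<Longrightarrow> d u \<le> d v" "u \<in> N V v"
  shows "N V v = {u}" "d v = Suc (d u)"
proof -
  have up: "d v = Suc (d w)" if "w \<in> N V v" for w
  proof -
    have "w \<in> V" "(v, w) \<in> E" using that by (auto simp: N_def)
    then show ?thesis using level[of v w] assms(1,2) assms(3)[of w] by auto
  qed
  show "d v = Suc (d u)" by (rule up[OF assms(4)])
  have "w = u" if "w \<in> N V v" for w
    by (rule parent_unique[of v w u, OF _ _ _ _ _ up[OF that] up[OF assms(4)]])
       (use that assms(1,2,4) in \<open>auto simp: N_def\<close>)
  then show "N V v = {u}" using assms(4) by blast
qed

text \<open>A deepest vertex of a subset has no child in it, so it is isolated or a leaf. It can be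
  deleted alone or together with its parent.\<close>

lemma leaf_induct [consumes 1, case_names empty isolated leaf]:
  assumes "V \<subseteq> U" and "P {}"
    and "\<And>V v. \<lbrakk>V \<subseteq> U; v \<in> V; N V v = {}; P (V - {v})\<rbrakk> \<Longrightarrow> P V"
    and "\<And>V v u. \<lbrakk>V \<subseteq> U; v \<in> V; u \<in> V; u \<noteq> v; N V v = {u}; P (V - {v}); P (V - {v, u})\<rbrakk> \<Longrightarrow> P V"
  shows "P V"
  using assms(1)
proof (induction "card V" arbitrary: V rule: less_induct)
  case less
  show ?case
  proof (cases "V = {}")
    case False
    obtain v where v: "v \<in> V" "\<And>u. u \<in> V \<Longrightarrow> d u \<le> d v"
      using obtain_deepest[OF less.prems False] by blast
    have fin: "finite V" using less.prems fin_subset by blast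
    have IH: "P (V - W)" if "v \<in> W" for W
    proof (rule less.hyps)
      show "card (V - W) < card V" using that v(1) fin by (intro psubset_card_mono) auto
    qed (use less.prems in auto)
    show ?thesis
    proof (cases "N V v = {}")
      case True
      then show ?thesis using assms(3)[OF less.prems v(1)] IH by simp
    next
      case False
      then obtain u where u: "u \<in> N V v" by blast
      have Nv: "N V v = {u}" by (rule deepest_N(1)[OF less.prems v u])
      have "u \<in> V" "u \<noteq> v" using u no_loop[of v] v(1) less.prems by (auto simp: N_def)
      then show ?thesis using assms(4)[OF less.prems v(1) _ _ Nv] IH by simp
    qed
  qed (use assms(2) in simp)
qed

lemma M_real: "V \<subseteq> U \<Longrightarrow> matching_det E t V = of_real (M V)"
proof (induction V rule: leaf_induct)
  case (isolated V v)
  then show ?case using M_isolated[of V v] matching_det_isolated'[of V v] by simp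
next
  case (leaf V v u)
  then show ?case using M_leaf[of V v u] matching_det_leaf'[of V v u] by simp
qed simp

lemma M_ge_1: "V \<subseteq> U \<Longrightarrow> 1 \<le> M V"
proof (induction V rule: leaf_induct)
  case (isolated V v)
  then show ?case using M_isolated[of V v] by simp
next
  case (leaf V v u)
  have "0 \<le> t * M (V - {v, u})" using t leaf by simp
  then show ?case using M_leaf[of V v u] leaf by linarith
qed simp

text \<open>The leaf recursion is the recursion of the path polynomials, and for an isolated vertex
  it is enough that these increase with the index.\<close>

lemma M_le_path: "V \<subseteq> U \<Longrightarrow> M V \<le> p (card V)"
proof (induction V rule: leaf_induct)
  case (isolated V v)
  then have "finite V" using fin_subset by blast
  then have "card V = Suc (card (V - {v}))" using isolated by (metis card.remove)
  then show ?case using isolated M_isolated[of V v] path_poly_Suc_ge[OF t, of "card (V - {v})"]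
    by simp
next
  case (leaf V v u)
  then have fin: "finite V" using fin_subset by blast
  have "card V = Suc (card (V - {v}))" by (rule card.remove[OF fin leaf(2)])
  moreover have "card (V - {v}) = Suc (card (V - {v} - {u}))"
    by (rule card.remove) (use fin leaf in auto)
  moreover have "V - {v} - {u} = V - {v, u}" by auto
  ultimately have "card V = Suc (Suc (card (V - {v, u})))"
      "card (V - {v}) = Suc (card (V - {v, u}))"
    by simp_all
  then have e: "p (card V) = p (card (V - {v})) + t * p (card (V - {v, u}))"
    by (simp only: path_poly.simps)
  show ?case
    unfolding M_leaf[OF leaf(1,2,5)] e by (intro add_mono mult_left_mono leaf.IH t)
qed simp

lemma M_union:
  assumes "V \<subseteq> U" "V = A \<union> B" "A \<inter> B = {}" "\<And>a b. a \<in> A \<Longrightarrow> b \<in> B \<Longrightarrow> (a, b) \<notin> E"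
  shows "M V = M A * M B"
  using assms
proof (induction V arbitrary: A B rule: leaf_induct)
  case (isolated V v)
  show ?case
  proof (cases "v \<in> A")
    case True
    then have "N A v = {}" "v \<notin> B" using isolated.hyps isolated.prems by (auto simp: N_def)
    moreover have "M (V - {v}) = M (A - {v}) * M B"
      by (rule isolated.IH) (use isolated.prems \<open>v \<notin> B\<close> in auto)
    ultimately show ?thesis
      using M_isolated[of V v] M_isolated[of A v] isolated.hyps isolated.prems True by auto
  next
    case False
    then have "v \<in> B" using isolated by auto
    then have "N B v = {}" using isolated.hyps isolated.prems by (auto simp: N_def)
    moreover have "M (V - {v}) = M A * M (B - {v})"
      by (rule isolated.IH) (use isolated.prems False in auto)
    ultimately show ?thesis
      using M_isolated[of V v] M_isolated[of B v] isolated.hyps isolated.prems \<open>v \<in> B\<close> by auto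
  qed
next
  case (leaf V v u)
  have cross: "(a, b) \<notin> E \<and> (b, a) \<notin> E" if "a \<in> A" "b \<in> B" for a b
    using leaf.prems(3)[OF that] sym by (auto dest: symD)
  have vu: "(v, u) \<in> E" using leaf.hyps(5) by (auto simp: N_def)
  show ?case
  proof (cases "v \<in> A")
    case True
    then have uA: "u \<in> A" using cross[of v u] vu leaf by auto
    then have NA: "N A v = {u}" using leaf.hyps leaf.prems by (auto simp: N_def)
    have "M (V - {v}) = M (A - {v}) * M B" "M (V - {v, u}) = M (A - {v, u}) * M B"
      by (rule leaf.IH; use leaf.prems True uA in auto)+
    then show ?thesis
      using M_leaf[OF leaf.hyps(1,2,5)] M_leaf[OF _ True NA] leaf.hyps leaf.prems
      by (auto simp: algebra_simps)
  next
    case False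
    then have vB: "v \<in> B" using leaf by auto
    then have uB: "u \<in> B" using cross[of u v] vu leaf by auto
    then have NB: "N B v = {u}" using leaf.hyps leaf.prems by (auto simp: N_def)
    have "M (V - {v}) = M A * M (B - {v})" "M (V - {v, u}) = M A * M (B - {v, u})"
      by (rule leaf.IH; use leaf.prems vB uB in auto)+
    then show ?thesis
      using M_leaf[OF leaf.hyps(1,2,5)] M_leaf[OF _ vB NB] leaf.hyps leaf.prems
      by (auto simp: algebra_simps)
  qed
qed simp

text \<open>Each part is bounded by a path polynomial, and \<open>path_poly_mult_le_2\<close> bounds
  the product. The sharper value for two single vertices serves the adjacent forks on eight
  vertices.\<close>

lemma M_split_le:
  assumes "V \<subseteq> U" "V = A \<union> B" "A \<inter> B = {}" "A \<noteq> {}" "B \<noteq> {}"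
    "\<And>a b. a \<in> A \<Longrightarrow> b \<in> B \<Longrightarrow> (a, b) \<notin> E"
  shows "M V \<le> p 2 * p (card V - 2)" "card V = 2 \<Longrightarrow> M V \<le> 1"
proof -
  have fin: "finite A" "finite B" using assms fin_subset by blast+
  then have c: "card A \<ge> 1" "card B \<ge> 1" "card V = card A + card B"
    using assms by (auto simp: card_Un_disjoint card_gt_0_iff Suc_le_eq)
  have "M V = M A * M B" by (rule M_union[OF assms(1-3,6)])
  also have "\<dots> \<le> p (card A) * p (card B)"
    using M_le_path[of A] M_le_path[of B] M_ge_1[of A] M_ge_1[of B] assms(1,2)
    by (intro mult_mono) (auto intro: order_trans path_poly_nonneg[OF t])
  finally have le: "M V \<le> p (card A) * p (card B)" .
  show "card V = 2 \<Longrightarrow> M V \<le> 1"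
  proof -
    assume "card V = 2"
    then have "card A = 1" "card B = 1" using c by linarith+
    then show ?thesis using le by simp
  qed
  show "M V \<le> p 2 * p (card V - 2)"
  proof (cases "3 \<le> card A + card B")
    case True
    then show ?thesis using le path_poly_mult_le_2[OF t c(1,2)] c by simp
  next
    case False
    then have "card A = 1" "card B = 1" using c by auto
    then show ?thesis using le c t by (simp add: path_poly_numeral)
  qed
qed

text \<open>Deleting an inner vertex splits off the descendants of one of its children.\<close>

lemma M_delete_inner_le:
  assumes "V \<subseteq> U" "x \<in> V" "c \<in> N V x" "d c = Suc (d x)" "y \<in> N V x" "y \<noteq> c"
  shows "M (V - {x}) \<le> p 2 * p (card V - 3)" "card V = 3 \<Longrightarrow> M (V - {x}) \<le> 1"
proof -
  define R where "R = {(a, b). a \<in> V \<and> b \<in> V \<and> (a, b) \<in> E \<and> d a = Suc (d b)}"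
  \<comment> \<open>The descendants of c in V, with c itself: chains of steps to the parent that end
    in c.\<close>
  define A where "A = {z. (z, c) \<in> R\<^sup>*}"
  have cV: "c \<in> V" "y \<in> V" "(x, c) \<in> E" "(x, y) \<in> E" using assms by (auto simp: N_def)
  have AV: "z \<in> V \<and> d c \<le> d z \<and> (d z = d c \<longrightarrow> z = c)" if "z \<in> A" for z
    using that unfolding A_def mem_Collect_eq
    by (induction rule: converse_rtrancl_induct) (use cV in \<open>auto simp: R_def\<close>)
  have xA: "x \<notin> A" using AV[of x] assms(4) by auto
  have yA: "y \<notin> A"
  proof
    assume "y \<in> A"
    then have "d c \<le> d y" "d y \<noteq> d c" using AV[of y] assms(6) by blast+
    moreover have "d x = Suc (d y) \<or> d y = Suc (d x)"
      by (rule level) (use assms(1,2) cV in auto)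
    ultimately show False using assms(4) by auto
  qed
  \<comment> \<open>The only edge that leaves A goes from c up to x: children of members are
    members, and so are the parents of all members except c.\<close>
  have cross: "(a, b) \<notin> E" if ab: "a \<in> A" "b \<in> V" "b \<notin> A" "b \<noteq> x" for a b
  proof
    assume e: "(a, b) \<in> E"
    have aV: "a \<in> V" using AV[OF ab(1)] by blast
    then consider "d a = Suc (d b)" | "d b = Suc (d a)" using level[of a b] e ab assms(1) by auto
    then show False
    proof cases
      case 1
      show False
      proof (cases "a = c")
        case True
        then have "(c, x) \<in> E" "(c, b) \<in> E" using cV e sym by (auto dest: symD)
        then have "b = x" using parent_unique[of c b x] 1 True assms(1,2,4) ab cV by auto
        then show False using ab by simp
      next
        case False
        then obtain b' where b': "(a, b') \<in> R" "(b', c) \<in> R\<^sup>*"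
          using ab(1) unfolding A_def by (auto elim: converse_rtranclE)
        then have "b' = b" using parent_unique[of a b' b] e 1 ab assms(1) by (auto simp: R_def)
        then show False using b' ab by (simp add: A_def)
      qed
    next
      case 2
      then have "(b, a) \<in> R" using e ab aV sym by (auto simp: R_def dest: symD)
      then show False using ab by (auto simp: A_def intro: converse_rtrancl_into_rtrancl)
    qed
  qed
  have fin: "finite V" using assms fin_subset by blast
  have card: "card (V - {x}) = card V - 1" using fin assms(2) by simp
  have VA: "V - {x} = A \<union> (V - {x} - A)" using AV xA by auto
  have s: "V - {x} \<subseteq> U" using assms by auto
  have nA: "A \<noteq> {}" "V - {x} - A \<noteq> {}" using yA cV assms(2,5) no_loop[of x] assms(1)
    by (auto simp: A_def)
  have dis: "A \<inter> (V - {x} - A) = {}" by auto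
  have nc: "\<And>a b. a \<in> A \<Longrightarrow> b \<in> V - {x} - A \<Longrightarrow> (a, b) \<notin> E" using cross by auto
  have "card V - 3 = card (V - {x}) - 2" using card by simp
  then show "M (V - {x}) \<le> p 2 * p (card V - 3)"
    using M_split_le(1)[OF s VA dis nA nc] by simp
  show "card V = 3 \<Longrightarrow> M (V - {x}) \<le> 1"
    using M_split_le(2)[OF s VA dis nA nc] card by simp
qed

end

section \<open>Paths, spiders and other trees\<close>

fun list_edges :: "'a list \<Rightarrow> ('a \<times> 'a) set" where
  "list_edges [] = {}"
| "list_edges [x] = {}"
| "list_edges (x # y # zs) = {(x, y), (y, x)} \<union> list_edges (y # zs)"

lemma list_edges_Cons: "xs \<noteq> [] \<Longrightarrow> list_edges (x # xs) = {(x, hd xs), (hd xs, x)} \<union> list_edges xs"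
  by (cases xs) auto

lemma list_edges_append:
  "xs \<noteq> [] \<Longrightarrow> ys \<noteq> [] \<Longrightarrow> list_edges (xs @ ys) = list_edges xs \<union> list_edges ys
      \<union> {(last xs, hd ys), (hd ys, last xs)}"
  by (induction xs rule: list_edges.induct) (auto simp: list_edges_Cons)

lemma list_edges_subset: "list_edges xs \<subseteq> set xs \<times> set xs"
  by (induction xs rule: list_edges.induct) auto

lemma list_edges_rev: "list_edges (rev xs) = list_edges xs"
proof (induction xs rule: list_edges.induct)
  case (3 x y zs)
  have "list_edges (rev (x # y # zs)) = list_edges (rev (y # zs) @ [x])" by simp
  also have "\<dots> = list_edges (rev (y # zs)) \<union> {(y, x), (x, y)}"
    by (subst list_edges_append) (auto simp: last_rev)
  finally show ?case using 3 by auto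
qed auto

definition list_path :: "('a \<times> 'a) set \<Rightarrow> 'a set \<Rightarrow> 'a list \<Rightarrow> bool" where
  "list_path E V xs \<longleftrightarrow> distinct xs \<and> set xs = V \<and> E \<inter> V \<times> V = list_edges xs"

text \<open>The legs are listed from the tip towards the centre \<open>c\<close>.\<close>

definition list_spider :: "('a \<times> 'a) set \<Rightarrow> 'a set \<Rightarrow> 'a \<Rightarrow> 'a list \<Rightarrow> 'a list \<Rightarrow> 'a list \<Rightarrow> bool" where
  "list_spider E V c A B C \<longleftrightarrow> A \<noteq> [] \<and> B \<noteq> [] \<and> C \<noteq> [] \<and> distinct (c # A @ B @ C)
     \<and> set (c # A @ B @ C) = V \<and> E \<inter> V \<times> V = list_edges (A @ [c]) \<union> list_edges (B @ [c]) \<union>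
         list_edges (C @ [c])"

definition is_path :: "('a \<times> 'a) set \<Rightarrow> 'a set \<Rightarrow> bool" where
  "is_path E V \<longleftrightarrow> (\<exists>xs. list_path E V xs)"

definition is_spider :: "('a \<times> 'a) set \<Rightarrow> 'a set \<Rightarrow> bool" where
  "is_spider E V \<longleftrightarrow> (\<exists>c A B C. list_spider E V c A B C)"

lemma list_path_rev: "list_path E V xs \<Longrightarrow> list_path E V (rev xs)"
  by (simp add: list_path_def list_edges_rev)

lemma list_spider_swap12: "list_spider E V c A B C \<Longrightarrow> list_spider E V c B A C"
  by (auto simp: list_spider_def)

lemma list_spider_swap13: "list_spider E V c A B C \<Longrightarrow> list_spider E V c C B A"
  by (auto simp: list_spider_def)

section \<open>Attaching a leaf to a path or a spider\<close>

context depth_forest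
begin

definition at_most_one :: "'b set \<Rightarrow> bool" where
  "at_most_one A \<longleftrightarrow> (\<forall>a\<in>A. \<forall>b\<in>A. a = b)"

lemma at_most_oneD: "at_most_one A \<Longrightarrow> a \<in> A \<Longrightarrow> b \<in> A \<Longrightarrow> a = b"
  unfolding at_most_one_def by blast

lemma at_most_one_subset: "at_most_one A \<Longrightarrow> B \<subseteq> A \<Longrightarrow> at_most_one B"
  unfolding at_most_one_def by blast

lemma edges_insert_leaf:
  assumes "V \<subseteq> U" "v \<in> V" "N V v = {u}"
  shows "E \<inter> V \<times> V = {(v, u), (u, v)} \<union> (E \<inter> (V - {v}) \<times> (V - {v}))"
proof -
  have "(v, u) \<in> E" "(u, v) \<in> E" "u \<in> V"
    using assms sym by (auto simp: N_def dest: symD)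
  moreover have "z = u" if "(v, z) \<in> E \<or> (z, v) \<in> E" "z \<in> V" for z
    using that assms sym by (auto simp: N_def dest: symD)
  ultimately show ?thesis using assms(2) by blast
qed

lemma in_N_iff: "a \<in> N V b \<longleftrightarrow> a \<in> V \<and> (b, a) \<in> E"
  by (simp add: N_def)

lemma hd_path:
  assumes "list_path E V (u # bs)" "z \<in> N V u"
  shows "bs \<noteq> [] \<and> z = hd bs"
proof -
  have "(u, z) \<in> list_edges (u # bs)" "u \<notin> set bs" using assms by (auto simp: list_path_def N_def)
  then show ?thesis using list_edges_subset[of bs] by (cases bs) (auto simp: list_edges_Cons)
qed

text \<open>Having at most one other neighbour, u is an end of the path; an inner position would
  give it two. The list is reversed if u is its last entry.\<close>

lemma path_extend:
  assumes "V \<subseteq> U" "v \<in> V" "N V v = {u}" "is_path E (V - {v})" "at_most_one (N (V - {v}) u)"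
  shows "is_path E V"
proof -
  have u: "u \<in> V" "u \<noteq> v" using assms no_loop[of v] by (auto simp: N_def)
  have ext: "is_path E V" if "list_path E (V - {v}) (u # bs)" for bs
    unfolding is_path_def
  proof (intro exI)
    show "list_path E V (v # u # bs)"
      using that assms(2) edges_insert_leaf[OF assms(1-3)] by (auto simp: list_path_def)
  qed
  obtain xs where xs: "list_path E (V - {v}) xs" using assms(4) by (auto simp: is_path_def)
  then have "u \<in> set xs" using u by (simp add: list_path_def)
  then obtain as bs where spl: "xs = as @ u # bs" by (meson split_list)
  show ?thesis
  proof (cases "as = [] \<or> bs = []")
    case True
    then show ?thesis
    proof
      assume "as = []"
      then show ?thesis using ext[of bs] xs by (simp add: spl)
    next
      assume "bs = []"
      then show ?thesis using ext[of "rev as"] list_path_rev[OF xs] by (simp add: spl)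
    qed
  next
    case False
    have eq: "list_edges xs = E \<inter> (V - {v}) \<times> (V - {v})" using xs by (simp add: list_path_def)
    have "(u, last as) \<in> list_edges xs" "(u, hd bs) \<in> list_edges xs"
      using False by (simp_all add: spl list_edges_append list_edges_Cons)
    then have "(u, last as) \<in> E \<inter> (V - {v}) \<times> (V - {v})" "(u, hd bs) \<in> E \<inter> (V - {v}) \<times> (V - {v})"
      unfolding eq .
    then have "last as \<in> N (V - {v}) u" "hd bs \<in> N (V - {v}) u" by (simp_all add: N_def)
    moreover have "set as \<inter> set bs = {}" using xs by (simp add: spl list_path_def)
    then have "last as \<noteq> hd bs" using False last_in_set[of as] hd_in_set[of bs]
      by (metis disjoint_iff)
    ultimately show ?thesis using at_most_oneD[OF assms(5)] by metis
  qed
qed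

text \<open>The path is cut at u. Its two arms and the single vertex v become the three
  legs.\<close>

lemma path_attach_inner:
  assumes "V \<subseteq> U" "v \<in> V" "N V v = {u}" "is_path E (V - {v})" "\<not> at_most_one (N (V - {v}) u)"
  shows "is_spider E V"
proof -
  have u: "u \<in> V" "u \<noteq> v" using assms no_loop[of v] by (auto simp: N_def)
  obtain xs where xs: "list_path E (V - {v}) xs" using assms(4) by (auto simp: is_path_def)
  then have "u \<in> set xs" using u by (simp add: list_path_def)
  then obtain as bs where spl: "xs = as @ u # bs" by (meson split_list)
  have "\<not> list_path E (V - {v}) (u # cs)" for cs
  proof
    assume "list_path E (V - {v}) (u # cs)"
    then have "\<And>z. z \<in> N (V - {v}) u \<Longrightarrow> z = hd cs" using hd_path by blast
    then show False using assms(5) unfolding at_most_one_def by metis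
  qed
  from this[of bs] this[of "rev as"] have ne: "as \<noteq> []" "bs \<noteq> []"
    using xs list_path_rev[OF xs] by (auto simp: spl)
  have 1: "list_edges (rev bs @ [u]) = list_edges (u # bs)" using list_edges_rev[of "u # bs"]
    by simp
  have 2: "list_edges (as @ u # bs) = list_edges (as @ [u]) \<union> list_edges (u # bs)"
    using ne by (simp add: list_edges_append list_edges_Cons Un_ac insert_commute)
  have 3: "E \<inter> (V - {v}) \<times> (V - {v}) = list_edges (as @ [u]) \<union> list_edges (u # bs)"
      "distinct (as @ u # bs)"
    "set (as @ u # bs) = V - {v}"
    using xs by (simp_all add: list_path_def spl 2)
  have "list_spider E V u as (rev bs) [v]"
    unfolding list_spider_def edges_insert_leaf[OF assms(1-3)] 1 3(1)
  proof (intro conjI)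
    show "distinct (u # as @ rev bs @ [v])" using 3(2,3) by auto
    show "set (u # as @ rev bs @ [v]) = V" using 3(3) assms(2) by auto
  qed (use ne in auto)
  then show ?thesis by (auto simp: is_spider_def)
qed

text \<open>With at most one other neighbour, u is neither the centre nor an inner vertex of a leg.
  It is therefore a tip, and v prolongs its leg.\<close>

lemma spider_extend:
  assumes "V \<subseteq> U" "v \<in> V" "N V v = {u}" "is_spider E (V - {v})" "at_most_one (N (V - {v}) u)"
  shows "is_spider E V"
proof -
  have u: "u \<in> V" "u \<noteq> v" using assms no_loop[of v] by (auto simp: N_def)
  have ext: "is_spider E V" if spl: "list_spider E (V - {v}) c A B C" and uA: "u \<in> set A"
      for c A B C
  proof -
    obtain as bs where A: "A = as @ u # bs" using uA by (meson split_list)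
    have "as = []"
    proof (rule ccontr)
      assume as: "as \<noteq> []"
      have sub: "list_edges (A @ [c]) \<subseteq> E \<inter> (V - {v}) \<times> (V - {v})" using spl
        unfolding list_spider_def by blast
      have "(u, last as) \<in> list_edges (A @ [c])" "(u, hd (bs @ [c])) \<in> list_edges (A @ [c])"
        using as by (simp_all add: A list_edges_append list_edges_Cons)
      then have "(u, last as) \<in> E \<inter> (V - {v}) \<times> (V - {v})"
        "(u, hd (bs @ [c])) \<in> E \<inter> (V - {v}) \<times> (V - {v})"
        by (simp_all only: subsetD[OF sub])
      then have "last as \<in> N (V - {v}) u" "hd (bs @ [c]) \<in> N (V - {v}) u" by (simp_all add: N_def)
      moreover have "set as \<inter> set (bs @ [c]) = {}" using spl by (auto simp: A list_spider_def)
      then have "last as \<noteq> hd (bs @ [c])"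
        using as last_in_set[of as] hd_in_set[of "bs @ [c]"]
          by (metis disjoint_iff snoc_eq_iff_butlast)
      ultimately show False using at_most_oneD[OF assms(5)] by metis
    qed
    then have "list_edges (v # A @ [c]) = {(v, u), (u, v)} \<union> list_edges (A @ [c])"
      by (simp add: A list_edges_Cons)
    then have 1: "list_edges ((v # A) @ [c]) = {(v, u), (u, v)} \<union> list_edges (A @ [c])" by simp
    have 2: "distinct (c # A @ B @ C)" "set (c # A @ B @ C) = V - {v}"
      "E \<inter> (V - {v}) \<times> (V - {v}) = list_edges (A @ [c]) \<union> list_edges (B @ [c])
          \<union> list_edges (C @ [c])"
      "A \<noteq> []" "B \<noteq> []" "C \<noteq> []"
      using spl unfolding list_spider_def by blast+
    have "list_spider E V c (v # A) B C"
      unfolding list_spider_def edges_insert_leaf[OF assms(1-3)] 1 2(3)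
    proof (intro conjI)
      show "distinct (c # (v # A) @ B @ C)" using 2(1,2) by auto
      show "set (c # (v # A) @ B @ C) = V" using 2(2) assms(2) by auto
    qed (use 2 in auto)
    then show ?thesis by (auto simp: is_spider_def)
  qed
  obtain c A B C where spl: "list_spider E (V - {v}) c A B C" using assms(4)
    by (auto simp: is_spider_def)
  have "u \<noteq> c"
  proof
    assume uc: "u = c"
    have sub: "list_edges (A @ [c]) \<subseteq> E \<inter> (V - {v}) \<times> (V - {v})"
        "list_edges (B @ [c]) \<subseteq> E \<inter> (V - {v}) \<times> (V - {v})"
      using spl unfolding list_spider_def by blast+
    have "(u, last A) \<in> list_edges (A @ [c])" "(u, last B) \<in> list_edges (B @ [c])"
      using spl by (simp_all add: list_edges_append uc list_spider_def)
    then have "(u, last A) \<in> E \<inter> (V - {v}) \<times> (V - {v})"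
      "(u, last B) \<in> E \<inter> (V - {v}) \<times> (V - {v})"
      by (simp_all only: subsetD[OF sub(1)] subsetD[OF sub(2)])
    then have "last A \<in> N (V - {v}) u" "last B \<in> N (V - {v}) u" by (simp_all add: N_def)
    moreover have "set A \<inter> set B = {}" "A \<noteq> []" "B \<noteq> []" using spl by (auto simp: list_spider_def)
    then have "last A \<noteq> last B"
      using last_in_set[of A] last_in_set[of B] by (metis disjoint_iff)
    ultimately show False using at_most_oneD[OF assms(5)] by metis
  qed
  then have "u \<in> set A \<or> u \<in> set B \<or> u \<in> set C"
    using spl u by (auto simp: list_spider_def)
  then show ?thesis
    using ext[OF spl] ext[OF list_spider_swap12[OF spl]] ext[OF list_spider_swap13[OF spl]] by blast
qed

section \<open>Rooted trees and their deepest end\<close>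

text \<open>The parents make V connected. The root is required to be a leaf, so a vertex with two
  neighbours is never the root and has both a parent and a child.\<close>

definition tree :: "'a \<Rightarrow> 'a set \<Rightarrow> bool" where
  "tree r V \<longleftrightarrow> V \<subseteq> U \<and> r \<in> V \<and> d r = 0 \<and> at_most_one (N V r) \<and>
     (\<forall>v\<in>V - {r}. \<exists>u\<in>N V v. d v = Suc (d u))"

text \<open>It suffices that no remaining vertex loses its parent.\<close>

lemma tree_delete:
  assumes "tree r V" "r \<notin> W" "\<And>v u. v \<in> V - W \<Longrightarrow> u \<in> W \<Longrightarrow> u \<in> N V v \<Longrightarrow> d v = Suc (d u) \<Longrightarrow> False"
  shows "tree r (V - W)"
proof -
  have T: "V \<subseteq> U" "r \<in> V" "d r = 0" "at_most_one (N V r)"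
    "\<And>v. v \<in> V - {r} \<Longrightarrow> \<exists>u\<in>N V v. d v = Suc (d u)"
    using assms(1) unfolding tree_def by blast+
  have "\<exists>u\<in>N (V - W) v. d v = Suc (d u)" if v: "v \<in> V - W - {r}" for v
  proof -
    have "v \<in> V - {r}" using v by simp
    from T(5)[OF this] obtain u where u: "u \<in> N V v" "d v = Suc (d u)" by (elim bexE)
    have "u \<notin> W"
      using assms(3)[of v u] v u by (metis DiffD1)
    then have "u \<in> N (V - W) v" using u by (simp add: N_Diff)
    then show ?thesis using u(2) by (rule bexI[rotated])
  qed
  moreover have "at_most_one (N (V - W) r)"
    by (rule at_most_one_subset[OF T(4)]) (simp add: N_Diff)
  ultimately show ?thesis
    unfolding tree_def using T(1-3) assms(2) by (simp add: subset_iff)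
qed

lemma tree_delete_leaf:
  assumes "tree r V" "v \<noteq> r" "v \<in> V" "N V v = {u}"
  shows "tree r (V - {v})"
proof (rule tree_delete[OF assms(1)])
  fix a b assume ab: "a \<in> V - {v}" "b \<in> {v}" "b \<in> N V a" "d a = Suc (d b)"
  then have "a \<in> N V v" using N_sym[of a V b] by auto
  then have "a = u" using assms(4) by simp
  moreover have "\<exists>w\<in>N V v. d v = Suc (d w)" using assms(1-3) by (auto simp: tree_def)
  ultimately show False using ab assms(4) by auto
qed (use assms in auto)

text \<open>The vertex \<open>v\<close> is chosen deepest, so that all children of its parent are leaves.\<close>

lemma tree_end_cases:
  assumes T: "tree r V" and "3 \<le> card V"
  obtains
    (pendant) v u c y where "v \<in> V" "v \<noteq> r" "N V v = {u}" "u \<in> V" "c \<in> N V u" "d c = Suc (d u)"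
      "y \<in> N V u" "c \<noteq> v" "y \<noteq> v" "y \<noteq> c"
  | (tail) v u w where "v \<in> V" "u \<in> V" "w \<in> V" "v \<noteq> r" "u \<noteq> r" "v \<noteq> w" "N V v = {u}"
      "N V u = {v, w}"
      "at_most_one (N V w - {u})"
  | (fork) w x v u v' u' where "w \<in> V" "w \<noteq> r" "x \<in> N V w" "d w = Suc (d x)" "v \<in> V" "u \<in> V"
      "v' \<in> V" "u' \<in> V"
      "N V v = {u}" "N V u = {v, w}" "N V v' = {u'}" "N V u' = {v', w}" "r \<notin> {v, u, v', u'}"
      "distinct [w, x, v, u, v', u']"
      "\<And>z. z \<in> N V w \<Longrightarrow> z \<noteq> x \<Longrightarrow> z \<noteq> r \<and> (\<exists>z'. N V z' = {z} \<and> N V z = {z', w} \<and> z' \<in> V)"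
proof -
  have VU: "V \<subseteq> U" and rV: "r \<in> V" and r0: "d r = 0" and r1: "at_most_one (N V r)"
    and par: "\<And>v. v \<in> V \<Longrightarrow> v \<noteq> r \<Longrightarrow> \<exists>u\<in>N V v. d v = Suc (d u)"
    using T by (auto simp: tree_def)
  have fin: "finite V" using VU fin_subset by blast
  obtain v where v: "v \<in> V" "\<And>z. z \<in> V \<Longrightarrow> d z \<le> d v"
    using obtain_deepest[OF VU] rV by blast
  have NV: "z \<in> V" if "z \<in> N V a" for z a using that by (simp add: N_def)
  have lev: "d a = Suc (d b) \<or> d b = Suc (d a)" if "a \<in> V" "b \<in> N V a" for a b
    using level[of a b] that VU by (auto simp: N_def)
  have uniq: "b = b'" if "a \<in> V" "b \<in> N V a" "b' \<in> N V a" "d a = Suc (d b)" "d a = Suc (d b')"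
      for a b b'
    by (rule parent_unique[of a b b']) (use that VU in \<open>auto simp: N_def\<close>)
  have leaf: "N V z = {b}" if "z \<in> V" "d z = d v" "b \<in> N V z" for z b
    by (rule deepest_N(1)[OF VU that(1) _ that(3)]) (use v that in auto)
  have neq: "a \<noteq> b" if "a \<in> V" "b \<in> N V a" for a b using lev[OF that] by auto
  obtain z0 where z0: "z0 \<in> V" "z0 \<noteq> r"
    using assms(2) rV by (metis One_nat_def card.infinite card_le_Suc0_iff_eq fin le_trans
        not_less_eq_eq numeral_3_eq_3 le_SucI order_refl)
  have vr: "v \<noteq> r"
    using par[OF z0] v(2)[OF z0(1)] r0 by auto
  obtain u where u: "u \<in> N V v" "d v = Suc (d u)" using par[OF v(1) vr] by blast
  have uV: "u \<in> V" using u NV by blast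
  have Nv: "N V v = {u}" by (rule leaf[OF v(1) refl u(1)])
  have vNu: "v \<in> N V u" by (rule N_sym[OF v(1) u(1)])
  have child_leaf: "N V c = {u}" if "c \<in> N V u" "d c = Suc (d u)" for c
    by (rule leaf) (use that u(2) NV N_sym[OF uV that(1)] in auto)
  \<comment> \<open>Otherwise all vertices other than the root lie on level 1; as the root has a
    single neighbour, there would be at most two vertices.\<close>
  have u_ne_r: "u \<noteq> r"
  proof
    assume u_ne_r: "u = r"
    have "z \<in> {r, v}" if z: "z \<in> V" for z
    proof (rule ccontr)
      assume n: "z \<notin> {r, v}"
      then obtain b where b: "b \<in> N V z" "d z = Suc (d b)" using par z by blast
      then have "d b = 0" using v(2)[OF z] u(2) u_ne_r r0 by simp
      then have "b = r" using par[of b] NV[OF b(1)] by force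
      then have "z \<in> N V r" using N_sym[OF z b(1)] by simp
      then show False using at_most_oneD[OF r1 _ vNu[unfolded u_ne_r]] n by blast
    qed
    then have "V \<subseteq> {r, v}" by blast
    then have "card V \<le> card {r, v}" by (intro card_mono) auto
    then show False using assms(2) card_insert_le_m1[of 2 "{v}" r]
      by (simp add: card_insert_if split: if_splits)
  qed
  obtain w where w: "w \<in> N V u" "d u = Suc (d w)" using par[OF uV u_ne_r] by blast
  have wV: "w \<in> V" using w NV by blast
  have uNw: "u \<in> N V w" by (rule N_sym[OF uV w(1)])
  have dne: "v \<noteq> w" "v \<noteq> u" "u \<noteq> w" using u w by auto
  show thesis
  proof (cases "\<exists>c\<in>N V u. d c = Suc (d u) \<and> c \<noteq> v")
    case True
    then obtain c where c: "c \<in> N V u" "d c = Suc (d u)" "c \<noteq> v" by blast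
    have "w \<noteq> c" using c w by auto
    then show thesis using pendant[OF v(1) vr Nv uV c(1,2) w(1) c(3)] dne by blast
  next
    case False
    have Nu: "N V u = {v, w}"
    proof (intro equalityI subsetI)
      fix z assume z: "z \<in> N V u"
      from lev[OF uV z] show "z \<in> {v, w}"
      proof
        assume "d u = Suc (d z)"
        from uniq[OF uV z w(1) this w(2)] show ?thesis by blast
      qed (use False z in blast)
    qed (use vNu w in auto)
    \<comment> \<open>A child z of w that does not start a leg of length 2 leads to
      \<open>pendant\<close>: a childless z is a leaf beside u and x, and otherwise z has two
      children on the deepest level, which are leaves.\<close>
    have child: thesis if z: "z \<in> N V w" "d z = Suc (d w)" "z \<noteq> u"
      and bad: "\<not> (\<exists>z'. N V z' = {z} \<and> N V z = {z', w} \<and> z' \<in> V)" for z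
    proof -
      have zV: "z \<in> V" using z NV by blast
      have zw: "w \<in> N V z" by (rule N_sym[OF wV z(1)])
      have zr: "z \<noteq> r" using z r0 by auto
      have wr: "w \<noteq> r"
        using at_most_oneD[OF r1] uNw z by blast
      obtain x where x: "x \<in> N V w" "d w = Suc (d x)" using par[OF wV wr] by blast
      show thesis
      proof (cases "\<exists>z'\<in>N V z. d z' = Suc (d z)")
        case False
        have "N V z = {w}"
        proof (intro equalityI subsetI)
          fix b assume b: "b \<in> N V z"
          then have "d z = Suc (d b)" using lev[OF zV b] False by blast
          from uniq[OF zV b zw this z(2)] show "b \<in> {w}" by blast
        qed (use zw in auto)
        moreover have "x \<noteq> z" "x \<noteq> u" using x z w by auto
        ultimately show thesis
          using pendant[OF zV zr _ wV uNw w(2) x(1)] z(3) by blast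
      next
        case True
        then obtain z' where z': "z' \<in> N V z" "d z' = Suc (d z)" by blast
        have z'V: "z' \<in> V" using z' NV by blast
        have dz: "d z' = d v" using z' z w u by simp
        have Nz': "N V z' = {z}" by (rule leaf[OF z'V dz N_sym[OF zV z'(1)]])
        have z'r: "z' \<noteq> r" using z' r0 by auto
        have "\<exists>c\<in>N V z. d c = Suc (d z) \<and> c \<noteq> z'"
        proof (rule ccontr)
          assume no: "\<not> ?thesis"
          have "N V z = {z', w}"
          proof (intro equalityI subsetI)
            fix b assume b: "b \<in> N V z"
            from lev[OF zV b] show "b \<in> {z', w}"
            proof
              assume "d z = Suc (d b)"
              from uniq[OF zV b zw this z(2)] show ?thesis by blast
            qed (use no b in blast)
          qed (use zw z' in auto)
          then show False using bad Nz' z'V by blast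
        qed
        then obtain c where c: "c \<in> N V z" "d c = Suc (d z)" "c \<noteq> z'" by blast
        have "w \<noteq> z'" "w \<noteq> c" using z' c z by auto
        then show thesis
          using pendant[OF z'V z'r Nz' zV c(1,2) zw c(3)] by blast
      qed
    qed
    show thesis
    proof (cases "\<exists>z\<in>N V w. d z = Suc (d w) \<and> z \<noteq> u")
      case False
      have "at_most_one (N V w - {u})"
        unfolding at_most_one_def
      proof (intro ballI)
        fix a b assume ab: "a \<in> N V w - {u}" "b \<in> N V w - {u}"
        then have "d w = Suc (d a)" "d w = Suc (d b)" using lev[OF wV] False by blast+
        then show "a = b" using uniq[OF wV] ab by blast
      qed
      then show thesis using tail[OF v(1) uV wV vr u_ne_r dne(1) Nv Nu] by blast
    next
      case True
      then obtain u' where u': "u' \<in> N V w" "d u' = Suc (d w)" "u' \<noteq> u" by blast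
      have wr: "w \<noteq> r"
        using at_most_oneD[OF r1] uNw u' by blast
      obtain x where x: "x \<in> N V w" "d w = Suc (d x)" using par[OF wV wr] by blast
      show thesis
      proof (cases "\<exists>z\<in>N V w. d z = Suc (d w) \<and> z \<noteq> u
          \<and> \<not> (\<exists>z'. N V z' = {z} \<and> N V z = {z', w} \<and> z' \<in> V)")
        case True
        then show thesis using child by blast
      next
        case False
        have ends: "\<exists>z'. N V z' = {z} \<and> N V z = {z', w} \<and> z' \<in> V" if "z \<in> N V w" "d z = Suc (d w)"
            for z
          using False Nv Nu v(1) that by blast
        obtain v' where v': "N V v' = {u'}" "N V u' = {v', w}" "v' \<in> V"
          using ends[OF u'(1,2)] by blast
        have u'V: "u' \<in> V" using u' NV by blast
        have "u' \<in> N V v'" using v' by simp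
        then have "d v' = Suc (d u') \<or> d u' = Suc (d v')" using lev v'(3) by blast
        moreover have "d u' \<noteq> Suc (d v')"
        proof
          assume a: "d u' = Suc (d v')"
          have "v' \<in> N V u'" "w \<in> N V u'" using v' by auto
          then have "v' = w" using uniq[OF u'V] a u'(2) by blast
          then have "u \<in> N V v'" using uNw by simp
          then show False using v'(1) u'(3) by simp
        qed
        ultimately have dv': "d v' = Suc (d u')" by blast
        have vv': "v \<noteq> v'" using Nv v'(1) u'(3) by auto
        have dist: "distinct [w, x, v, u, v', u']"
          using u(2) w(2) x(2) u'(2,3) dv' vv' by auto
        have rn: "r \<notin> {v, u, v', u'}" using vr u_ne_r dv' u'(2) r0 by auto
        show thesis
        proof (rule fork[OF wV wr x v(1) uV v'(3) u'V Nv Nu v'(1,2) rn dist])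
          fix z assume z: "z \<in> N V w" "z \<noteq> x"
          then have "d z = Suc (d w)" using lev[OF wV z(1)] uniq[OF wV z(1) x(1) _ x(2)] by blast
          then show "z \<noteq> r \<and> (\<exists>z'. N V z' = {z} \<and> N V z = {z', w} \<and> z' \<in> V)"
            using ends z r0 by auto
        qed
      qed
    qed
  qed
qed

section \<open>The leaf recursion in the three end shapes\<close>

text \<open>Two steps of the leaf recursion remove a leg of length 2 at w; the terms in which w
  survives combine to the factor 1 + t = p_2.\<close>

lemma M_fork:
  assumes "V \<subseteq> U" "v \<in> V" "u \<in> V" "u \<noteq> v" "v \<noteq> w" "N V v = {u}" "N V u = {v, w}"
  shows "M V = p 2 * M (V - {v, u}) + t * M (V - {v, u, w})"
proof -
  have "M V = M (V - {v}) + t * M (V - {v, u})" by (rule M_leaf) fact+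
  moreover have "N (V - {v}) u = {w}" using assms(5,7) by (auto simp: N_Diff)
  then have "M (V - {v}) = M (V - {v} - {u}) + t * M (V - {v} - {u, w})"
    using assms by (intro M_leaf) auto
  moreover have "V - {v} - {u} = V - {v, u}" "V - {v} - {u, w} = V - {v, u, w}" by auto
  ultimately show ?thesis by (simp add: path_poly_numeral algebra_simps)
qed

lemma not_at_most_oneI: "a \<in> A \<Longrightarrow> b \<in> A \<Longrightarrow> a \<noteq> b \<Longrightarrow> \<not> at_most_one A"
  unfolding at_most_one_def by blast

lemma M_edge: "a \<in> U \<Longrightarrow> b \<in> U \<Longrightarrow> a \<noteq> b \<Longrightarrow> (a, b) \<in> E \<Longrightarrow> M {a, b} = p 2"
proof -
  assume ab: "a \<in> U" "b \<in> U" "a \<noteq> b" "(a, b) \<in> E"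
  have Na: "N {a, b} a = {b}" using ab no_loop[of a] by (auto simp: N_def)
  have Nb: "N {b} b = {}" using ab no_loop[of b] by (auto simp: N_def)
  have "{a, b} - {a} = {b}" "{a, b} - {a, b} = {}" using ab by auto
  then have "M {a, b} = M {b} + t" using M_leaf[of "{a, b}" a b] Na ab by simp
  moreover have "M {b} = 1" using M_isolated[of "{b}" b] Nb ab by simp
  ultimately show ?thesis by (simp add: path_poly_numeral)
qed

lemma M_pendant_component:
  assumes "V \<subseteq> U" "v \<in> V" "u \<in> V" "u \<noteq> v" "N V v \<subseteq> {u}" "N V u \<subseteq> {v}" "(v, u) \<in> E"
  shows "M V = p 2 * M (V - {v, u})"
proof -
  have "M V = M {v, u} * M (V - {v, u})"
  proof (rule M_union[OF assms(1)])
    fix a b assume "a \<in> {v, u}" "b \<in> V - {v, u}"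
    then show "(a, b) \<notin> E" using assms(5,6) by (auto simp: N_def)
  qed (use assms in auto)
  then show ?thesis using M_edge[of v u] assms by auto
qed

lemma tree_le_2_is_path: "tree r V \<Longrightarrow> card V \<le> 2 \<Longrightarrow> is_path E V"
proof -
  assume T: "tree r V" and c: "card V \<le> 2"
  have VU: "V \<subseteq> U" and rV: "r \<in> V" and par: "\<And>v. v \<in> V - {r} \<Longrightarrow> \<exists>u\<in>N V v. d v = Suc (d u)"
    using T by (auto simp: tree_def)
  have fin: "finite V" using VU fin_subset by blast
  show ?thesis
  proof (cases "V = {r}")
    case True
    then have "list_path E V [r]" using no_loop[of r] VU by (auto simp: list_path_def)
    then show ?thesis by (auto simp: is_path_def)
  next
    case False
    then obtain v where v: "v \<in> V" "v \<noteq> r" using rV by auto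
    have "card {r, v} = 2" using v by simp
    then have V: "V = {r, v}" using card_seteq[OF fin, of "{r, v}"] c v rV by auto
    obtain u where u: "u \<in> N V v" "d v = Suc (d u)" using par[of v] v by blast
    then have "u = r" using V by (auto simp: N_def)
    then have "(v, r) \<in> E" "(r, v) \<in> E" using u sym by (auto simp: N_def dest: symD)
    then have "list_path E V [r, v]"
      using no_loop[of r] no_loop[of v] VU v V by (auto simp: list_path_def)
    then show ?thesis by (auto simp: is_path_def)
  qed
qed

lemma card_remove1: "V \<subseteq> U \<Longrightarrow> v \<in> V \<Longrightarrow> card (V - {v}) = card V - 1"
  using fin_subset by (simp add: card_Diff_singleton)

lemma card_remove2: "V \<subseteq> U \<Longrightarrow> v \<in> V \<Longrightarrow> u \<in> V \<Longrightarrow> u \<noteq> v \<Longrightarrow> card (V - {v, u}) = card V - 2"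
  using fin_subset[of V] by (subst card_Diff_subset) auto

text \<open>Once u is deleted after its leaf v, the branch of c is separated from y. The remaining n
  - 2 vertices form a disconnected forest, bounded by p_2 p_{n-4}.\<close>

lemma pendant_reduction:
  assumes T: "tree r V" and h: "v \<in> V" "v \<noteq> r" "N V v = {u}" "u \<in> V" "c \<in> N V u" "d c = Suc (d u)"
    "y \<in> N V u" "c \<noteq> v" "y \<noteq> v" "y \<noteq> c"
  shows "tree r (V - {v})" "card (V - {v}) = card V - 1" "4 \<le> card V"
      "\<not> at_most_one (N (V - {v}) u)"
    "M V \<le> M (V - {v}) + t * (p 2 * p (card V - 4))"
proof -
  have VU: "V \<subseteq> U" using T by (auto simp: tree_def)
  have VV: "c \<in> V" "y \<in> V" using h N_subset by blast+
  have uc: "u \<noteq> c" "u \<noteq> y" "u \<noteq> v" using h no_loop VU by (auto simp: N_def)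
  have "card {v, u, c, y} = 4" using h uc by auto
  moreover have "card {v, u, c, y} \<le> card V" using h VV fin_subset[OF VU] by (intro card_mono) auto
  ultimately show "4 \<le> card V" by simp
  show "tree r (V - {v})" by (rule tree_delete_leaf[OF T h(2,1,3)])
  show c1: "card (V - {v}) = card V - 1" by (rule card_remove1[OF VU h(1)])
  have "c \<in> N (V - {v}) u" "y \<in> N (V - {v}) u" using h by (auto simp: N_Diff)
  then show "\<not> at_most_one (N (V - {v}) u)" by (rule not_at_most_oneI) (use h in auto)
  have "M (V - {v} - {u}) \<le> p 2 * p (card (V - {v}) - 3)"
    by (rule M_delete_inner_le(1)[of _ u c y]) (use h uc VU in \<open>auto simp: N_Diff\<close>)
  then have "M (V - {v, u}) \<le> p 2 * p (card V - 4)"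
    using c1 by (simp add: Diff_insert2[symmetric] insert_commute)
  then show "M V \<le> M (V - {v}) + t * (p 2 * p (card V - 4))"
    unfolding M_leaf[OF VU h(1,3)] using t by (intro add_left_mono mult_left_mono)
qed

text \<open>As w has at most one neighbour besides u, a path or spider on either smaller set would
  extend to V. Read contrapositively, this lets the induction hypothesis apply to both terms of the
  leaf recursion.\<close>

lemma tail_reduction:
  assumes T: "tree r V" and h: "v \<in> V" "u \<in> V" "w \<in> V" "v \<noteq> r" "u \<noteq> r" "v \<noteq> w" "N V v = {u}"
    "N V u = {v, w}" "at_most_one (N V w - {u})"
  shows "tree r (V - {v})" "tree r (V - {v, u})" "card (V - {v}) = card V - 1"
      "card (V - {v, u}) = card V - 2"
    "is_path E (V - {v}) \<Longrightarrow> is_path E V" "is_path E (V - {v, u}) \<Longrightarrow> is_path E V"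
    "is_spider E (V - {v}) \<Longrightarrow> is_spider E V" "is_spider E (V - {v, u}) \<Longrightarrow> is_spider E V"
    "M V = M (V - {v}) + t * M (V - {v, u})"
proof -
  have VU: "V \<subseteq> U" using T by (auto simp: tree_def)
  have sub: "V - W \<subseteq> U" for W using VU by auto
  have uv: "u \<noteq> v" using no_loop[of v] h VU by (auto simp: N_def)
  have Nu: "N (V - {v}) u = {w}" using h(6,8) by (auto simp: N_Diff)
  have uV: "u \<in> V - {v}" using h uv by simp
  have E2: "V - {v} - {u} = V - {v, u}" by auto
  have amo: "at_most_one (N (V - {v} - {u}) w)"
    by (rule at_most_one_subset[OF h(9)]) (auto simp: N_Diff)
  have am1: "at_most_one (N (V - {v}) u)" using Nu by (simp add: at_most_one_def)
  show T1: "tree r (V - {v})" by (rule tree_delete_leaf[OF T h(4,1,7)])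
  show "tree r (V - {v, u})"
    unfolding E2[symmetric] by (rule tree_delete_leaf[OF T1 h(5) uV Nu])
  show "card (V - {v}) = card V - 1" by (rule card_remove1[OF VU h(1)])
  show "card (V - {v, u}) = card V - 2" by (rule card_remove2[OF VU h(1,2) uv])
  show p1: "is_path E (V - {v}) \<Longrightarrow> is_path E V" by (rule path_extend[OF VU h(1,7) _ am1])
  show "is_path E (V - {v, u}) \<Longrightarrow> is_path E V"
    using path_extend[OF sub uV Nu _ amo] p1 by (simp add: E2)
  show s1: "is_spider E (V - {v}) \<Longrightarrow> is_spider E V" by (rule spider_extend[OF VU h(1,7) _ am1])
  show "is_spider E (V - {v, u}) \<Longrightarrow> is_spider E V"
    using spider_extend[OF sub uV Nu _ amo] s1 by (simp add: E2)
  show "M V = M (V - {v}) + t * M (V - {v, u})" by (rule M_leaf[OF VU h(1,7)])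
qed

text \<open>Deleting w detaches the second leg as a component with one edge, whence the second
  factor p_2.\<close>

lemma fork_reduction:
  assumes VU: "V \<subseteq> U" and h: "w \<in> V" "x \<in> V" "v \<in> V" "u \<in> V" "v' \<in> V" "u' \<in> V"
    "N V v = {u}" "N V u = {v, w}" "N V v' = {u'}" "N V u' = {v', w}"
        "distinct [w, x, v, u, v', u']"
  shows "6 \<le> card V" "card (V - {v, u, v', u', w}) = card V - 5" "card (V - {v, u}) = card V - 2"
    "M V = p 2 * M (V - {v, u}) + t * (p 2 * M (V - {v, u, v', u', w}))"
proof -
  have fin: "finite V" by (rule fin_subset[OF VU])
  have sub: "V - W \<subseteq> U" for W using VU by auto
  have dist: "u \<noteq> v" "v \<noteq> w" "v' \<noteq> u'" "v' \<notin> {v, u, w}" "u' \<notin> {v, u, w}" using h(11) by auto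
  have "card (set [w, x, v, u, v', u']) = 6" by (subst distinct_card[OF h(11)]) simp
  moreover have "card (set [w, x, v, u, v', u']) \<le> card V"
    using h fin by (intro card_mono) auto
  ultimately show "6 \<le> card V" by simp
  show "card (V - {v, u, v', u', w}) = card V - 5"
    using h fin by (subst card_Diff_subset) auto
  show "card (V - {v, u}) = card V - 2" by (rule card_remove2[OF VU h(3,4) dist(1)])
  have "M V = p 2 * M (V - {v, u}) + t * M (V - {v, u, w})"
    by (rule M_fork) (use h VU dist in auto)
  moreover have "M (V - {v, u, w}) = p 2 * M (V - {v, u, w} - {v', u'})"
    by (rule M_pendant_component[OF sub]) (use h dist in \<open>auto simp: N_Diff in_N_iff set_eq_iff\<close>)
  moreover have "V - {v, u, w} - {v', u'} = V - {v, u, v', u', w}" by auto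
  ultimately show "M V = p 2 * M (V - {v, u}) + t * (p 2 * M (V - {v, u, v', u', w}))" by simp
qed

section \<open>Bounds for non-paths and for non-spiders\<close>

text \<open>The bound on the cardinality is proved along with the inequality, because the recursive
  inequality \<open>nonpath_bound_rec\<close> starts only at six vertices: the smaller of the two
  trees in the tail case has at least four.\<close>

theorem M_le_nonpath_bound:
  assumes "tree r V" "\<not> is_path E V"
  shows "4 \<le> card V \<and> M V \<le> nonpath_bound t (card V)"
  using assms
proof (induction "card V" arbitrary: V rule: less_induct)
  case less
  have VU: "V \<subseteq> U" using less.prems by (auto simp: tree_def)
  have sub: "V - W \<subseteq> U" for W using VU by auto
  have card3: "3 \<le> card V"
    using tree_le_2_is_path[OF less.prems(1)] less.prems(2) by linarith
  show ?case
    using less.prems(1) card3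
  proof (cases rule: tree_end_cases)
    case (pendant v u c y)
    note red = pendant_reduction[OF less.prems(1) pendant]
    have "M (V - {v}) \<le> p (card V - 1)" using M_le_path[OF sub, of "{v}"] red(2) by simp
    then show ?thesis using red(3,5) nonpath_bound_pendant[OF t red(3)] by simp
  next
    case (tail v u w)
    note red = tail_reduction[OF less.prems(1) tail]
    have I: "4 \<le> card V - 1 \<and> M (V - {v}) \<le> nonpath_bound t (card V - 1)"
      "4 \<le> card V - 2 \<and> M (V - {v, u}) \<le> nonpath_bound t (card V - 2)"
      using less.hyps[OF _ red(1)] less.hyps[OF _ red(2)] red(3-6) less.prems(2) card3 by auto
    have "M V \<le> nonpath_bound t (card V - 1) + t * nonpath_bound t (card V - 2)"
      unfolding red(9) using I t by (intro add_mono mult_left_mono) auto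
    also have "\<dots> \<le> nonpath_bound t (card V)" by (rule nonpath_bound_rec[OF t]) (use I in auto)
    finally show ?thesis using I by auto
  next
    case (fork w x v u v' u')
    have xV: "x \<in> V" using fork N_subset by blast
    note red = fork_reduction[OF VU fork(1) xV fork(5-12,14)]
    have "M V \<le> p 2 * p (card V - 2) + t * (p 2 * p (card V - 5))"
      unfolding red(4) using M_le_path[OF sub, of "{v, u}"]
          M_le_path[OF sub, of "{v, u, v', u', w}"] red(2,3) t
      by (intro add_mono mult_left_mono path_poly_nonneg[OF t]) auto
    also have "\<dots> = nonpath_bound t (card V)" by (rule nonpath_bound_fork[OF t red(1)])
    finally show ?thesis using red(1) by simp
  qed
qed

theorem M_le_nonspider_bound:
  assumes "tree r V" "\<not> is_path E V" "\<not> is_spider E V"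
  shows "5 \<le> card V \<and> M V \<le> nonspider_bound t (card V)"
  using assms
proof (induction "card V" arbitrary: V rule: less_induct)
  case less
  have VU: "V \<subseteq> U" using less.prems by (auto simp: tree_def)
  have sub: "V - W \<subseteq> U" for W using VU by auto
  have card3: "3 \<le> card V" using M_le_nonpath_bound[OF less.prems(1,2)] by simp
  show ?case
    using less.prems(1) card3
  proof (cases rule: tree_end_cases)
    case (pendant v u c y)
    note red = pendant_reduction[OF less.prems(1) pendant]
    have "\<not> is_path E (V - {v})"
      using path_attach_inner[OF VU pendant(1,3) _ red(4)] less.prems(3) by blast
    then have I: "4 \<le> card V - 1" "M (V - {v}) \<le> nonpath_bound t (card V - 1)"
      using M_le_nonpath_bound[OF red(1)] red(2) by auto
    moreover have "nonpath_bound t (card V - 1) + t * (p 2 * p (card V - 4))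
        \<le> nonspider_bound t (card V)"
      by (rule nonspider_bound_pendant[OF t]) (use I in auto)
    ultimately show ?thesis using red(5) by simp
  next
    case (tail v u w)
    note red = tail_reduction[OF less.prems(1) tail]
    have I: "5 \<le> card V - 1 \<and> M (V - {v}) \<le> nonspider_bound t (card V - 1)"
      "5 \<le> card V - 2 \<and> M (V - {v, u}) \<le> nonspider_bound t (card V - 2)"
      using less.hyps[OF _ red(1)] less.hyps[OF _ red(2)] red(3-8) less.prems(2,3) card3 by auto
    have "M V \<le> nonspider_bound t (card V - 1) + t * nonspider_bound t (card V - 2)"
      unfolding red(9) using I t by (intro add_mono mult_left_mono) auto
    also have "\<dots> \<le> nonspider_bound t (card V)" by (rule nonspider_bound_rec[OF t]) (use I in auto)
    finally show ?thesis using I by auto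
  next
    case (fork w x v u v' u')
    note Nv = fork(9) and Nu = fork(10) and Nv' = fork(11) and Nu' = fork(12)
    have xV: "x \<in> V" using fork N_subset by blast
    note red = fork_reduction[OF VU fork(1) xV fork(5-12,14)]
    have dist: "u \<noteq> v" "v \<noteq> w" "v' \<noteq> u'" "v' \<noteq> w" "v' \<notin> {v, u, w}" "u' \<notin> {v, u, w}" "w \<noteq> u"
      "w \<noteq> u'" "x \<notin> {v, u, v', u', w}" "w \<notin> {v, u, v', u'}"
      using fork(14) by auto
    define R where "R = V - {v, u, v', u', w}"
    have RU: "R \<subseteq> U" using VU by (auto simp: R_def)
    have xR: "x \<in> R" using xV dist by (auto simp: R_def)
    have cR: "card R = card V - 5" using red(2) by (simp add: R_def)
    have uNw: "u \<in> N V w" by (rule N_sym) (use fork in auto)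
    have u'Nw: "u' \<in> N V w" by (rule N_sym) (use fork in auto)
    have am_u: "at_most_one (N (V - {v}) u)" using Nu by (auto simp: N_Diff at_most_one_def)
    have Nu1: "N (V - {v}) u = {w}" using Nu dist by (auto simp: N_Diff)
    have E2: "V - {v} - {u} = V - {v, u}" by auto
    have uV1: "u \<in> V - {v}" using fork dist by simp
    have T1: "tree r (V - {v})" by (rule tree_delete_leaf[OF less.prems(1)]) (use fork in auto)
    have T2: "tree r (V - {v, u})"
      unfolding E2[symmetric] by (rule tree_delete_leaf[OF T1]) (use fork dist Nu1 in auto)
    \<comment> \<open>Otherwise w, with its neighbours u' and x, is an inner vertex of this path,
      and putting u and v back makes V a spider.\<close>
    have np2: "\<not> is_path E (V - {v, u})"
    proof
      assume ip: "is_path E (V - {v, u})"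
      have "u' \<in> N (V - {v} - {u}) w" "x \<in> N (V - {v} - {u}) w"
        using u'Nw fork(3) dist by (auto simp: N_Diff)
      then have "\<not> at_most_one (N (V - {v} - {u}) w)" by (rule not_at_most_oneI) (use dist in auto)
      then have "is_spider E (V - {v})"
        using path_attach_inner[OF sub uV1 Nu1] ip by (simp add: E2)
      then show False using spider_extend[OF VU fork(5) Nv _ am_u] less.prems(3) by blast
    qed
    have I2: "4 \<le> card V - 2" "M (V - {v, u}) \<le> nonpath_bound t (card V - 2)"
      using M_le_nonpath_bound[OF T2 np2] red(3) by auto
    have MV: "M V = p 2 * M (V - {v, u}) + t * (p 2 * M R)" using red(4) by (simp add: R_def)
    have p2: "0 \<le> p 2" by (rule path_poly_nonneg[OF t])
    show ?thesis
    proof (cases "N V w = {u, u', x}")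
      case False
      \<comment> \<open>A third leg of length 2 at w, with inner vertex z and tip z'.\<close>
      then obtain z where z: "z \<in> N V w" "z \<notin> {u, u', x}" using uNw u'Nw fork(3) by blast
      obtain z' where z': "N V z' = {z}" "N V z = {z', w}" "z' \<in> V" using fork(15)[OF z(1)] z
        by blast
      have zV: "z \<in> V" using z N_subset by blast
      have zR: "z \<in> R"
      proof -
        have "z \<noteq> w" using no_loop[of w] z fork(1) VU by (auto simp: N_def)
        moreover have "z \<noteq> v" using Nv z'(2) dist by auto
        moreover have "z \<noteq> v'" using Nv' z'(2) dist by auto
        ultimately show ?thesis using zV z by (auto simp: R_def)
      qed
      have z'R: "z' \<in> R" "z' \<noteq> z"
      proof -
        have "z' \<noteq> u" "z' \<noteq> u'" "z' \<noteq> v" "z' \<noteq> v'" using z'(1) Nu Nu' Nv Nv' z dist zR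
          by (auto simp: R_def)
        moreover have "z' \<noteq> w" using z'(1) uNw z by auto
        ultimately show "z' \<in> R" using z' by (auto simp: R_def)
        show "z' \<noteq> z" using no_loop[of z] z' zV VU by (auto simp: N_def)
      qed
      have "x \<noteq> z" "x \<noteq> z'"
      proof -
        show "x \<noteq> z" using z by auto
        have "w \<in> N V x" by (rule N_sym[OF fork(1,3)])
        then show "x \<noteq> z'" using z'(1) zR by (auto simp: R_def)
      qed
      then have "card {x, z, z'} = 3" using z'R by auto
      moreover have "card {x, z, z'} \<le> card R" using xR zR z'R fin_subset[OF RU]
        by (intro card_mono) auto
      ultimately have n8: "8 \<le> card V" using cR by simp
      have "M R = p 2 * M (R - {z', z})"
        by (rule M_pendant_component[OF RU])
           (use z' zR z'R in \<open>auto simp: R_def N_Diff in_N_iff set_eq_iff\<close>)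
      also have "M (R - {z', z}) \<le> p (card V - 7)"
        using M_le_path[of "R - {z', z}"] RU card_remove2[OF RU z'R(1) zR] z'R cR by auto
      finally have "M R \<le> p 2 * p (card V - 7)" using p2 by (simp add: mult_left_mono)
      then have "M V \<le> p 2 * nonpath_bound t (card V - 2) + t * (p 2 * (p 2 * p (card V - 7)))"
        unfolding MV using I2 p2 t by (intro add_mono mult_left_mono) auto
      also have "\<dots> \<le> nonspider_bound t (card V)" by (rule nonspider_bound_three_forks[OF t n8])
      finally show ?thesis using n8 by simp
    next
      case Nw: True
      have NxR: "N R x = N V x - {w}"
      proof -
        have "b \<notin> {v, u, v', u'}" if "b \<in> N V x" for b
          using N_sym[OF xV that] Nu Nu' Nv Nv' dist by auto
        then show ?thesis by (auto simp: R_def N_Diff)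
      qed
      define W where "W = V - {v, u, v', u'}"
      have WU: "W \<subseteq> U" using VU by (auto simp: W_def)
      have WR: "W - {w} = R" "w \<in> W" using fork dist by (auto simp: W_def R_def)
      have NWw: "N W w = {x}" using Nw dist by (auto simp: W_def N_Diff)
      show ?thesis
      proof (cases "at_most_one (N R x)")
        case True
        \<comment> \<open>Otherwise w, u and v prolong the path R at x, and the other leg u', v' at
          w makes V a spider.\<close>
        have npR: "\<not> is_path E R"
        proof
          assume "is_path E R"
          then have pW: "is_path E W"
            using path_extend[OF WU WR(2) NWw] True by (simp add: WR)
          define W1 where "W1 = V - {v, v', u'}"
          have W1: "W1 \<subseteq> U" "u \<in> W1" "W1 - {u} = W" "N W1 u = {w}" "at_most_one (N W w)"
            using VU fork dist Nu NWw by (auto simp: W1_def W_def N_Diff at_most_one_def)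
          then have p1: "is_path E W1" using path_extend[of W1 u w] pW by simp
          define W2 where "W2 = V - {v', u'}"
          have W2: "W2 \<subseteq> U" "v \<in> W2" "W2 - {v} = W1" "N W2 v = {u}" "at_most_one (N W1 u)"
            using VU fork dist Nv W1 by (auto simp: W1_def W2_def N_Diff at_most_one_def)
          then have p2: "is_path E W2" using path_extend[of W2 v u] p1 by simp
          define W3 where "W3 = V - {v'}"
          have W3: "W3 \<subseteq> U" "u' \<in> W3" "W3 - {u'} = W2" "N W3 u' = {w}"
            using VU fork dist Nu' by (auto simp: W3_def W2_def N_Diff)
          have "u \<in> N W2 w" "x \<in> N W2 w" using uNw fork(3) dist by (auto simp: W2_def N_Diff)
          then have "\<not> at_most_one (N W2 w)" by (rule not_at_most_oneI) (use dist in auto)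
          then have s3: "is_spider E W3" using path_attach_inner[of W3 u' w] W3 p2 by simp
          have "at_most_one (N (V - {v'}) u')" using W3(4) by (simp add: W3_def at_most_one_def)
          then show False
            using spider_extend[OF VU fork(7) Nv'] s3 less.prems(3) by (simp add: W3_def)
        qed
        have TR: "tree r R"
          unfolding R_def
        proof (rule tree_delete[OF less.prems(1)])
          show "r \<notin> {v, u, v', u', w}" using fork(2,13) by auto
          fix a b assume ab: "a \<in> V - {v, u, v', u', w}" "b \<in> {v, u, v', u', w}" "b \<in> N V a"
              "d a = Suc (d b)"
          then have "a \<in> N V b" using N_sym[of a V b] by blast
          then have "b = w" "a = x" using ab Nv Nu Nv' Nu' Nw by auto
          then show False using ab(4) fork(4) by simp
        qed
        have IR: "4 \<le> card V - 5" "M R \<le> nonpath_bound t (card V - 5)"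
          using M_le_nonpath_bound[OF TR npR] cR by auto
        have "M V \<le> p 2 * nonpath_bound t (card V - 2) + t * (p 2 * nonpath_bound t (card V - 5))"
          unfolding MV using I2 IR p2 t by (intro add_mono mult_left_mono) auto
        also have "\<dots> \<le> nonspider_bound t (card V)"
          by (rule nonspider_bound_fork[OF t]) (use IR in auto)
        finally show ?thesis using IR by simp
      next
        case False
        then obtain a b where ab: "a \<in> N R x" "b \<in> N R x" "a \<noteq> b" by (auto simp: at_most_one_def)
        have abU: "a \<in> U" "b \<in> U" "x \<in> U" "(x, a) \<in> E" "(x, b) \<in> E" using ab RU xR
          by (auto simp: N_def)
        have "d a = Suc (d x) \<or> d b = Suc (d x)"
        proof (rule ccontr)
          assume "\<not> ?thesis"
          then have "d x = Suc (d a)" "d x = Suc (d b)" using level abU by blast+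
          then show False using parent_unique[of x a b] abU ab(3) by blast
        qed
        then obtain c y where cy: "c \<in> N R x" "d c = Suc (d x)" "y \<in> N R x" "y \<noteq> c"
          using ab by metis
        have X: "M (R - {x}) \<le> p 2 * p (card R - 3)" "card R = 3 \<Longrightarrow> M (R - {x}) \<le> 1"
          using M_delete_inner_le[OF RU xR cy(1,2,3,4)] by auto
        have "c \<noteq> x" "y \<noteq> x" using cy no_loop[of x] abU by (auto simp: N_def)
        then have "card {x, c, y} = 3" using cy by auto
        moreover have "card {x, c, y} \<le> card R"
          using xR cy N_subset[of R x] fin_subset[OF RU] by (intro card_mono) auto
        ultimately have n8: "8 \<le> card V" using cR by simp
        have M1: "M W = M R + t * M (R - {x})"
        proof -
          have "M W = M (W - {w}) + t * M (W - {w, x})" by (rule M_leaf[OF WU WR(2) NWw])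
          moreover have "W - {w, x} = R - {x}" using WR by auto
          ultimately show ?thesis by (simp add: WR)
        qed
        have M2: "M (V - {v, u}) = p 2 * M W + t * M R"
        proof -
          have "M (V - {v, u}) = p 2 * M (V - {v, u} - {v', u'}) + t * M (V - {v, u} - {v', u', w})"
            by (rule M_fork[OF sub]) (use fork dist in \<open>auto simp: N_Diff\<close>)
          moreover have "V - {v, u} - {v', u'} = W" "V - {v, u} - {v', u', w} = R"
            by (auto simp: W_def R_def)
          ultimately show ?thesis by simp
        qed
        \<comment> \<open>R is joined to the path v, u, w, u', v' only by the edge between w and x;
          the two terms omit this edge and use it.\<close>
        have MV': "M V = p 5 * M R + t * (p 2)\<^sup>2 * M (R - {x})"
          unfolding MV M2 M1 by (simp add: path_poly_numeral algebra_simps power2_eq_square)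
        have MRle: "M R \<le> p (card V - 5)" using M_le_path[OF RU] cR by simp
        show ?thesis
        proof (cases "card V = 8")
          case True
          have "M V \<le> p 5 * p 3 + t * (p 2)\<^sup>2 * 1"
            unfolding MV' using MRle X(2) True cR t path_poly_nonneg[OF t]
            by (intro add_mono mult_left_mono) auto
          also have "\<dots> \<le> nonspider_bound t (card V)"
            using nonspider_bound_adjacent_forks_8[OF t] True by simp
          finally show ?thesis using True by simp
        next
          case False
          have "M V \<le> p 5 * p (card V - 5) + t * (p 2)\<^sup>2 * (p 2 * p (card V - 8))"
            unfolding MV' using MRle X(1) cR t path_poly_nonneg[OF t]
            by (intro add_mono mult_left_mono) auto
          also have "\<dots> \<le> nonspider_bound t (card V)"
            by (rule nonspider_bound_adjacent_forks[OF t]) (use False n8 in auto)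
          finally show ?thesis using n8 by simp
        qed
      qed
    qed
  qed
qed

end

section \<open>Matching polynomials of paths and spiders\<close>

definition spider_poly :: "real \<Rightarrow> nat \<Rightarrow> nat \<Rightarrow> nat \<Rightarrow> real" where
  "spider_poly t a b c = path_poly t (a + b + c + 1)
      - t\<^sup>2 * (path_poly t (a - 1) * path_poly t (b - 1) * path_poly t (c - 1))"

text \<open>The right-hand side sorts the matchings by the edge that joins the first leg to the
  centre. A path on all the vertices would have, in its last factor, one path in place of the two
  other legs; by \<open>path_poly_add\<close> this adds exactly the correction term of
  \<open>spider_poly\<close>.\<close>

lemma spider_poly_eq:
  "spider_poly t (Suc a) (Suc b) (Suc c) = path_poly t (Suc a) * path_poly t (b + c + 3)
      + t * path_poly t a * (path_poly t (Suc b) * path_poly t (Suc c))"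
proof -
  have "path_poly t (Suc a + Suc b + Suc c + 1)
      = path_poly t (Suc a) * path_poly t (b + c + 3) + t * path_poly t a * path_poly t (b + c + 2)"
    using path_poly_add[of t a "b + c + 2"] by (simp add: eval_nat_numeral add.assoc)
  moreover have "path_poly t (b + c + 2) = path_poly t (Suc b) * path_poly t (Suc c)
      + t * path_poly t b * path_poly t c"
    using path_poly_add[of t b c] by simp
  ultimately have "path_poly t (Suc a + Suc b + Suc c + 1)
      = path_poly t (Suc a) * path_poly t (b + c + 3) + t * path_poly t a *
          (path_poly t (Suc b) * path_poly t (Suc c) + t * path_poly t b * path_poly t c)"
    by (simp only:)
  then show ?thesis
    unfolding spider_poly_def by (simp only: diff_Suc_1) (simp add: algebra_simps power2_eq_square)
qed

lemma list_edges_restrict: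
  assumes "c \<notin> set B" "set B \<inter> set C = {}"
  shows "(list_edges (B @ [c]) \<union> list_edges (C @ [c])) \<inter> set B \<times> set B = list_edges B"
proof -
  have "list_edges (B @ [c]) \<inter> set B \<times> set B = list_edges B"
    using assms(1) list_edges_subset[of B] by (cases "B = []") (auto simp: list_edges_append)
  moreover have "list_edges (C @ [c]) \<inter> set B \<times> set B = {}"
    using list_edges_subset[of "C @ [c]"] assms by fastforce
  ultimately show ?thesis by (simp add: Int_Un_distrib2)
qed

context depth_forest
begin

lemma list_path_tl:
  assumes "list_path E V (x # xs)"
  shows "list_path E (V - {x}) xs"
proof -
  have 1: "distinct (x # xs)" "set (x # xs) = V" "E \<inter> V \<times> V = list_edges (x # xs)"
    using assms by (simp_all add: list_path_def)
  have "E \<inter> (V - {x}) \<times> (V - {x}) = list_edges (x # xs) \<inter> (V - {x}) \<times> (V - {x})" using 1(3) by blast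
  also have "\<dots> = list_edges xs"
  proof (cases "xs = []")
    case False
    then show ?thesis using 1(1,2) list_edges_subset[of xs] by (auto simp: list_edges_Cons)
  qed simp
  finally show ?thesis using 1 by (auto simp: list_path_def)
qed

lemma list_path_N_hd:
  assumes "list_path E V (x # y # xs)"
  shows "N V x = {y}"
proof -
  have "(x, y) \<in> E" "y \<in> V" using assms by (auto simp: list_path_def)
  then have "y \<in> N V x" by (simp add: N_def)
  moreover have "z = y" if "z \<in> N V x" for z
    using hd_path[OF assms that] by simp
  ultimately show ?thesis by blast
qed

lemma M_list_path:
  assumes "V \<subseteq> U" "list_path E V xs"
  shows "M V = p (length xs)"
  using assms
proof (induction "length xs" arbitrary: xs V rule: less_induct)
  case less
  consider "xs = []" | x where "xs = [x]" | x y zs where "xs = x # y # zs"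
    by (cases xs rule: list_edges.cases) auto
  then show ?case
  proof cases
    case 1
    then show ?thesis using less.prems by (simp add: list_path_def)
  next
    case (2 x)
    then have V: "V = {x}" using less.prems by (simp add: list_path_def)
    then have "N V x = {}" using less.prems no_loop[of x] by (auto simp: N_def)
    then show ?thesis using M_isolated[OF less.prems(1), of x] V 2 by simp
  next
    case (3 x y zs)
    note l = less.prems(2)[unfolded 3]
    have l1: "list_path E (V - {x}) (y # zs)" by (rule list_path_tl[OF l])
    have l2: "list_path E (V - {x} - {y}) zs" by (rule list_path_tl[OF l1])
    have "V - {x} - {y} = V - {x, y}" by auto
    moreover have "M (V - {x}) = p (length (y # zs))"
      by (rule less.hyps[OF _ _ l1]) (use less.prems 3 in auto)
    moreover have "M (V - {x} - {y}) = p (length zs)"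
      by (rule less.hyps[OF _ _ l2]) (use less.prems 3 in auto)
    moreover have "M V = M (V - {x}) + t * M (V - {x, y})"
      by (rule M_leaf[OF less.prems(1) _ list_path_N_hd[OF l]]) (use l in \<open>auto simp: list_path_def\<close>)
    ultimately show ?thesis by (simp add: 3)
  qed
qed

text \<open>Unlike \<open>list_spider\<close> it admits empty legs, so that deleting the tip of a
  leg stays within the notion; with an empty first leg it is a path through c.\<close>

definition weak_spider :: "'a set \<Rightarrow> 'a \<Rightarrow> 'a list \<Rightarrow> 'a list \<Rightarrow> 'a list \<Rightarrow> bool" where
  "weak_spider V c A B C \<longleftrightarrow> distinct (c # A @ B @ C)
     \<and> set (c # A @ B @ C) = V \<and> E \<inter> V \<times> V = list_edges (A @ [c]) \<union> list_edges (B @ [c]) \<union>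
         list_edges (C @ [c])"

lemma weak_spider_delete:
  assumes "weak_spider V c (x # A) B C"
  shows "weak_spider (V - {x}) c A B C" "N V x = {hd (A @ [c])}" "x \<in> V"
proof -
  have 1: "distinct (c # (x # A) @ B @ C)" "set (c # (x # A) @ B @ C) = V"
    "E \<inter> V \<times> V = list_edges (x # A @ [c]) \<union> list_edges (B @ [c]) \<union> list_edges (C @ [c])"
    using assms by (simp_all add: weak_spider_def)
  have 2: "list_edges (x # A @ [c]) = {(x, hd (A @ [c])), (hd (A @ [c]), x)} \<union> list_edges (A @ [c])"
    by (simp add: list_edges_Cons)
  have 3: "E \<inter> V \<times> V = {(x, hd (A @ [c])), (hd (A @ [c]), x)}
      \<union> (list_edges (A @ [c]) \<union> list_edges (B @ [c]) \<union> list_edges (C @ [c]))"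
    unfolding 1(3) 2 by blast
  have 4: "list_edges (A @ [c]) \<union> list_edges (B @ [c]) \<union> list_edges (C @ [c])
      \<subseteq> (V - {x}) \<times> (V - {x})"
    using list_edges_subset[of "A @ [c]"] list_edges_subset[of "B @ [c]"]
        list_edges_subset[of "C @ [c]"] 1(1,2) by fastforce
  have "E \<inter> (V - {x}) \<times> (V - {x}) = list_edges (A @ [c]) \<union> list_edges (B @ [c])
      \<union> list_edges (C @ [c])"
    using 3 4 by blast
  then show "weak_spider (V - {x}) c A B C"
    using 1(1,2) by (auto simp: weak_spider_def)
  show "x \<in> V" using 1(2) by auto
  have h: "hd (A @ [c]) \<in> V" using 1(2) hd_in_set[of "A @ [c]"] by auto
  show "N V x = {hd (A @ [c])}"
  proof (intro equalityI subsetI)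
    fix z assume "z \<in> N V x"
    then have "(x, z) \<in> E \<inter> V \<times> V" using \<open>x \<in> V\<close> by (auto simp: N_def)
    then show "z \<in> {hd (A @ [c])}" using 3 4 by blast
  next
    fix z assume "z \<in> {hd (A @ [c])}"
    then show "z \<in> N V x" using 3 by (auto simp: N_def)
  qed
qed

lemma weak_spider_Nil:
  assumes "weak_spider V c [] B C"
  shows "list_path E V (B @ c # rev C)"
proof -
  have "list_edges (B @ c # rev C) = list_edges (B @ [c]) \<union> list_edges (C @ [c])"
  proof -
    have "list_edges (c # rev C) = list_edges (C @ [c])" using list_edges_rev[of "C @ [c]"] by simp
    moreover have "list_edges (B @ c # rev C) = list_edges (B @ [c]) \<union> list_edges (c # rev C)"
      by (cases "B = []"; cases "C = []") (auto simp: list_edges_append list_edges_Cons)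
    ultimately show ?thesis by simp
  qed
  then show ?thesis using assms by (auto simp: weak_spider_def list_path_def)
qed

lemma M_weak_spider_one:
  assumes "V \<subseteq> U" "weak_spider V c [x] B C"
  shows "M V = p (length B + length C + 1) + t * (p (length B) * p (length C))"
proof -
  note del = weak_spider_delete[OF assms(2), simplified]
  have 0: "M V = M (V - {x}) + t * M (V - {x, c})"
    by (rule M_leaf[OF assms(1) del(3)]) (use del in simp)
  have sub: "V - W \<subseteq> U" for W using assms(1) by auto
  have lp: "list_path E (V - {x}) (B @ c # rev C)" by (rule weak_spider_Nil[OF del(1)])
  have 1: "M (V - {x}) = p (length B + length C + 1)"
    using M_list_path[OF sub lp] by simp
  have d: "distinct (c # B @ C)" "set (c # B @ C) = V - {x}"
    "E \<inter> (V - {x}) \<times> (V - {x}) = list_edges (B @ [c]) \<union> list_edges (C @ [c])"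
    using del(1) by (simp_all add: weak_spider_def)
  have BC: "V - {x, c} = set B \<union> set C" "set B \<inter> set C = {}" using d(1,2) by auto
  have ceX: "list_edges (B @ [c]) \<subseteq> set (B @ [c]) \<times> set (B @ [c])"
      "list_edges (C @ [c]) \<subseteq> set (C @ [c]) \<times> set (C @ [c])"
    by (rule list_edges_subset)+
  have cross: "(a, b) \<notin> E" if "a \<in> set B" "b \<in> set C" for a b
  proof
    assume "(a, b) \<in> E"
    then have "(a, b) \<in> E \<inter> (V - {x}) \<times> (V - {x})" using that d(2) by auto
    then show False using d(1) ceX that unfolding d(3) by auto
  qed
  have "E \<inter> set B \<times> set B = (E \<inter> (V - {x}) \<times> (V - {x})) \<inter> set B \<times> set B" using d(2) by auto
  also have "\<dots> = list_edges B" unfolding d(3) by (rule list_edges_restrict) (use d(1) in auto)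
  finally have "list_path E (set B) B" using d(1) by (simp add: list_path_def)
  moreover have "E \<inter> set C \<times> set C = (E \<inter> (V - {x}) \<times> (V - {x})) \<inter> set C \<times> set C" using d(2) by auto
  then have "E \<inter> set C \<times> set C = list_edges C"
    unfolding d(3) using list_edges_restrict[of c C B] d(1) by (simp add: Un_commute Int_commute)
  then have "list_path E (set C) C" using d(1) by (simp add: list_path_def)
  moreover have "set B \<subseteq> U" "set C \<subseteq> U" using BC(1) sub[of "{x, c}"] by auto
  ultimately have "M (set B) = p (length B)" "M (set C) = p (length C)" using M_list_path by blast+
  moreover have "M (V - {x, c}) = M (set B) * M (set C)"
    by (rule M_union[OF sub BC cross])
  ultimately show ?thesis using 0 1 by simp
qed

text \<open>Both sides satisfy the recursion of the path polynomials in the length of A, so the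
  lengths 1 and 2 decide.\<close>

lemma M_weak_spider:
  assumes "V \<subseteq> U" "weak_spider V c A B C" "A \<noteq> []"
  shows "M V = p (length A) * p (length B + length C + 1)
      + t * p (length A - 1) * (p (length B) * p (length C))"
  using assms
proof (induction "length A" arbitrary: A V rule: less_induct)
  case less
  have sub: "V - W \<subseteq> U" for W using less.prems(1) by auto
  consider x where "A = [x]" | x y where "A = [x, y]" | x y z zs where "A = x # y # z # zs"
    using less.prems(3) by (metis list.exhaust)
  then show ?case
  proof cases
    case (1 x)
    then show ?thesis using M_weak_spider_one[OF less.prems(1)] less.prems(2) by simp
  next
    case (2 x y)
    note d1 = weak_spider_delete[OF less.prems(2)[unfolded 2], simplified]
    note d2 = weak_spider_delete[OF d1(1), simplified]
    have "M V = M (V - {x}) + t * M (V - {x, y})" by (rule M_leaf[OF less.prems(1) d1(3,2)])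
    moreover have "V - {x, y} = V - {x} - {y}" by auto
    moreover have "M (V - {x} - {y}) = p (length B + length C + 1)"
      using M_list_path[OF _ weak_spider_Nil[OF d2(1)]] sub by (simp add: Diff_insert2[symmetric])
    ultimately show ?thesis
      using M_weak_spider_one[OF sub d1(1)] by (simp add: 2 path_poly_numeral algebra_simps)
  next
    case (3 x y z zs)
    note d1 = weak_spider_delete[OF less.prems(2)[unfolded 3], simplified]
    note d2 = weak_spider_delete[OF d1(1), simplified]
    have "M V = M (V - {x}) + t * M (V - {x, y})" by (rule M_leaf[OF less.prems(1) d1(3,2)])
    moreover have "V - {x, y} = V - {x} - {y}" by auto
    moreover have "V - {x} - {y} \<subseteq> U" using less.prems(1) by auto
    ultimately show ?thesis
      using less.hyps[OF _ sub d1(1)] less.hyps[OF _ _ d2(1)] by (simp add: 3 algebra_simps)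
  qed
qed

lemma M_list_spider:
  assumes "V \<subseteq> U" "list_spider E V c A B C"
  shows "M V = spider_poly t (length A) (length B) (length C)"
    "card V = length A + length B + length C + 1"
proof -
  have ne: "A \<noteq> []" "B \<noteq> []" "C \<noteq> []" and w: "weak_spider V c A B C"
    and ds: "distinct (c # A @ B @ C)" "set (c # A @ B @ C) = V"
    using assms(2) unfolding list_spider_def weak_spider_def by blast+
  then obtain a b e where l: "length A = Suc a" "length B = Suc b" "length C = Suc e"
    by (metis length_0_conv not0_implies_Suc)
  show "M V = spider_poly t (length A) (length B) (length C)"
    using M_weak_spider[OF assms(1) w ne(1)] unfolding l spider_poly_eq
      by (simp add: eval_nat_numeral)
  show "card V = length A + length B + length C + 1"
    using distinct_card[OF ds(1)] ds(2) by simp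
qed

end

section \<open>Undirected trees\<close>

definition depth_function :: "('a \<times> 'a) set \<Rightarrow> 'a \<Rightarrow> 'a set \<Rightarrow> ('a \<Rightarrow> nat) \<Rightarrow> bool" where
  "depth_function E r W d \<longleftrightarrow> r \<in> W \<and> d r = 0
     \<and> (\<forall>u\<in>W. \<forall>v\<in>W. (u, v) \<in> E \<longrightarrow> d u = Suc (d v) \<or> d v = Suc (d u))
     \<and> (\<forall>v\<in>W. \<forall>u\<in>W. \<forall>u'\<in>W. (v, u) \<in> E \<longrightarrow> (v, u') \<in> E \<longrightarrow> d v = Suc (d u) \<longrightarrow> d v = Suc (d u') \<longrightarrow> u = u')
     \<and> (\<forall>v\<in>W - {r}. \<exists>u\<in>W. (v, u) \<in> E \<and> d v = Suc (d u))"

definition vertex_path :: "('a \<times> 'a) set \<Rightarrow> 'a set \<Rightarrow> 'a \<Rightarrow> 'a \<Rightarrow> 'a list \<Rightarrow> bool" where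
  "vertex_path E W a b xs \<longleftrightarrow> xs \<noteq> [] \<and> hd xs = a \<and> last xs = b \<and> distinct xs \<and> set xs \<subseteq> W
      \<and> list_edges xs \<subseteq> E"

definition path_connected_on :: "('a \<times> 'a) set \<Rightarrow> 'a set \<Rightarrow> bool" where
  "path_connected_on E W \<longleftrightarrow> (\<forall>a\<in>W. \<forall>b\<in>W. \<exists>xs. vertex_path E W a b xs)"

fun arcs_of :: "'a list \<Rightarrow> ('a \<times> 'a) list" where
  "arcs_of (x # y # zs) = (x, y) # arcs_of (y # zs)"
| "arcs_of _ = []"

lemma arcs_of_walk:
  assumes "xs \<noteq> []"
  shows "pcas (hd xs) (arcs_of xs) (last xs)" "pawalk_verts (hd xs) (arcs_of xs) = xs"
    "set (arcs_of xs) \<subseteq> list_edges xs" "length (arcs_of xs) = length xs - 1"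
  using assms by (induction xs rule: arcs_of.induct) auto

text \<open>The vertex b closes the path between its two neighbours in W. As these differ, the path
  has at least two vertices and the cycle at least three arcs, so it is not one of the 2-cycles that
  every edge produces.\<close>

lemma cycle_of_vertex_path:
  assumes G: "pair_graph G" and p: "vertex_path (parcs G) W a a' xs"
      and "b \<notin> W" "W \<subseteq> pverts G" "b \<in> pverts G"
    and "a \<noteq> a'" "(b, a) \<in> parcs G" "(a', b) \<in> parcs G"
  shows "\<exists>p. pre_digraph.cycle (with_proj G) p \<and> 3 \<le> length p"
proof -
  interpret pair_graph G by (rule G)
  have sym: "sym (parcs G)" using sym_arcs by (simp add: symmetric_def)
  have xs: "xs \<noteq> []" "hd xs = a" "last xs = a'" "distinct xs" "set xs \<subseteq> W" "list_edges xs \<subseteq> parcs G"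
    using p by (auto simp: vertex_path_def)
  define ys where "ys = b # xs @ [b]"
  have len: "2 \<le> length xs" using xs(1-3) assms(6) by (cases xs rule: arcs_of.cases) auto
  have "(a, b) \<in> parcs G" "(b, a') \<in> parcs G" using assms(7,8) sym by (auto dest: symD)
  then have cey: "list_edges ys \<subseteq> parcs G"
    using xs assms(7,8) by (auto simp: ys_def list_edges_append list_edges_Cons)
  have "ys \<noteq> []" by (simp add: ys_def)
  note w = arcs_of_walk[OF this]
  have "awalk b (arcs_of ys) b"
    using w(1,3) cey assms(5) by (auto simp: awalk_def ys_def)
  moreover have "distinct (tl (pawalk_verts b (arcs_of ys)))"
    using w(2) xs(4,5) assms(3) by (auto simp: ys_def)
  moreover have "3 \<le> length (arcs_of ys)" using w(4) len by (simp add: ys_def)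
  ultimately show ?thesis unfolding cycle_def by (intro exI[of _ "arcs_of ys"]) force
qed

lemma vertex_path_mono: "vertex_path E W a b xs \<Longrightarrow> W \<subseteq> W' \<Longrightarrow> vertex_path E W' a b xs"
  by (auto simp: vertex_path_def)

lemma vertex_path_Cons:
  assumes "vertex_path E W a b xs" "v \<notin> W" "(v, a) \<in> E" "(a, v) \<in> E"
  shows "vertex_path E (insert v W) v b (v # xs)"
  using assms by (auto simp: vertex_path_def list_edges_Cons)

lemma vertex_path_rev: "vertex_path E W a b xs \<Longrightarrow> vertex_path E W b a (rev xs)"
  by (auto simp: vertex_path_def list_edges_rev hd_rev last_rev)

lemma depth_function_extend:
  assumes "depth_function E r W d" "sym E" "a \<in> W" "b \<notin> W" "(b, a) \<in> E" "(b, b) \<notin> E"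
    and "\<And>a'. a' \<in> W \<Longrightarrow> (b, a') \<in> E \<Longrightarrow> a' = a"
  shows "depth_function E r (insert b W) (d(b := Suc (d a)))"
proof -
  have 1: "(a', b) \<in> E \<longleftrightarrow> a' = a" "(b, a') \<in> E \<longleftrightarrow> a' = a" if "a' \<in> W" for a'
    using assms(2,5) assms(7)[OF that] that by (auto dest: symD)
  have ba: "b \<noteq> a" "r \<noteq> b" using assms(1,3,4) by (auto simp: depth_function_def)
  have D: "r \<in> W" "d r = 0"
    "\<And>u v. u \<in> W \<Longrightarrow> v \<in> W \<Longrightarrow> (u, v) \<in> E \<Longrightarrow> d u = Suc (d v) \<or> d v = Suc (d u)"
    "\<And>v u u'. \<lbrakk>v \<in> W; u \<in> W; u' \<in> W; (v, u) \<in> E; (v, u') \<in> E; d v = Suc (d u); d v = Suc (d u')\<rbrakk>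
        \<Longrightarrow> u = u'"
    "\<And>v. v \<in> W - {r} \<Longrightarrow> \<exists>u\<in>W. (v, u) \<in> E \<and> d v = Suc (d u)"
    using assms(1) unfolding depth_function_def by blast+
  let ?d = "d(b := Suc (d a))"
  have dW: "?d v = d v" if "v \<in> W" for v using that assms(4) by auto
  show ?thesis
    unfolding depth_function_def
  proof (intro conjI ballI impI)
    show "r \<in> insert b W" "?d r = 0" using D(1,2) ba by auto
  next
    fix u v assume uv: "u \<in> insert b W" "v \<in> insert b W" "(u, v) \<in> E"
    consider "u \<in> W" "v \<in> W" | "u = b" "v \<in> W" | "u \<in> W" "v = b" using uv assms(6) by auto
    then show "?d u = Suc (?d v) \<or> ?d v = Suc (?d u)"
    proof cases
      case 1
      then show ?thesis using D(3) uv(3) dW by simp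
    qed (use uv(3) 1 dW ba in auto)
  next
    fix v u u'
    assume v: "v \<in> insert b W" "u \<in> insert b W" "u' \<in> insert b W" "(v, u) \<in> E" "(v, u') \<in> E"
      "?d v = Suc (?d u)" "?d v = Suc (?d u')"
    show "u = u'"
    proof (cases "v = b")
      case True
      then have "u \<in> W" "u' \<in> W" using v assms(6) by auto
      then show ?thesis using v(4,5) True 1 by simp
    next
      case False
      then have vW: "v \<in> W" using v by simp
      have nb: "z \<noteq> b" if "(v, z) \<in> E" "?d v = Suc (?d z)" for z
        using that 1(1)[OF vW] ba by auto
      have "u \<in> W" "u' \<in> W" using v(2,3) nb[OF v(4,6)] nb[OF v(5,7)] by auto
      then show ?thesis using D(4)[OF vW] v(4-7) dW vW by simp
    qed
  next
    fix v assume v: "v \<in> insert b W - {r}"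
    show "\<exists>u\<in>insert b W. (v, u) \<in> E \<and> ?d v = Suc (?d u)"
    proof (cases "v = b")
      case True
      then show ?thesis using assms(3,5) ba by (intro bexI[of _ a]) auto
    next
      case False
      then obtain u where "u \<in> W" "(v, u) \<in> E" "d v = Suc (d u)" using D(5)[of v] v by auto
      then show ?thesis using dW False v by (intro bexI[of _ u]) auto
    qed
  qed
qed

text \<open>W grows from the root by one adjacent vertex b at a time, placed one level below its
  neighbour. A second neighbour of b in W would close a cycle; this is why W is kept connected by
  simple paths.\<close>

lemma undirected_tree_depth_function:
  assumes T: "undirected_tree G" and r: "r \<in> pverts G"
  shows "\<exists>d. depth_function (parcs G) r (pverts G) d"
proof -
  have G: "pair_graph G" using T by (simp add: undirected_tree_def)
  interpret pair_graph G by (rule G)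
  let ?E = "parcs G" and ?V = "pverts G"
  have sym: "sym ?E" using sym_arcs by (simp add: symmetric_def)
  have "strongly_connected (with_proj G)"
    by (rule symmetric_connected_imp_strongly_connected)
       (use T sym_arcs in \<open>auto simp: undirected_tree_def\<close>)
  then have reach: "(r, v) \<in> ?E\<^sup>*" if "v \<in> ?V" for v
    using reachable_rtranclI[of "with_proj G" r v] that r by (auto simp: strongly_connected_def)
  have "\<exists>d. depth_function ?E r ?V d"
    if "W \<subseteq> ?V" "depth_function ?E r W d" "path_connected_on ?E W" for W d
    using that
  proof (induction "card (?V - W)" arbitrary: W d rule: less_induct)
    case less
    show ?case
    proof (cases "W = ?V")
      case True
      then show ?thesis using less.prems(2) by blast
    next
      case False
      have rW: "r \<in> W" using less.prems(2) by (simp add: depth_function_def)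
      have "\<exists>a b. a \<in> W \<and> b \<notin> W \<and> (a, b) \<in> ?E"
      proof (rule ccontr)
        assume no: "\<not> ?thesis"
        have "v \<in> W" if "(r, v) \<in> ?E\<^sup>*" for v
          using that by (induction rule: rtrancl_induct) (use rW no in auto)
        then show False using reach False less.prems(1) by blast
      qed
      then obtain a b where ab: "a \<in> W" "b \<notin> W" "(a, b) \<in> ?E" by blast
      have ba: "(b, a) \<in> ?E" using ab(3) sym by (auto dest: symD)
      have bV: "b \<in> ?V" using ab(3) by (rule in_arcsD2)
      have uniq: "a' = a" if a': "a' \<in> W" "(b, a') \<in> ?E" for a'
      proof (rule ccontr)
        assume "a' \<noteq> a"
        obtain xs where "vertex_path ?E W a a' xs"
          using less.prems(3) ab(1) a'(1) by (auto simp: path_connected_on_def)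
        moreover have "(a', b) \<in> ?E" using a'(2) sym by (auto dest: symD)
        ultimately have "\<exists>p. pre_digraph.cycle (with_proj G) p \<and> 3 \<le> length p"
          using cycle_of_vertex_path[OF G _ ab(2) less.prems(1) bV _ ba] \<open>a' \<noteq> a\<close> by blast
        then show False using T by (auto simp: undirected_tree_def)
      qed
      have "depth_function ?E r (insert b W) (d(b := Suc (d a)))"
        by (rule depth_function_extend[OF less.prems(2) sym ab(1,2) ba _ uniq])
           (use pair_no_loops in fastforce)
      moreover have "path_connected_on ?E (insert b W)"
      proof -
        have from_b: "\<exists>xs. vertex_path ?E (insert b W) b c xs" if "c \<in> W" for c
          using less.prems(3) ab(1) that vertex_path_Cons[OF _ ab(2) ba ab(3)]
          unfolding path_connected_on_def by blast
        have bb: "vertex_path ?E (insert b W) b b [b]" by (simp add: vertex_path_def)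
        show ?thesis
          unfolding path_connected_on_def
        proof (intro ballI)
          fix x y assume xy: "x \<in> insert b W" "y \<in> insert b W"
          consider "x = b" "y = b" | "x = b" "y \<in> W" | "x \<in> W" "y = b" | "x \<in> W" "y \<in> W"
            using xy by blast
          then show "\<exists>xs. vertex_path ?E (insert b W) x y xs"
          proof cases
            case 1
            then show ?thesis using bb by blast
          next
            case 2
            then show ?thesis using from_b by blast
          next
            case 3
            then show ?thesis using from_b[OF 3(1)] vertex_path_rev 3(2) by metis
          next
            case 4
            then show ?thesis
              using less.prems(3) vertex_path_mono[of ?E W x y _ "insert b W"]
              unfolding path_connected_on_def by blast
          qed
        qed
      qed
      moreover have "card (?V - insert b W) < card (?V - W)"
        using bV ab(2) pair_finite_verts by (intro psubset_card_mono) auto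
      ultimately show ?thesis
        using less.hyps[of "insert b W"] less.prems(1) bV by blast
    qed
  qed
  moreover have "depth_function ?E r {r} (\<lambda>_. 0)"
    using pair_no_loops by (fastforce simp: depth_function_def)
  moreover have "vertex_path ?E {r} r r [r]" by (simp add: vertex_path_def)
  then have "path_connected_on ?E {r}" by (auto simp: path_connected_on_def)
  ultimately show ?thesis using r by blast
qed

lemma depth_function_forest:
  assumes "depth_function E r V d" "sym E" "finite V" "0 \<le> t"
  shows "depth_forest E d V t"
  using assms unfolding depth_function_def depth_forest_def by blast

text \<open>The tree is rooted twice: a vertex that is deepest with respect to an arbitrary root has
  at most one neighbour and serves as the new root.\<close>

theorem undirected_tree_rooted_at_leaf:
  assumes T: "undirected_tree G"
  obtains d r where "\<And>t. 0 \<le> t \<Longrightarrow> depth_forest (parcs G) d (pverts G) t"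
    "depth_forest.tree (parcs G) d (pverts G) r (pverts G)"
proof -
  interpret pair_graph G using T by (simp add: undirected_tree_def)
  let ?E = "parcs G" and ?V = "pverts G"
  have sym: "sym ?E" using sym_arcs by (simp add: symmetric_def)
  have "?V \<noteq> {}"
    using T by (auto simp: undirected_tree_def connected_def strongly_connected_def)
  then obtain r0 where "r0 \<in> ?V" by blast
  then obtain d0 where d0: "depth_function ?E r0 ?V d0"
    using undirected_tree_depth_function[OF T] by blast
  \<comment> \<open>Depths and neighbours do not involve t, so the value 0 will do.\<close>
  interpret F0: depth_forest ?E d0 ?V 0
    by (rule depth_function_forest[OF d0 sym pair_finite_verts]) simp
  obtain r where r: "r \<in> ?V" "\<And>u. u \<in> ?V \<Longrightarrow> d0 u \<le> d0 r"
    using F0.obtain_deepest[OF order_refl \<open>?V \<noteq> {}\<close>] by blast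
  obtain d where d: "depth_function ?E r ?V d"
    using undirected_tree_depth_function[OF T r(1)] by blast
  have F: "depth_forest ?E d ?V t" if "0 \<le> t" for t
    by (rule depth_function_forest[OF d sym pair_finite_verts that])
  interpret F: depth_forest ?E d ?V 0 by (rule F) simp
  have "F.N ?V r = F0.N ?V r" by (simp add: F.N_def F0.N_def)
  moreover have "F0.N ?V r = {u}" if "u \<in> F0.N ?V r" for u
    using F0.deepest_N(1)[OF order_refl r that] by simp
  ultimately have "F.at_most_one (F.N ?V r)"
    unfolding F.at_most_one_def by blast
  then have "F.tree r ?V"
    using d unfolding F.tree_def depth_function_def F.N_def by blast
  then show thesis using that F by blast
qed

section \<open>Trees given by a parent function\<close>

lemma pcas_nth:
  "pcas u p v \<Longrightarrow> length (pawalk_verts u p) = Suc (length p) \<and> pawalk_verts u p ! 0 = u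
     \<and> pawalk_verts u p ! length p = v
     \<and> (\<forall>i<length p. (pawalk_verts u p ! i, pawalk_verts u p ! Suc i) = p ! i)"
proof (induction p arbitrary: u)
  case (Cons e p)
  then show ?case
    by (auto simp: nth_Cons split: nat.split)
qed simp

definition parent_arcs :: "(nat \<Rightarrow> nat) \<Rightarrow> nat \<Rightarrow> (nat \<times> nat) set" where
  "parent_arcs par m = {(v, par v) | v. v \<in> {1..m}} \<union> {(par v, v) | v. v \<in> {1..m}}"

lemma parent_arcs_less:
  assumes "\<And>v. 0 < v \<Longrightarrow> par v < v" "(a, b) \<in> parent_arcs par m" "b \<le> a"
  shows "b = par a" "b < a"
  using assms unfolding parent_arcs_def by (auto dest: order.strict_trans1)

text \<open>Following parents leads from every vertex to 0. The largest vertex of a cycle would have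
  two distinct smaller neighbours on it, whereas its parent is its only smaller neighbour.\<close>

lemma parent_tree_undirected:
  assumes par: "\<And>v. 0 < v \<Longrightarrow> par v < v"
    and G: "G = \<lparr> pverts = {0..m}, parcs = parent_arcs par m \<rparr>"
  shows "undirected_tree G"
proof -
  have bound: "par v \<le> m" if "v \<in> {1..m}" for v using par[of v] that by auto
  have pg: "pair_graph G"
  proof
    show "finite (parcs G)"
      by (rule finite_subset[of _ "{0..m} \<times> {0..m}"]) (use bound in \<open>auto simp: G parent_arcs_def\<close>)
    show "fst e \<in> pverts G" "snd e \<in> pverts G" if "e \<in> parcs G" for e
      using that bound by (auto simp: G parent_arcs_def)
    show "symmetric (with_proj G)"
      by (auto simp: symmetric_def G parent_arcs_def intro!: symI)
    show "fst e \<noteq> snd e" if "e \<in> parcs G" for e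
    proof
      assume eq: "fst e = snd e"
      have "(fst e, snd e) \<in> parent_arcs par m" using that by (simp add: G)
      from parent_arcs_less(2)[OF par this] eq show False by simp
    qed
  qed (simp add: G)
  interpret pair_graph G by (rule pg)
  have down: "reachable (with_proj G) v 0" if "v \<le> m" for v
    using that
  proof (induction v rule: less_induct)
    case (less v)
    show ?case
    proof (cases "v = 0")
      case True
      have "0 \<in> pverts G" by (simp add: G)
      then show ?thesis using True reachable_refl by blast
    next
      case False
      then have "(v, par v) \<in> parcs G" using less.prems by (auto simp: G parent_arcs_def)
      moreover have "reachable (with_proj G) (par v) 0"
        using less.IH[of "par v"] par[of v] False less.prems by auto
      ultimately show ?thesis by (metis adj_reachable_trans with_proj_simps(3))
    qed
  qed
  have up: "reachable (with_proj G) 0 v" if "v \<le> m" for v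
    using symmetric_reachable[OF _ down[OF that]] sym_arcs by blast
  have conn: "connected (with_proj G)"
    unfolding connected_def strongly_connected_def
  proof (intro conjI ballI)
    show "verts (mk_symmetric (with_proj G)) \<noteq> {}" by (simp add: mk_symmetric_def G)
    fix u v assume "u \<in> verts (mk_symmetric (with_proj G))" "v \<in> verts (mk_symmetric (with_proj G))"
    then have "u \<le> m" "v \<le> m" by (auto simp: mk_symmetric_def G)
    then have "reachable (with_proj G) u v" using reachable_trans[OF down up] by blast
    then show "reachable (mk_symmetric (with_proj G)) u v"
      using reachable_mk_symmetric_eq[OF sym_arcs] by blast
  qed
  have acyclic: False if c: "cycle p" and l: "3 \<le> length p" for p
  proof -
    obtain u where u: "awalk u p u" "distinct (tl (pawalk_verts u p))"
      using c by (auto simp: cycle_def)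
    define ys where "ys = pawalk_verts u p"
    define n where "n = length p"
    have cas: "pcas u p u" and sub: "set p \<subseteq> parcs G" using u(1) by (auto simp: awalk_def)
    have ys: "length ys = Suc n" "ys ! 0 = u" "ys ! n = u"
      and arc: "\<And>i. i < n \<Longrightarrow> (ys ! i, ys ! Suc i) \<in> parcs G"
      using pcas_nth[OF cas] sub nth_mem[of _ p] by (auto simp: ys_def n_def)
    have inj: "i = j" if "1 \<le> i" "i \<le> n" "1 \<le> j" "j \<le> n" "ys ! i = ys ! j" for i j
    proof -
      have "tl ys ! (i - 1) = ys ! i" "tl ys ! (j - 1) = ys ! j"
        using that ys(1) by (simp_all add: nth_tl)
      then have "i - 1 = j - 1"
        using u(2) nth_eq_iff_index_eq[of "tl ys" "i - 1" "j - 1"] that ys(1) by (simp add: ys_def)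
      then show ?thesis using that by simp
    qed
    have n3: "3 \<le> n" using l by (simp add: n_def)
    define mx where "mx = Max (set ys)"
    have ysne: "ys \<noteq> []" using ys(1) by auto
    have le: "ys ! i \<le> mx" if "i \<le> n" for i
      using that ys(1) by (simp add: mx_def)
    have "mx \<in> set ys" using ysne by (simp add: mx_def)
    then obtain i0 where "i0 \<le> n" "ys ! i0 = mx" using ys(1)
      by (auto simp: in_set_conv_nth less_Suc_eq_le)
    then have "\<exists>i. 1 \<le> i \<and> i \<le> n \<and> ys ! i = mx"
      using n3 ys(2,3) by (intro exI[of _ "if i0 = 0 then n else i0"]) auto
    then obtain i where i: "1 \<le> i" "i \<le> n" "ys ! i = mx" by blast
    \<comment> \<open>The closed walk shows its first vertex again at index n, so indices are kept
      in 1, ..., n, where they are injective: the successor of n is 1, and for \<open>k\<close>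
      below the predecessor of 1 is n.\<close>
    define j where "j = (if i = n then 1 else Suc i)"
    have "(ys ! (i - 1), ys ! i) \<in> parcs G" using arc[of "i - 1"] i by simp
    then have a1: "(ys ! i, ys ! (i - 1)) \<in> parcs G" using sym_arcs
      by (auto simp: symmetric_def dest: symD)
    have a2: "(ys ! i, ys ! j) \<in> parcs G"
      using arc[of i] arc[of 0] i n3 ys(2,3) by (auto simp: j_def)
    have jn: "1 \<le> j" "j \<le> n" using i n3 by (auto simp: j_def)
    have nb: "z = par (ys ! i)" if "(ys ! i, z) \<in> parcs G" "z \<le> mx" for z
      by (rule parent_arcs_less(1)[OF par]) (use that i in \<open>auto simp: G\<close>)
    have e: "ys ! (i - 1) = ys ! j"
      using nb[OF a1 le] nb[OF a2 le] i jn by simp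
    define k where "k = (if i = 1 then n else i - 1)"
    have "ys ! k = ys ! j" using e ys(2,3) by (auto simp: k_def)
    then have "k = j" using inj[of k j] i jn n3 by (auto simp: k_def)
    then show False using i n3 by (auto simp: k_def j_def split: if_splits)
  qed
  show ?thesis
    unfolding undirected_tree_def using pg conn acyclic by blast
qed

section \<open>Isomorphisms from vertex lists\<close>

lemma graph_isomorphicI:
  assumes "pair_graph G" "inj_on f (pverts G)" "f ` pverts G = pverts H"
    "map_prod f f ` parcs G = parcs H"
  shows "graph_isomorphic G H"
proof -
  interpret pair_graph G by (rule assms(1))
  define h where "h = \<lparr> iso_verts = f, iso_arcs = map_prod f f, iso_head = snd, iso_tail = fst \<rparr>"
  have "inj_on (map_prod f f) (parcs G)"
  proof (rule inj_onI)
    fix x y assume xy: "x \<in> parcs G" "y \<in> parcs G" "map_prod f f x = map_prod f f y"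
    then have "f (fst x) = f (fst y)" "f (snd x) = f (snd y)"
      by (auto simp: map_prod_def split_beta)
    moreover have "fst x \<in> pverts G" "fst y \<in> pverts G" "snd x \<in> pverts G" "snd y \<in> pverts G"
      using xy arc_fst_in_verts arc_snd_in_verts by auto
    ultimately show "x = y" using assms(2) by (auto simp: inj_on_def prod_eq_iff)
  qed
  then have "digraph_isomorphism h"
    unfolding digraph_isomorphism_def using assms(2) wf_digraph
      by (auto simp: h_def map_prod_def split_beta)
  moreover have "with_proj H = app_iso h (with_proj G)"
    using assms(3,4) by (simp add: app_iso_def with_proj_def h_def)
  ultimately show ?thesis unfolding graph_isomorphic_def digraph_iso_def by blast
qed

lemma graph_isomorphicE:
  assumes "graph_isomorphic G H"
  obtains f where "bij_betw f (pverts G) (pverts H)"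
    "\<And>x y. x \<in> pverts G \<Longrightarrow> y \<in> pverts G \<Longrightarrow> (f x, f y) \<in> parcs H \<longleftrightarrow> (x, y) \<in> parcs G"
proof -
  obtain h where h: "pre_digraph.digraph_isomorphism (with_proj G) h"
      "with_proj H = app_iso h (with_proj G)"
    using assms by (auto simp: graph_isomorphic_def digraph_iso_def)
  define f where "f = iso_verts h"
  have wf: "wf_digraph (with_proj G)" and inj: "inj_on f (pverts G)"
    and ends: "\<And>a. a \<in> parcs G \<Longrightarrow> f (fst a) = iso_tail h (iso_arcs h a)
        \<and> f (snd a) = iso_head h (iso_arcs h a)"
    using h(1) by (auto simp: pre_digraph.digraph_isomorphism_def f_def)
  have V: "pverts H = f ` pverts G" and A: "parcs H = iso_arcs h ` parcs G"
    and hd: "iso_tail h = fst" "iso_head h = snd"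
    using h(2) by (auto simp: app_iso_def with_proj_def f_def)
  have arcs: "iso_arcs h a = (f (fst a), f (snd a))" if "a \<in> parcs G" for a
    using ends[OF that] hd by (simp add: prod_eq_iff)
  have inV: "x \<in> pverts G \<and> y \<in> pverts G" if "(x, y) \<in> parcs G" for x y
    using wf that by (auto simp: wf_digraph_def)
  have "(f x, f y) \<in> parcs H \<longleftrightarrow> (x, y) \<in> parcs G" if xy: "x \<in> pverts G" "y \<in> pverts G" for x y
  proof
    assume "(f x, f y) \<in> parcs H"
    then obtain x' y' where "(x', y') \<in> parcs G" "f x = f x'" "f y = f y'"
      unfolding A using arcs by fastforce
    then show "(x, y) \<in> parcs G" using inj xy inV[of x' y'] by (auto simp: inj_on_def)
  next
    assume "(x, y) \<in> parcs G"
    then show "(f x, f y) \<in> parcs H" unfolding A using arcs by force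
  qed
  moreover have "bij_betw f (pverts G) (pverts H)" using inj V by (simp add: bij_betw_def)
  ultimately show thesis using that by blast
qed

lemma graph_isomorphic_poly:
  assumes "graph_isomorphic G H" "finite (pverts G)"
  shows "matching_poly (parcs H) t (pverts H) = matching_poly (parcs G) t (pverts G)"
proof -
  obtain f where "bij_betw f (pverts G) (pverts H)"
    "\<And>x y. x \<in> pverts G \<Longrightarrow> y \<in> pverts G \<Longrightarrow> (f x, f y) \<in> parcs H \<longleftrightarrow> (x, y) \<in> parcs G"
    using graph_isomorphicE[OF assms(1)] by blast
  then show ?thesis by (rule matching_poly_iso[OF _ assms(2)])
qed

lemma list_edges_map: "list_edges (map f xs) = map_prod f f ` list_edges xs"
  by (induction xs rule: list_edges.induct) auto

lemma map_between_lists: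
  assumes "distinct xs" "distinct ys" "length xs = length ys"
  obtains f where "map f xs = ys" "inj_on f (set xs)"
proof -
  define f where "f x = the (map_of (zip xs ys) x)" for x
  have "map f xs = ys"
    using assms(1,3) by (intro nth_equalityI) (auto simp: f_def map_of_zip_nth)
  moreover from this have "inj_on f (set xs)"
    using assms(1,2) distinct_map[of f xs] by auto
  ultimately show thesis using that by blast
qed

lemma parcs_restrict: "pair_graph G \<Longrightarrow> parcs G \<inter> pverts G \<times> pverts G = parcs G"
proof -
  assume "pair_graph G"
  then interpret pair_graph G .
  show ?thesis using in_arcsD1 in_arcsD2 by auto
qed

lemma list_path_isomorphic:
  assumes "pair_graph G" "pair_graph H" "list_path (parcs G) (pverts G) xs"
      "list_path (parcs H) (pverts H) ys"
    "length xs = length ys"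
  shows "graph_isomorphic G H"
proof -
  obtain f where f: "map f xs = ys" "inj_on f (set xs)"
    using map_between_lists[of xs ys] assms by (auto simp: list_path_def)
  show ?thesis
    by (rule graph_isomorphicI[OF assms(1), of f])
       (use f assms(3,4) parcs_restrict[OF assms(1)] parcs_restrict[OF assms(2)] in
         \<open>auto simp: list_path_def simp flip: list_edges_map\<close>)
qed

lemma list_spider_isomorphic:
  assumes "pair_graph G" "pair_graph H"
    and G: "list_spider (parcs G) (pverts G) c A B C"
        and H: "list_spider (parcs H) (pverts H) c' A' B' C'"
    and len: "length A = length A'" "length B = length B'" "length C = length C'"
  shows "graph_isomorphic G H"
proof -
  have g: "distinct (c # A @ B @ C)" "set (c # A @ B @ C) = pverts G"
    "parcs G = list_edges (A @ [c]) \<union> list_edges (B @ [c]) \<union> list_edges (C @ [c])"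
    using G parcs_restrict[OF assms(1)] by (simp_all add: list_spider_def)
  have h: "distinct (c' # A' @ B' @ C')" "set (c' # A' @ B' @ C') = pverts H"
    "parcs H = list_edges (A' @ [c']) \<union> list_edges (B' @ [c']) \<union> list_edges (C' @ [c'])"
    using H parcs_restrict[OF assms(2)] by (simp_all add: list_spider_def)
  obtain f where f: "map f (c # A @ B @ C) = c' # A' @ B' @ C'" "inj_on f (set (c # A @ B @ C))"
    by (rule map_between_lists[OF g(1) h(1)]) (use len in auto)
  have m: "f c = c'" "map f A = A'" "map f B = B'" "map f C = C'"
    using f(1) len by (simp_all add: append_eq_append_conv)
  show ?thesis
  proof (rule graph_isomorphicI[OF assms(1), of f])
    show "inj_on f (pverts G)" using f(2) by (simp only: g(2))
    show "f ` pverts G = pverts H" using arg_cong[OF f(1), of set] g(2) h(2) by (metis set_map)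
    have e: "list_edges (X @ [c']) = map_prod f f ` list_edges (Y @ [c])" if "map f Y = X" for X Y
      using list_edges_map[of f "Y @ [c]"] that m(1) by simp
    show "map_prod f f ` parcs G = parcs H"
      by (simp only: g(3) h(3) image_Un e[OF m(2)] e[OF m(3)] e[OF m(4)])
  qed
qed

section \<open>Vertex lists of the concrete graphs\<close>

text \<open>The labels of a leg ascend from the neighbour of the centre 0 to the tip; reversal gives
  the order that \<open>list_spider\<close> expects.\<close>

lemma list_edges_leg_parent:
  fixes par :: "nat \<Rightarrow> nat"
  assumes "1 \<le> k" "par s = 0" "\<And>v. s < v \<Longrightarrow> v < s + k \<Longrightarrow> par v = v - 1"
  shows "list_edges (rev [s..<s + k] @ [0]) = (\<lambda>v. (v, par v)) ` {s..<s + k}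
      \<union> (\<lambda>v. (par v, v)) ` {s..<s + k}"
  using assms(1,3)
proof (induction k rule: dec_induct)
  case base
  have "{s..<s + 1} = {s}" by auto
  then show ?case using assms(2) by (simp add: list_edges_Cons insert_commute)
next
  case (step k)
  have p: "par (s + k) = s + k - 1" using step by simp
  have "rev [s..<s + Suc k] @ [0] = (s + k) # rev [s..<s + k] @ [0]" by simp
  moreover have "hd (rev [s..<s + k] @ [0]) = s + k - 1"
    using step(1) by (cases k) auto
  ultimately have 1: "list_edges (rev [s..<s + Suc k] @ [0])
      = {(s + k, s + k - 1), (s + k - 1, s + k)} \<union> list_edges (rev [s..<s + k] @ [0])"
    by (simp add: list_edges_Cons)
  have 2: "{s..<s + Suc k} = insert (s + k) {s..<s + k}" by auto
  have 3: "list_edges (rev [s..<s + k] @ [0])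
      = (\<lambda>v. (v, par v)) ` {s..<s + k} \<union> (\<lambda>v. (par v, v)) ` {s..<s + k}"
    by (rule step.IH) (use step.prems in auto)
  show ?case unfolding 1 2 3 image_insert p by blast
qed

lemma path_starts_3: "path_starts [a, b, c] = {1, a + 1, a + b + 1}"
proof -
  have "path_starts [a, b, c] = (\<lambda>i. Suc (sum_list (take i [a, b, c]))) ` {i. i < 3}"
    by (simp add: path_starts_def setcompr_eq_image numeral_3_eq_3)
  also have "{i. i < (3::nat)} = {0, 1, 2}" by auto
  finally show ?thesis by (simp add: numeral_2_eq_2)
qed

lemma pendent_tree_parent_arcs:
  "pendent_paths_tree as = \<lparr> pverts = {0..sum_list as}, parcs
      = parent_arcs (pendent_parent as) (sum_list as) \<rparr>"
  by (simp add: pendent_paths_tree_def parent_arcs_def)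

lemma pendent_tree_undirected: "undirected_tree (pendent_paths_tree as)"
  by (rule parent_tree_undirected[OF _ pendent_tree_parent_arcs]) (auto simp: pendent_parent_def)

lemma path_graph_parent_arcs:
  assumes "1 \<le> n"
  shows "path_graph n = \<lparr> pverts = {0..n - 1}, parcs = parent_arcs (\<lambda>v. v - 1) (n - 1) \<rparr>"
proof -
  have "(u < n \<and> v < n \<and> (v = Suc u \<or> u = Suc v)) \<longleftrightarrow> (u, v) \<in> parent_arcs (\<lambda>v. v - 1) (n - 1)"
      for u v
    using assms unfolding parent_arcs_def by (cases u; cases v) auto
  then show ?thesis using assms by (auto simp: path_graph_def)
qed

lemma path_graph_undirected: "1 \<le> n \<Longrightarrow> undirected_tree (path_graph n)"
  by (rule parent_tree_undirected[OF _ path_graph_parent_arcs]) auto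

lemma list_edges_upt: "list_edges [0..<n] = {(u, v). u < n \<and> v < n \<and> (v = Suc u \<or> u = Suc v)}"
proof (induction n)
  case (Suc n)
  show ?case
  proof (cases "n = 0")
    case False
    then have "list_edges [0..<Suc n] = list_edges [0..<n] \<union> {(n - 1, n), (n, n - 1)}"
      by (simp add: list_edges_append)
    also have "\<dots> = {(u, v). u < Suc n \<and> v < Suc n \<and> (v = Suc u \<or> u = Suc v)}"
      unfolding Suc using False by (auto simp: less_Suc_eq)
    finally show ?thesis .
  qed auto
qed simp

lemma path_graph_list_path: "list_path (parcs (path_graph n)) (pverts (path_graph n)) [0..<n]"
  unfolding list_path_def list_edges_upt by (auto simp: path_graph_def)

lemma pendent_tree_list_spider:
  assumes "1 \<le> a" "1 \<le> b" "1 \<le> c"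
  defines "G \<equiv> pendent_paths_tree [a, b, c]"
  shows "list_spider (parcs G) (pverts G) 0
    (rev [1..<1 + a]) (rev [a + 1..<a + 1 + b]) (rev [a + b + 1..<a + b + 1 + c])"
proof -
  let ?m = "a + b + c"
  have V: "pverts G = {0..?m}" by (simp add: G_def pendent_paths_tree_def add.assoc)
  have par: "pendent_parent [a, b, c] v = (if v \<in> {1, a + 1, a + b + 1} then 0 else v - 1)" for v
    by (simp add: pendent_parent_def path_starts_3)
  let ?p = "pendent_parent [a, b, c]"
  let ?S = "\<lambda>I. (\<lambda>v. (v, ?p v)) ` I \<union> (\<lambda>v. (?p v, v)) ` I"
  have P: "parcs G = ?S {1..?m}"
    unfolding G_def pendent_paths_tree_def
    by (simp only: pair_pre_digraph.simps setcompr_eq_image Collect_mem_eq) (simp add: add.assoc)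
  have 1: "list_edges (rev [1..<1 + a] @ [0]) = ?S {1..<1 + a}"
    by (rule list_edges_leg_parent[OF assms(1)]) (use assms(1-3) in \<open>auto simp: par\<close>)
  have 2: "list_edges (rev [a + 1..<a + 1 + b] @ [0]) = ?S {a + 1..<a + 1 + b}"
    by (rule list_edges_leg_parent[OF assms(2)]) (use assms(1-3) in \<open>auto simp: par\<close>)
  have 3: "list_edges (rev [a + b + 1..<a + b + 1 + c] @ [0]) = ?S {a + b + 1..<a + b + 1 + c}"
    by (rule list_edges_leg_parent[OF assms(3)]) (use assms(1-3) in \<open>auto simp: par\<close>)
  have "{1..?m} = {1..<1 + a} \<union> {a + 1..<a + 1 + b} \<union> {a + b + 1..<a + b + 1 + c}" by auto
  note I = this
  have edges: "parcs G = list_edges (rev [1..<1 + a] @ [0])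
      \<union> list_edges (rev [a + 1..<a + 1 + b] @ [0]) \<union>
      list_edges (rev [a + b + 1..<a + b + 1 + c] @ [0])"
    unfolding P 1 2 3 I image_Un by blast
  have "parcs G \<subseteq> pverts G \<times> pverts G"
    unfolding P V by (auto simp: pendent_parent_def)
  then show ?thesis
    unfolding list_spider_def
  proof (intro conjI)
    show "parcs G \<inter> pverts G \<times> pverts G = list_edges (rev [1..<1 + a] @ [0])
        \<union> list_edges (rev [a + 1..<a + 1 + b] @ [0]) \<union>
      list_edges (rev [a + b + 1..<a + b + 1 + c] @ [0])"
      using edges \<open>parcs G \<subseteq> pverts G \<times> pverts G\<close> by blast
  qed (use assms(1-3) V in auto)
qed

section \<open>Ordering by energy\<close>

lemma spider_poly_swap12: "spider_poly t a b c = spider_poly t b a c"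
  by (simp add: spider_poly_def algebra_simps)

lemma spider_poly_swap13: "spider_poly t a b c = spider_poly t c b a"
  by (simp add: spider_poly_def algebra_simps)

lemma spider_poly_2: "spider_poly t 2 a b = path_poly t (a + b + 3)
    - t\<^sup>2 * (path_poly t (a - 1) * path_poly t (b - 1))"
  by (simp add: spider_poly_def eval_nat_numeral add.commute)

lemma path_poly_mult_ge:
  assumes "0 \<le> t" "1 \<le> i + j"
  shows "path_poly t (i + j - 1) \<le> path_poly t i * path_poly t j"
proof (cases "i = 0 \<or> j = 0")
  case True
  obtain k where "i + j = Suc k" using assms(2) by (cases "i + j") auto
  then show ?thesis using True path_poly_Suc_ge[OF assms(1), of k] by auto
next
  case False
  then show ?thesis using path_poly_mult_ge_odd[OF assms(1), of 1 i j] by simp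
qed

text \<open>The index k = a - 1 is even and below 6, so p_k p_{n-5-k} exceeds p_6 p_{n-11};
  splitting the second factor into p_{b-1} p_{c-1} can only raise the product.\<close>

lemma spider_poly_short_odd_less:
  assumes t: "0 < t" and a: "a \<in> {1, 3, 5}" and "1 \<le> b" "1 \<le> c" "a + b + c + 1 = n" "31 \<le> n"
  shows "spider_poly t a b c < cutoff_poly t n"
proof -
  define k where "k = a - 1"
  have k: "even k" "k < 6" "a = k + 1" using a by (auto simp: k_def)
  have "path_poly t 6 * path_poly t (n - 11) < path_poly t k * path_poly t (6 + (n - 11) - k)"
    by (rule path_poly_mult_less_even[OF t k(1,2)]) (use k assms(6) in auto)
  also have "6 + (n - 11) - k = (b - 1) + (c - 1) - 1"
    using k assms by auto
  also have "path_poly t k * path_poly t ((b - 1) + (c - 1) - 1)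
      \<le> path_poly t k * (path_poly t (b - 1) * path_poly t (c - 1))"
    by (intro mult_left_mono path_poly_mult_ge) (use t k assms path_poly_nonneg[of t k] in auto)
  finally have "t\<^sup>2 * (path_poly t 6 * path_poly t (n - 11))
      < t\<^sup>2 * (path_poly t k * (path_poly t (b - 1) * path_poly t (c - 1)))"
    using t by simp
  then show ?thesis
    unfolding spider_poly_def cutoff_poly_def assms(5) k_def[symmetric] by (simp add: mult.assoc)
qed

text \<open>The odd index 3 minimises a product whose indices are at least 3. Used for two legs and
  then for the third, it leads to the legs 4, 4, n - 9.\<close>

lemma spider_poly_long_le:
  assumes t: "0 \<le> t" and "4 \<le> a" "4 \<le> b" "4 \<le> c" "a + b + c + 1 = n"
  shows "spider_poly t a b c \<le> long_leg_poly t n"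
proof -
  have "(path_poly t 3)\<^sup>2 * path_poly t (n - 10)
      = path_poly t 3 * (path_poly t 3 * path_poly t ((a - 1 + (b - 1) - 3) + (c - 1) - 3))"
  proof -
    have "n - 10 = (a - 1 + (b - 1) - 3) + (c - 1) - 3" using assms by auto
    then show ?thesis by (simp add: power2_eq_square)
  qed
  also have "\<dots> \<le> path_poly t 3 * (path_poly t (a - 1 + (b - 1) - 3) * path_poly t (c - 1))"
    by (intro mult_left_mono path_poly_mult_ge_odd[OF t] path_poly_nonneg[OF t]) (use assms in auto)
  also have "\<dots> = (path_poly t 3 * path_poly t (a - 1 + (b - 1) - 3)) * path_poly t (c - 1)" by simp
  also have "\<dots> \<le> (path_poly t (a - 1) * path_poly t (b - 1)) * path_poly t (c - 1)"
    by (intro mult_right_mono path_poly_mult_ge_odd[OF t] path_poly_nonneg[OF t])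
        (use assms in auto)
  finally have "t\<^sup>2 * ((path_poly t 3)\<^sup>2 * path_poly t (n - 10))
      \<le> t\<^sup>2 * (path_poly t (a - 1) * path_poly t (b - 1) * path_poly t (c - 1))"
    by (intro mult_left_mono) auto
  then show ?thesis unfolding spider_poly_def long_leg_poly_def assms(5) by simp
qed

text \<open>The leg a enters with index a - 1. The odd indices 1, 3, 5 give smaller products than
  the index 6; beyond 6 the even index 6 gives the larger product.\<close>

lemma cutoff_poly_le_spider_poly_2:
  assumes t: "0 \<le> t" and ab: "1 \<le> a" "a \<le> b" "a + b + 3 = n" "a \<notin> {1, 3, 5}" and n: "31 \<le> n"
  shows "cutoff_poly t n \<le> spider_poly t 2 a b"
proof -
  have "path_poly t (a - 1) * path_poly t (b - 1) \<le> path_poly t 6 * path_poly t (n - 11)"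
  proof (cases "a \<in> {2, 4, 6}")
    case True
    have "path_poly t (a - 1) * path_poly t (6 + (n - 11) - (a - 1))
        \<le> path_poly t 6 * path_poly t (n - 11)"
      by (rule path_poly_mult_ge_odd[OF t]) (use True n in auto)
    moreover have "6 + (n - 11) - (a - 1) = b - 1" using ab n by auto
    ultimately show ?thesis by simp
  next
    case False
    then have a7: "7 \<le> a" using ab(1,4) by auto
    show ?thesis
    proof (cases "a = 7")
      case True
      then have "b - 1 = n - 11" using ab n by auto
      then show ?thesis using True by simp
    next
      case False
      show ?thesis
      proof (cases "t = 0")
        case True
        have "path_poly 0 m = 1" for m by (induction "0::real" m rule: path_poly.induct) auto
        then show ?thesis using True by simp
      next
        case t0: False
        have "path_poly t (a - 1) * path_poly t (b - 1)
            < path_poly t 6 * path_poly t (a - 1 + (b - 1) - 6)"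
          by (rule path_poly_mult_less_even) (use t t0 False a7 ab in auto)
        moreover have "a - 1 + (b - 1) - 6 = n - 11" using ab a7 by auto
        ultimately show ?thesis by simp
      qed
    qed
  qed
  then have "t\<^sup>2 * (path_poly t (a - 1) * path_poly t (b - 1))
      \<le> t\<^sup>2 * (path_poly t 6 * path_poly t (n - 11))"
    by (intro mult_left_mono) auto
  then show ?thesis unfolding cutoff_poly_def spider_poly_2 ab(3) by simp
qed

text \<open>At t = 1 the right-hand side of \<open>path_poly_docagne'\<close> is, up to sign, a
  product of two Fibonacci numbers and so is nonzero: different a give different numbers of
  matchings.\<close>

lemma spider_poly_2_inj:
  assumes "spider_poly 1 2 a b = spider_poly 1 2 a' b'" "1 \<le> a" "1 \<le> a'" "a \<le> b" "a' \<le> b'"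
      "a + b = a' + b'"
  shows "a = a'"
proof -
  have ne: "spider_poly 1 2 a b \<noteq> spider_poly 1 2 a' b'"
    if "1 \<le> a" "a < a'" "a' \<le> b'" "a + b = a' + b'" for a b a' b'
  proof -
    have "path_poly 1 (a' - 1) * path_poly 1 (b' - 1)
        - path_poly 1 (a - 1) * path_poly 1 ((a' - 1) + (b' - 1) - (a - 1))
        = (- 1) ^ Suc (a - 1) * path_poly 1 (a' - 1 - Suc (a - 1)) * path_poly 1
            (b' - 1 - Suc (a - 1))"
      by (rule path_poly_docagne') (use that in auto)
    moreover have "(a' - 1) + (b' - 1) - (a - 1) = b - 1" using that by auto
    moreover have "path_poly 1 m \<noteq> 0" for m using path_poly_pos[of 1 m] by simp
    ultimately have "path_poly 1 (a' - 1) * path_poly 1 (b' - 1)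
        \<noteq> path_poly 1 (a - 1) * path_poly 1 (b - 1)" by auto
    then show ?thesis using that(4) by (simp add: spider_poly_2)
  qed
  show ?thesis
    using ne[of a a' b' b] ne[of a' a b b'] assms by (metis linorder_neqE_nat)
qed

section \<open>From matching polynomials to energies\<close>

abbreviation graph_poly :: "'a pair_pre_digraph \<Rightarrow> real \<Rightarrow> real" where
  "graph_poly G t \<equiv> matching_poly (parcs G) t (pverts G)"

lemma tree_graph_poly_ge_1:
  assumes "undirected_tree G" "0 \<le> t"
  shows "1 \<le> graph_poly G t"
proof -
  obtain d r where "\<And>t. 0 \<le> t \<Longrightarrow> depth_forest (parcs G) d (pverts G) t"
    using undirected_tree_rooted_at_leaf[OF assms(1)] by metis
  then interpret depth_forest "parcs G" d "pverts G" t using assms(2) by blast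
  show ?thesis by (rule M_ge_1) simp
qed

lemma tree_energy_integral:
  assumes T: "undirected_tree G"
  shows "set_integrable lborel {0<..} (\<lambda>y. ln (graph_poly G (1 / y\<^sup>2)))"
    "(LBINT y:{0<..}. ln (graph_poly G (1 / y\<^sup>2))) = pi / 2 * energy G"
proof -
  interpret G: pair_graph G using T by (simp add: undirected_tree_def)
  obtain d r where F: "\<And>t. 0 \<le> t \<Longrightarrow> depth_forest (parcs G) d (pverts G) t"
    using undirected_tree_rooted_at_leaf[OF T] by metis
  have real: "matching_det (parcs G) t (pverts G) = of_real (graph_poly G t)" if "0 < t" for t
  proof -
    interpret depth_forest "parcs G" d "pverts G" t using F that by simp
    show ?thesis by (rule M_real) simp
  qed
  have pos: "0 < graph_poly G t" if "0 < t" for t using tree_graph_poly_ge_1[OF T, of t] that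
    by simp
  have sym: "sym (parcs G)" using G.sym_arcs by (simp add: symmetric_def)
  have nl: "(x, x) \<notin> parcs G" for x using G.pair_no_loops by fastforce
  show "set_integrable lborel {0<..} (\<lambda>y. ln (graph_poly G (1 / y\<^sup>2)))"
    "(LBINT y:{0<..}. ln (graph_poly G (1 / y\<^sup>2))) = pi / 2 * energy G"
    using energy_log_integral[OF sym G.pair_finite_verts nl real pos] by auto
qed

lemma energy_less_iff:
  assumes "undirected_tree G" "undirected_tree H"
  defines "g \<equiv> \<lambda>y. ln (graph_poly H (1 / y\<^sup>2)) - ln (graph_poly G (1 / y\<^sup>2))"
  shows "set_integrable lborel {0<..} g" "energy G < energy H \<longleftrightarrow> 0 < (LBINT y:{0<..}. g y)"
proof -
  note I = tree_energy_integral[OF assms(1)] tree_energy_integral[OF assms(2)]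
  show "set_integrable lborel {0<..} g" unfolding g_def by (rule set_integral_diff(1)[OF I(3,1)])
  have "(LBINT y:{0<..}. g y) = pi / 2 * energy H - pi / 2 * energy G"
    unfolding g_def set_integral_diff(2)[OF I(3,1)] I(2,4) ..
  also have "\<dots> = pi / 2 * (energy H - energy G)" by (simp add: right_diff_distrib)
  finally have e: "(LBINT y:{0<..}. g y) = pi / 2 * (energy H - energy G)" .
  show "energy G < energy H \<longleftrightarrow> 0 < (LBINT y:{0<..}. g y)"
    unfolding e using pi_gt_zero by (simp add: zero_less_mult_iff)
qed

lemma set_integral_pos:
  fixes g :: "real \<Rightarrow> real"
  assumes int: "set_integrable lborel {0<..} g" and pos: "\<And>y. 0 < y \<Longrightarrow> 0 < g y"
  shows "0 < (LBINT y:{0<..}. g y)"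
proof -
  let ?f = "\<lambda>y. indicat_real {0<..} y *\<^sub>R g y"
  have f: "integrable lborel ?f" using int by (simp add: set_integrable_def)
  have f0: "0 \<le> ?f y" for y using pos[of y] by (auto simp: indicator_def)
  have "(LBINT y. ?f y) \<noteq> 0"
  proof
    assume "(LBINT y. ?f y) = 0"
    then have "AE y in lborel. ?f y = 0"
      using integral_nonneg_eq_0_iff_AE[OF f] f0 by simp
    then have "AE y in lborel. y \<notin> {0<..1::real}"
      by (rule AE_mp) (use pos in \<open>fastforce intro!: AE_I2\<close>)
    moreover have "{y \<in> space lborel. \<not> y \<notin> {0<..1::real}} = {0<..1}" by auto
    ultimately have "emeasure lborel {0<..1::real} = 0"
      using AE_iff_measurable[of "{0<..1::real}" lborel "\<lambda>y. y \<notin> {0<..1}"] by simp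
    then show False by simp
  qed
  moreover have "0 \<le> (LBINT y. ?f y)" using f0 by (intro Bochner_Integration.integral_nonneg) simp
  ultimately show ?thesis by (simp add: set_lebesgue_integral_def)
qed

lemma energy_less_pointwise:
  assumes "undirected_tree G" "undirected_tree H" "\<And>t. 0 < t \<Longrightarrow> graph_poly G t < graph_poly H t"
  shows "energy G < energy H"
  unfolding energy_less_iff(2)[OF assms(1,2)]
proof (rule set_integral_pos[OF energy_less_iff(1)[OF assms(1,2)]])
  fix y :: real assume "0 < y"
  then have "0 < 1 / y\<^sup>2" by simp
  then show "0 < ln (graph_poly H (1 / y\<^sup>2)) - ln (graph_poly G (1 / y\<^sup>2))"
    using assms(3) tree_graph_poly_ge_1[OF assms(1)] tree_graph_poly_ge_1[OF assms(2)]
    by (smt (verit) ln_less_cancel_iff)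
qed

lemma tree_trichotomy:
  assumes T: "undirected_tree G"
  shows "is_path (parcs G) (pverts G) \<or> is_spider (parcs G) (pverts G)
     \<or> (\<forall>t\<ge>0. graph_poly G t \<le> nonspider_bound t (card (pverts G)))"
proof -
  obtain d r where F: "\<And>t. 0 \<le> t \<Longrightarrow> depth_forest (parcs G) d (pverts G) t"
    and R: "depth_forest.tree (parcs G) d (pverts G) r (pverts G)"
    using undirected_tree_rooted_at_leaf[OF T] by metis
  have "graph_poly G t \<le> nonspider_bound t (card (pverts G))"
    if "0 \<le> t" "\<not> is_path (parcs G) (pverts G)" "\<not> is_spider (parcs G) (pverts G)" for t
  proof -
    interpret depth_forest "parcs G" d "pverts G" t using F that(1) .
    show ?thesis using M_le_nonspider_bound[OF R that(2,3)] by simp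
  qed
  then show ?thesis by blast
qed

lemma tree_list_spider_graph_poly:
  assumes T: "undirected_tree G" and S: "list_spider (parcs G) (pverts G) c A B C"
  shows "0 \<le> t \<Longrightarrow> graph_poly G t = spider_poly t (length A) (length B) (length C)"
    "card (pverts G) = length A + length B + length C + 1"
proof -
  obtain d r where F: "\<And>t. 0 \<le> t \<Longrightarrow> depth_forest (parcs G) d (pverts G) t"
    using undirected_tree_rooted_at_leaf[OF T] by metis
  show "graph_poly G t = spider_poly t (length A) (length B) (length C)" if "0 \<le> t"
  proof -
    interpret depth_forest "parcs G" d "pverts G" t using F that .
    show ?thesis by (rule M_list_spider(1)[OF order_refl S])
  qed
  interpret depth_forest "parcs G" d "pverts G" 0 by (rule F) simp
  show "card (pverts G) = length A + length B + length C + 1"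
    by (rule M_list_spider(2)[OF order_refl S])
qed

lemma graph_poly_path_graph:
  assumes "1 \<le> n" "0 \<le> t"
  shows "graph_poly (path_graph n) t = path_poly t n"
proof -
  obtain d r where F: "\<And>t. 0 \<le> t \<Longrightarrow> depth_forest (parcs (path_graph n)) d (pverts (path_graph n)) t"
    using undirected_tree_rooted_at_leaf[OF path_graph_undirected[OF assms(1)]] by metis
  interpret depth_forest "parcs (path_graph n)" d "pverts (path_graph n)" t using F assms(2) .
  show ?thesis using M_list_path[OF order_refl path_graph_list_path] by simp
qed

lemma graph_poly_pendent_tree:
  assumes "1 \<le> a" "1 \<le> b" "1 \<le> c" "0 \<le> t"
  shows "graph_poly (pendent_paths_tree [a, b, c]) t = spider_poly t a b c"
  using tree_list_spider_graph_poly(1)[OF pendent_tree_undirected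
      pendent_tree_list_spider[OF assms(1-3)] assms(4)]
  by (simp only: length_rev length_upt add_diff_cancel_left')

section \<open>The family of large trees\<close>

lemma S_trees_image: "S_trees n = (\<lambda>a. pendent_paths_tree [2, a, n - 3 - a]) ` {1..(n - 3) div 2}"
proof -
  have "a + b = n - 3 \<and> 1 \<le> a \<and> a \<le> b \<longleftrightarrow> a \<in> {1..(n - 3) div 2} \<and> b = n - 3 - a" for a b
    by auto
  then show ?thesis unfolding S_trees_def by auto
qed

lemma pendent_2_inj:
  assumes "pendent_paths_tree [2, a, n - 3 - a] = pendent_paths_tree [2, b, n - 3 - b]"
    "a \<in> {1..(n - 3) div 2}" "b \<in> {1..(n - 3) div 2}"
  shows "a = b"
proof (rule spider_poly_2_inj)
  show "spider_poly 1 2 a (n - 3 - a) = spider_poly 1 2 b (n - 3 - b)"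
    using graph_poly_pendent_tree[of 2 a "n - 3 - a" 1]
        graph_poly_pendent_tree[of 2 b "n - 3 - b" 1] assms by auto
qed (use assms in auto)

lemma S_trees'_image:
  assumes "31 \<le> n"
  shows "S_trees' n = (\<lambda>a. pendent_paths_tree [2, a, n - 3 - a]) ` ({1..(n - 3) div 2} - {1, 3, 5})"
proof -
  let ?h = "\<lambda>a. pendent_paths_tree [2, a, n - 3 - a]"
  have inj: "inj_on ?h {1..(n - 3) div 2}" using pendent_2_inj by (auto intro!: inj_onI)
  have h: "{pendent_paths_tree [2, 5, n - 8], pendent_paths_tree [2, 3, n - 6],
      pendent_paths_tree [2, 1, n - 4]}
     = ?h ` {1, 3, 5}"
    by (auto simp: insert_commute)
  have "{1, 3, 5} \<subseteq> {1..(n - 3) div 2}" using assms by auto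
  then show ?thesis
    unfolding S_trees'_def S_trees_image h using
        inj_on_image_set_diff[OF inj, of "{1..(n - 3) div 2}" "{1, 3, 5}"]
    by simp
qed

lemma mem_S_trees':
  assumes "31 \<le> n" "G \<in> S_trees' n"
  obtains a b where "G = pendent_paths_tree [2, a, b]" "1 \<le> a" "a \<le> b" "a + b + 3 = n"
      "a \<notin> {1, 3, 5}"
proof -
  obtain a where a: "G = pendent_paths_tree [2, a, n - 3 - a]" "a \<in> {1..(n - 3) div 2}"
      "a \<notin> {1, 3, 5}"
    using assms(2) unfolding S_trees'_image[OF assms(1)] by blast
  show thesis by (rule that[OF a(1)]) (use a assms(1) in auto)
qed

lemma S_trees'_memI:
  assumes "31 \<le> n" "1 \<le> a" "a \<le> b" "a + b + 3 = n" "a \<notin> {1, 3, 5}"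
  shows "pendent_paths_tree [2, a, b] \<in> S_trees' n"
proof -
  have "b = n - 3 - a" "a \<in> {1..(n - 3) div 2} - {1, 3, 5}" using assms by auto
  then show ?thesis unfolding S_trees'_image[OF assms(1)] by blast
qed

lemma card_S_trees':
  assumes "31 \<le> n"
  shows "card (S_trees' n) = (n - 9) div 2"
proof -
  have "inj_on (\<lambda>a. pendent_paths_tree [2, a, n - 3 - a]) ({1..(n - 3) div 2} - {1, 3, 5})"
    using pendent_2_inj by (auto intro!: inj_onI)
  then have "card (S_trees' n) = card ({1..(n - 3) div 2} - {1, 3, 5})"
    unfolding S_trees'_image[OF assms] by (rule card_image)
  also have "\<dots> = (n - 3) div 2 - 3"
    using assms by (subst card_Diff_subset) auto
  also have "\<dots> = (n - 9) div 2" using assms by linarith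
  finally show ?thesis .
qed

lemma cutoff_poly_le_large_tree:
  assumes n: "31 \<le> n" and G: "G \<in> insert (path_graph n) (S_trees' n)" and t: "0 \<le> t"
  shows "cutoff_poly t n \<le> graph_poly G t"
proof (cases "G = path_graph n")
  case True
  have "0 \<le> t\<^sup>2 * (path_poly t 6 * path_poly t (n - 11))" using path_poly_nonneg[OF t] by simp
  then show ?thesis using True graph_poly_path_graph[of n t] n t by (simp add: cutoff_poly_def)
next
  case False
  then obtain a b where "G = pendent_paths_tree [2, a, b]" "1 \<le> a" "a \<le> b" "a + b + 3 = n"
      "a \<notin> {1, 3, 5}"
    using mem_S_trees'[OF n] G by blast
  then show ?thesis using cutoff_poly_le_spider_poly_2[OF t _ _ _ _ n]
      graph_poly_pendent_tree[of 2 a b t] t by simp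
qed

text \<open>As the polynomial of an actual tree it inherits the bound that holds for all
  trees.\<close>

lemma cutoff_poly_ge_1:
  assumes "31 \<le> n" "0 \<le> t"
  shows "1 \<le> cutoff_poly t n"
proof -
  have "n - 10 + 10 = n" using assms by simp
  then have "graph_poly (pendent_paths_tree [2, 7, n - 10]) t = cutoff_poly t n"
    using graph_poly_pendent_tree[of 2 7 "n - 10" t] assms
      by (simp add: spider_poly_2 cutoff_poly_def)
  then show ?thesis using tree_graph_poly_ge_1[OF pendent_tree_undirected assms(2), of
      "[2, 7, n - 10]"] by simp
qed

lemma large_tree_undirected:
  assumes "31 \<le> n" "G \<in> insert (path_graph n) (S_trees' n)"
  shows "undirected_tree G \<and> card (pverts G) = n"
proof (cases "G = path_graph n")
  case True
  then show ?thesis using path_graph_undirected[of n] assms(1) by (simp add: path_graph_def)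
next
  case False
  then obtain a b where "G = pendent_paths_tree [2, a, b]" "a + b + 3 = n"
    using mem_S_trees'[OF assms(1)] assms(2) by blast
  then have "undirected_tree G" "pverts G = {0..a + b + 2}"
    by (simp_all add: pendent_tree_undirected) (simp add: pendent_paths_tree_def)
  then show ?thesis using \<open>a + b + 3 = n\<close> by simp
qed

text \<open>At t = 1 the polynomial counts all matchings, an isomorphism invariant that takes
  different values on different members.\<close>

lemma large_trees_not_isomorphic:
  assumes n: "31 \<le> n" and G: "G \<in> insert (path_graph n) (S_trees' n)"
    and H: "H \<in> insert (path_graph n) (S_trees' n)" and iso: "graph_isomorphic G H"
  shows "G = H"
proof -
  have fin: "finite (pverts G)"
    using large_tree_undirected[OF n G] n card_ge_0_finite[of "pverts G"] by simp
  have eq: "graph_poly H 1 = graph_poly G 1" by (rule graph_isomorphic_poly[OF iso fin])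
  have pth: "graph_poly (path_graph n) 1 = path_poly 1 n" using n
    by (intro graph_poly_path_graph) auto
  have less: "graph_poly K 1 < path_poly 1 n" if KS: "K \<in> S_trees' n" for K
  proof -
    obtain a b where K: "K = pendent_paths_tree [2, a, b]" "1 \<le> a" "a \<le> b" "a + b + 3 = n"
      using mem_S_trees'[OF n KS] by metis
    have "0 < path_poly 1 (a - 1) * path_poly 1 (b - 1)" using path_poly_pos[of 1] by simp
    then show ?thesis using K graph_poly_pendent_tree[of 2 a b 1] by (simp add: spider_poly_2)
  qed
  show ?thesis
  proof (cases "G = path_graph n \<or> H = path_graph n")
    case True
    then show ?thesis using G H eq pth less by fastforce
  next
    case False
    then have "G \<in> S_trees' n" "H \<in> S_trees' n" using G H by auto
    from mem_S_trees'[OF n this(1)] obtain a b where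
      G: "G = pendent_paths_tree [2, a, b]" "1 \<le> a" "a \<le> b" "a + b + 3 = n" by metis
    from mem_S_trees'[OF n \<open>H \<in> S_trees' n\<close>] obtain a' b' where
      H: "H = pendent_paths_tree [2, a', b']" "1 \<le> a'" "a' \<le> b'" "a' + b' + 3 = n" by metis
    have "spider_poly 1 2 a b = spider_poly 1 2 a' b'"
      using eq graph_poly_pendent_tree[of 2 a b 1] graph_poly_pendent_tree[of 2 a' b' 1] G H by simp
    then have "a = a'" by (rule spider_poly_2_inj) (use G H in auto)
    moreover from this have "b = b'" using G(4) H(4) by simp
    ultimately show ?thesis using G(1) H(1) by simp
  qed
qed

lemma spider_isomorphic_pendent:
  assumes T: "undirected_tree G" and S: "list_spider (parcs G) (pverts G) c A B C"
  shows "graph_isomorphic G (pendent_paths_tree [length A, length B, length C])"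
proof -
  have "1 \<le> length A" "1 \<le> length B" "1 \<le> length C"
    using S by (auto simp: list_spider_def Suc_le_eq)
  note P = pendent_tree_list_spider[OF this]
  have "pair_graph G" "pair_graph (pendent_paths_tree [length A, length B, length C])"
    using T pendent_tree_undirected unfolding undirected_tree_def by blast+
  then show ?thesis
    by (rule list_spider_isomorphic[OF _ _ S P])
       (simp_all only: length_rev length_upt add_diff_cancel_left')
qed

text \<open>A spider with a leg of length 2 outside the family has a leg of length 1, 3 or 5.\<close>

lemma spider_leg_2:
  assumes n: "31 \<le> n" and T: "undirected_tree G" "card (pverts G) = n"
    and S: "list_spider (parcs G) (pverts G) c A B C" and A: "length A = 2"
    and no: "\<forall>H\<in>insert (path_graph n) (S_trees' n). \<not> graph_isomorphic G H" and t: "0 < t"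
  shows "graph_poly G t < cutoff_poly t n"
proof -
  \<comment> \<open>The other two legs play symmetric roles, so B may be taken as the shorter
    one.\<close>
  have main: "graph_poly G t < cutoff_poly t n"
    if S: "list_spider (parcs G) (pverts G) c A B C" and A: "length A = 2"
        and BC: "length B \<le> length C"
    for A B C
  proof -
    have ne: "1 \<le> length B" "1 \<le> length C" using S by (auto simp: list_spider_def Suc_le_eq)
    note f = tree_list_spider_graph_poly[OF T(1) S]
    have "length B \<in> {1, 3, 5}"
    proof (rule ccontr)
      assume "length B \<notin> {1, 3, 5}"
      then have "pendent_paths_tree [2, length B, length C] \<in> S_trees' n"
        by (intro S_trees'_memI) (use n ne BC f(2) T(2) A in auto)
      then show False using spider_isomorphic_pendent[OF T(1) S] no A by auto
    qed
    then have "spider_poly t (length B) 2 (length C) < cutoff_poly t n"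
      by (intro spider_poly_short_odd_less) (use t ne n f(2) T(2) A in auto)
    then show ?thesis using f(1)[of t] t A by (simp add: spider_poly_swap12)
  qed
  have S': "list_spider (parcs G) (pverts G) c A C B"
    using S unfolding list_spider_def by (auto simp: Un_ac)
  show ?thesis using main[OF S A] main[OF S' A] by linarith
qed

lemma small_tree_energy_less:
  assumes n: "31 \<le> n" and T: "undirected_tree T" "card (pverts T) = n"
    and no: "\<forall>G\<in>insert (path_graph n) (S_trees' n). \<not> graph_isomorphic T G"
    and H: "H \<in> insert (path_graph n) (S_trees' n)"
  shows "energy T < energy H"
proof -
  have Ht: "undirected_tree H" using large_tree_undirected[OF n H] by simp
  note I = energy_less_iff[OF T(1) Ht]
  have le: "cutoff_poly t n \<le> graph_poly H t" if "0 \<le> t" for t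
    by (rule cutoff_poly_le_large_tree[OF n H that])
  have strict: "energy T < energy H" if "\<And>t. 0 < t \<Longrightarrow> graph_poly T t < cutoff_poly t n"
    by (rule energy_less_pointwise[OF T(1) Ht]) (use that le in \<open>force intro: order.strict_trans2\<close>)
  \<comment> \<open>If h bounds the polynomial of T from above, the integrand of the energy
    difference is at least the logarithm of the cutoff divided by h.\<close>
  have dom: "ln (cutoff_poly (1 / y\<^sup>2) n / h)
      \<le> ln (graph_poly H (1 / y\<^sup>2)) - ln (graph_poly T (1 / y\<^sup>2)) \<and> 0 < h"
    if "0 < y" "graph_poly T (1 / y\<^sup>2) \<le> h" for y h
  proof -
    have t: "0 \<le> 1 / y\<^sup>2" by simp
    have "0 < graph_poly T (1 / y\<^sup>2)" "0 < cutoff_poly (1 / y\<^sup>2) n"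
      using tree_graph_poly_ge_1[OF T(1) t] cutoff_poly_ge_1[OF n t] by linarith+
    then show ?thesis
      using le[OF t] that(2) by (simp add: ln_div diff_mono)
  qed
  from tree_trichotomy[OF T(1)] show ?thesis
  proof (elim disjE)
    assume "is_path (parcs T) (pverts T)"
    then obtain xs where xs: "list_path (parcs T) (pverts T) xs" by (auto simp: is_path_def)
    then have "length xs = n" using T(2) distinct_card[of xs] by (auto simp: list_path_def)
    then have "graph_isomorphic T (path_graph n)"
      using list_path_isomorphic[OF _ _ xs path_graph_list_path] T(1) path_graph_undirected[of n] n
      by (auto simp: undirected_tree_def)
    then show ?thesis using no by simp
  next
    assume "is_spider (parcs T) (pverts T)"
    then obtain c A B C where S: "list_spider (parcs T) (pverts T) c A B C"
      by (auto simp: is_spider_def)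
    note S2 = list_spider_swap12[OF S] and S3 = list_spider_swap13[OF S]
    have ne: "1 \<le> length A" "1 \<le> length B" "1 \<le> length C" using S
      by (auto simp: list_spider_def Suc_le_eq)
    note f = tree_list_spider_graph_poly[OF T(1) S]
    have len: "length A + length B + length C + 1 = n" using f(2) T(2) by simp
    \<comment> \<open>These three groups cover all lengths; 5 belongs to two of them.\<close>
    have legs: "x = 2 \<or> x \<in> {1, 3, 5} \<or> 4 \<le> x" if "1 \<le> x" for x :: nat
      using that by auto
    consider "length A = 2" | "length B = 2" | "length C = 2"
      | "length A \<in> {1, 3, 5}" | "length B \<in> {1, 3, 5}" | "length C \<in> {1, 3, 5}"
      | "4 \<le> length A" "4 \<le> length B" "4 \<le> length C"
      using legs[OF ne(1)] legs[OF ne(2)] legs[OF ne(3)] by blast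
    then show ?thesis
    proof cases
      case 1
      then show ?thesis using spider_leg_2[OF n T S _ no] strict by blast
    next
      case 2
      then show ?thesis using spider_leg_2[OF n T S2 _ no] strict by blast
    next
      case 3
      then show ?thesis using spider_leg_2[OF n T S3 _ no] strict by blast
    next
      case 4
      then show ?thesis using strict spider_poly_short_odd_less[OF _ 4 ne(2,3) len n] f(1) by simp
    next
      case 5
      have "spider_poly t (length A) (length B) (length C) < cutoff_poly t n" if "0 < t" for t
        unfolding spider_poly_swap12[of t "length A"]
          by (rule spider_poly_short_odd_less[OF that 5 ne(1,3) _ n]) (use len in simp)
      then show ?thesis using strict f(1) by simp
    next
      case 6
      have "spider_poly t (length A) (length B) (length C) < cutoff_poly t n" if "0 < t" for t
        unfolding spider_poly_swap13[of t "length A"]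
          by (rule spider_poly_short_odd_less[OF that 6 ne(2,1) _ n]) (use len in simp)
      then show ?thesis using strict f(1) by simp
    next
      case 7
      have q: "graph_poly T t \<le> long_leg_poly t n" if "0 \<le> t" for t
        using spider_poly_long_le[OF that 7 len] f(1)[OF that] by simp
      show ?thesis
        unfolding I(2) by (rule log_integral_pos_long_leg[OF n I(1)]) (use dom q in auto)
    qed
  next
    assume "\<forall>t\<ge>0. graph_poly T t \<le> nonspider_bound t (card (pverts T))"
    then have q: "graph_poly T t \<le> nonspider_bound t n" if "0 \<le> t" for t using that T(2) by simp
    show ?thesis
      unfolding I(2) by (rule log_integral_pos_nonspider[OF n I(1)]) (use dom q in auto)
  qed
qed

theorem theorem5p6:
  fixes n :: nat
  assumes "n \<ge> 31"
  shows "let L = insert (path_graph n) (S_trees' n) in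
      card (S_trees' n) = (n - 9) div 2 \<and>
      card L = (n - 7) div 2 \<and>
      (\<forall>G\<in>L. undirected_tree G \<and> card (pverts G) = n) \<and>
      (\<forall>G\<in>L. \<forall>H\<in>L. graph_isomorphic G H \<longrightarrow> G = H) \<and>
      (\<forall>T :: 'a pair_pre_digraph.
         undirected_tree T \<and> card (pverts T) = n \<and> (\<forall>G\<in>L. \<not> graph_isomorphic T G) \<longrightarrow>
         (\<forall>T'\<in>L. energy T < energy T'))"
proof -
  \<comment> \<open>The path has strictly more matchings than any member of the family, as the
    values at t = 1 show.\<close>
  have "path_graph n \<notin> S_trees' n"
  proof
    assume "path_graph n \<in> S_trees' n"
    then obtain a b where ab: "path_graph n = pendent_paths_tree [2, a, b]" "1 \<le> a" "a \<le> b" "a + b + 3 = n"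
      using mem_S_trees'[OF assms] by metis
    have "path_poly 1 n = spider_poly 1 2 a b"
      using graph_poly_path_graph[of n 1] graph_poly_pendent_tree[of 2 a b 1] ab by simp
    then show False using path_poly_pos[of 1 "a - 1"] path_poly_pos[of 1 "b - 1"] ab(4) by (simp add: spider_poly_2)
  qed
  moreover have "finite (S_trees' n)" by (simp add: S_trees'_image[OF assms])
  ultimately have "card (insert (path_graph n) (S_trees' n)) = (n - 7) div 2"
    using card_S_trees'[OF assms] assms by simp
  then show ?thesis
    unfolding Let_def
  proof (intro conjI)
    show "card (S_trees' n) = (n - 9) div 2" by (rule card_S_trees'[OF assms])
    show "\<forall>G\<in>insert (path_graph n) (S_trees' n). undirected_tree G \<and> card (pverts G) = n"
      by (rule ballI) (rule large_tree_undirected[OF assms])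
    show "\<forall>G\<in>insert (path_graph n) (S_trees' n). \<forall>H\<in>insert (path_graph n) (S_trees' n).
        graph_isomorphic G H \<longrightarrow> G = H"
      by (intro ballI impI) (rule large_trees_not_isomorphic[OF assms])
    show "\<forall>T :: 'a pair_pre_digraph. undirected_tree T \<and> card (pverts T) = n \<and>
        (\<forall>G\<in>insert (path_graph n) (S_trees' n). \<not> graph_isomorphic T G) \<longrightarrow>
        (\<forall>T'\<in>insert (path_graph n) (S_trees' n). energy T < energy T')"
      by (intro allI impI ballI, elim conjE) (rule small_tree_energy_less[OF assms])
  qed
qed

end
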